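(* Let $Z \subset \mathbb{R}^n$ be an isotropic zonotope (with non-empty interior) that is a local maximizer of the isotropic constant $K \mapsto L_K$ in the class of centrally symmetric convex bodies in $\mathbb{R}^n$. If $Z$ has a cubical zone, then $Z$ is a cube.
   Context: A convex body $K\subset\mathbb{R}^n$ is a compact convex set with non-empty interior. It is centrally symmetric if there is a point $c\in\mathbb{R}^n$ with $K-c=-(K-c)$. Its covariance matrix is $A_K = \mathbb{E}[XX^{\mathsf T}] - \mathbb{E}[X]\mathbb{E}[X]^{\mathsf T}$, where $X$ is uniformly distributed on $K$, and its isotropic constant $L_K>0$ is defined by $L_K^{2n} = \det A_K/(\mathrm{vol}\, K)^2$ (an affine invariant). $K$ is isotropic if $\mathbb{E}[X]=0$ and $A_K=I_n$. A body $P$ is a local maximizer of the isotropic constant in a class of convex bodies if it belongs to the class and there is a neighbourhood $U$ of $P$ with respect to the Hausdorff metric such that $L_K \le L_P$ for all $K \in U$ in the class. A zonotope is a set of the form $Z = c+\sum_{i=1}^m[-z_i,z_i]$ (Minkowski sum) with $c\in\mathbb{R}^n$ and $z_1,\dots,z_m\in\mathbb{R}^n\setminus\{0\}$; the $z_i$ (or the segments $[-z_i,z_i]$) are called generators, and they are irredundant if they are pairwise non-parallel (every zonotope admits irredundant generators). For irredundant generators, the zones of $Z$ are the sets $\mathcal{Z}_i=\{F \mid F \text{ is a proper face of } Z \text{ that has } [-z_i,z_i] \text{ as a Minkowski summand}\}$, $i=1,\dots,m$. A zone is cubical if all its elements are parallelepipeds (of their respective dimensions). *)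

theory Defs
  imports "HOL-Analysis.Analysis"
begin

section \<open>Convex bodies and the isotropic constant\<close>

definition convex_body :: "(real ^ 'n) set \<Rightarrow> bool" where
  "convex_body K \<longleftrightarrow> compact K \<and> convex K \<and> interior K \<noteq> {}"

definition centrally_symmetric :: "(real ^ 'n) set \<Rightarrow> bool" where
  "centrally_symmetric K \<longleftrightarrow> (\<exists>c. (\<lambda>x. x - c) ` K = uminus ` (\<lambda>x. x - c) ` K)"

definition barycenter :: "(real ^ 'n) set \<Rightarrow> real ^ 'n" where
  "barycenter K = (LINT x|uniform_measure lborel K. x)"

definition covariance_matrix :: "(real ^ 'n) set \<Rightarrow> real ^ 'n ^ 'n" where
  "covariance_matrix K =
     (\<chi> i j. (LINT x|uniform_measure lborel K. x $ i * x $ j) - barycenter K $ i * barycenter K $ j)"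

definition isotropic :: "(real ^ 'n) set \<Rightarrow> bool" where
  "isotropic K \<longleftrightarrow> barycenter K = 0 \<and> covariance_matrix K = mat 1"

definition isotropic_constant :: "(real ^ 'n) set \<Rightarrow> real" where
  "isotropic_constant K =
     root (2 * CARD('n)) (det (covariance_matrix K) / (measure lborel K)\<^sup>2)"

text \<open>The usual Hausdorff metric when both sets are nonempty and compact.\<close>

definition hausdorff_dist :: "'a::metric_space set \<Rightarrow> 'a set \<Rightarrow> real" where
  "hausdorff_dist A B = max (SUP a\<in>A. infdist a B) (SUP b\<in>B. infdist b A)"

definition local_maximizer_isotropic_constant ::
    "(real ^ 'n) set set \<Rightarrow> (real ^ 'n) set \<Rightarrow> bool" where
  "local_maximizer_isotropic_constant \<C> P \<longleftrightarrow>
     P \<in> \<C> \<and>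
     (\<exists>\<epsilon>>0. \<forall>K\<in>\<C>. hausdorff_dist K P < \<epsilon> \<longrightarrow> isotropic_constant K \<le> isotropic_constant P)"

section \<open>Zonotopes\<close>

text \<open>Sums of sets are Minkowski sums, as provided by \<^theory>\<open>HOL-Library.Set_Algebras\<close>.\<close>

definition generated_zonotope :: "real ^ 'n \<Rightarrow> nat \<Rightarrow> (nat \<Rightarrow> real ^ 'n) \<Rightarrow> (real ^ 'n) set" where
  "generated_zonotope c m z = {c} + (\<Sum>i<m. closed_segment (- z i) (z i))"

definition zonotope :: "(real ^ 'n) set \<Rightarrow> bool" where
  "zonotope Z \<longleftrightarrow> (\<exists>c m z. (\<forall>i<m. z i \<noteq> 0) \<and> Z = generated_zonotope c m z)"

definition irredundant_generators ::
    "(real ^ 'n) set \<Rightarrow> real ^ 'n \<Rightarrow> nat \<Rightarrow> (nat \<Rightarrow> real ^ 'n) \<Rightarrow> bool" where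
  "irredundant_generators Z c m z \<longleftrightarrow>
     (\<forall>i<m. z i \<noteq> 0) \<and>
     (\<forall>i<m. \<forall>j<m. i \<noteq> j \<longrightarrow> (\<nexists>r. z i = r *\<^sub>R z j)) \<and>
     Z = generated_zonotope c m z"

definition minkowski_summand :: "(real ^ 'n) set \<Rightarrow> (real ^ 'n) set \<Rightarrow> bool" where
  "minkowski_summand S F \<longleftrightarrow> (\<exists>G. compact G \<and> convex G \<and> G \<noteq> {} \<and> F = S + G)"

text \<open>The library's \<open>face_of\<close> admits the empty set and the whole set as faces;
  neither is a proper face here.\<close>

definition zone :: "(real ^ 'n) set \<Rightarrow> real ^ 'n \<Rightarrow> (real ^ 'n) set set" where
  "zone Z v = {F. F face_of Z \<and> F \<noteq> {} \<and> F \<noteq> Z \<and> minkowski_summand (closed_segment (- v) v) F}"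

text \<open>A parallelepiped may have any dimension; its dimension is \<open>card B\<close>.\<close>

definition parallelepiped :: "(real ^ 'n) set \<Rightarrow> bool" where
  "parallelepiped P \<longleftrightarrow> (\<exists>a B. independent B \<and> P = {a} + (\<Sum>b\<in>B. closed_segment 0 b))"

text \<open>Irredundant generators of a zonotope are unique up to order and signs, and
  \<^term>\<open>zone Z (- v) = zone Z v\<close>, so the choice of generators below is immaterial.\<close>

definition has_cubical_zone :: "(real ^ 'n) set \<Rightarrow> bool" where
  "has_cubical_zone Z \<longleftrightarrow>
     (\<exists>c m z. irredundant_generators Z c m z \<and> (\<exists>i<m. \<forall>F\<in>zone Z (z i). parallelepiped F))"

text \<open>Full-dimensional cubes in arbitrary position.\<close>

definition cube :: "(real ^ 'n) set \<Rightarrow> bool" where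
  "cube P \<longleftrightarrow>
     (\<exists>a r (f :: real ^ 'n \<Rightarrow> real ^ 'n). r > 0 \<and> orthogonal_transformation f \<and>
        P = (\<lambda>x. a + f x) ` cbox (vec (- r)) (vec r))"

end

theory Submission
  imports Defs
begin

text \<open>First-order optimality: tilting a facet of \<open>Z\<close> that is a parallelepiped and comparing
  determinants of second moments shows that its center \<open>p\<close> is orthogonal to the generators \<open>z j\<close> of the
  facet and that \<open>\<bar>p\<bar>\<^sup>2 + \<kappa> (\<Sum>j. \<bar>z j\<bar>\<^sup>2) = n + 2\<close>, where \<open>\<kappa> < 1\<close> depends only on \<open>n\<close>. If
  \<open>Z\<close> has exactly \<open>n\<close> generators, these conditions for all facets say that the generators are orthogonal
  and of equal length.

  Suppose that there are more than \<open>n\<close> generators. Pick a belt of facets, all inside the cubical zone if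
  \<open>n > 2\<close>. By the first-order conditions the facet centers of the belt and the generators joining them have
  constant lengths, so the belt is symmetric under a reflection in a hyperplane \<open>w\<^sup>\<bottom>\<close>, which
  permutes the generators up to sign. Moving the generators along \<open>w\<close> compatibly with this reflection gives
  zonotopes \<open>K\<close> with Steiner symmetral \<open>Z\<close>. Then \<open>K\<close> is the image of \<open>Z\<close> under a fibrewise
  shift \<open>x \<mapsto> x + M(x) w\<close>, which preserves volume and does not decrease the determinant of the
  covariance matrix; local maximality forces \<open>M\<close> to be linear. But there are compatible movements that no
  linear map induces.\<close>

section \<open>Measure-preserving maps\<close>

text \<open>In the plane every isotropic regular polygon with an even number of sides satisfies the
  first-order conditions, so they cannot suffice; this is why an exact comparison follows. As
  \<open>Z\<close> is isotropic and \<open>K\<close> has the volume of \<open>Z\<close>,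
  \<open>det A_K = 1 + \<tau> - |c|^2\<close> with \<open>c = E[M(x) x]\<close> and
  \<open>\<tau> = E[M(x)^2]\<close>. Here \<open>\<tau> - |c|^2\<close> is the mean square error of
  the best linear approximation of \<open>M\<close>, and maximality makes it vanish. The number
  \<open>n + 2\<close> comes from the logarithmic derivative of \<open>det A_K / (vol K)^2\<close>:
  mass added at \<open>x\<close> contributes \<open>|x|^2 - n\<close> through the normalised second
  moments and \<open>-2\<close> through the squared volume. The constant \<kappa> is the mean square
  of a coordinate on the cube \<open>[-1, 1]^(n-1)\<close>. Adjacent facets of a belt share the
  center \<open>p + b = p' - b'\<close> of a ridge. By Pythagoras \<open>|p|^2 + |b|^2\<close> is
  therefore constant along the belt, besides \<open>|p|^2 + \<kappa> |b|^2\<close>; since \<kappa> <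
  1, both lengths are constant. For n = 2 the zone is just a pair of opposite edges, but then all
  edges are segments and the whole boundary serves as the belt.\<close>

lemma emeasure_lborel_shift:
  fixes B :: "'a::euclidean_space set"
  assumes "B \<in> sets borel"
  shows "emeasure lborel {x. x + v \<in> B} = emeasure lborel B"
proof -
  have "emeasure lborel B = emeasure (distr lborel borel ((+) v)) B"
    by (simp add: lborel_distr_plus)
  also have "\<dots> = emeasure lborel {x. x + v \<in> B}"
    using assms by (subst emeasure_distr) (auto simp: vimage_def add.commute)
  finally show ?thesis by simp
qed

text \<open>Each level set of \<open>f\<close> is a union of lines parallel to \<open>w\<close> on
  which the map is a single translation, and there are countably many of them.\<close>

lemma emeasure_shear_countable:
  fixes f :: "'a::euclidean_space \<Rightarrow> int" and g :: "int \<Rightarrow> real"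
  assumes f[measurable]: "f \<in> borel \<rightarrow>\<^sub>M count_space UNIV"
    and inv: "\<And>x s. f (x + s *\<^sub>R w) = f x"
    and A[measurable]: "A \<in> sets borel"
  shows "emeasure lborel {x. x + g (f x) *\<^sub>R w \<in> A} = emeasure lborel A"
proof -
  have "{x. x + g (f x) *\<^sub>R w \<in> A} = (\<Union>k. {x. f x = k \<and> x + g k *\<^sub>R w \<in> A})" by auto
  also have "emeasure lborel \<dots> = (\<integral>\<^sup>+k. emeasure lborel {x. f x = k \<and> x + g k *\<^sub>R w \<in> A} \<partial>count_space UNIV)"
    by (rule emeasure_UN_countable) (auto simp: disjoint_family_on_def)
  also have "\<dots> = (\<integral>\<^sup>+k. emeasure lborel {x. f x = k \<and> x \<in> A} \<partial>count_space UNIV)"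
  proof (rule nn_integral_cong)
    fix k
    have "{x. f x = k \<and> x + g k *\<^sub>R w \<in> A} = {x. x + g k *\<^sub>R w \<in> {x. f x = k \<and> x \<in> A}}"
      by (auto simp: inv)
    also have "emeasure lborel \<dots> = emeasure lborel {x. f x = k \<and> x \<in> A}"
      by (rule emeasure_lborel_shift) measurable
    finally show "emeasure lborel {x. f x = k \<and> x + g k *\<^sub>R w \<in> A} = emeasure lborel {x. f x = k \<and> x \<in> A}" .
  qed
  also have "\<dots> = emeasure lborel (\<Union>k. {x. f x = k \<and> x \<in> A})"
    by (rule emeasure_UN_countable[symmetric]) (auto simp: disjoint_family_on_def)
  also have "(\<Union>k. {x. f x = k \<and> x \<in> A}) = A" by auto
  finally show ?thesis .
qed

text \<open>Rounding \<open>M\<close> down to multiples of \<open>1 / (n + 1)\<close> reduces to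
  countably many translations. The indicator of an open set is lower semicontinuous, so Fatou's
  lemma passes to the limit, at the price of an inequality.\<close>

lemma emeasure_shear_open_le:
  fixes M :: "'a::euclidean_space \<Rightarrow> real"
  assumes M[measurable]: "M \<in> borel_measurable borel"
    and inv: "\<And>x s. M (x + s *\<^sub>R w) = M x"
    and A: "open A"
  shows "emeasure lborel {x. x + M x *\<^sub>R w \<in> A} \<le> emeasure lborel A"
proof -
  define F where "F = (\<lambda>n x. \<lfloor>real (Suc n) * M x\<rfloor>)"
  define G where "G = (\<lambda>n (k::int). of_int k / real (Suc n))"
  have Am[measurable]: "A \<in> sets borel" using A by auto
  have Fm[measurable]: "F n \<in> borel \<rightarrow>\<^sub>M count_space UNIV" for n unfolding F_def by measurable
  have eq: "emeasure lborel {x. x + G n (F n x) *\<^sub>R w \<in> A} = emeasure lborel A" for n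
    by (rule emeasure_shear_countable) (auto simp: F_def inv)
  have lim: "(\<lambda>n. G n (F n x)) \<longlonglongrightarrow> M x" for x
  proof (rule tendsto_sandwich[where f="\<lambda>n. M x - 1 / real (Suc n)" and h="\<lambda>n. M x"])
    show "\<forall>\<^sub>F n in sequentially. M x - 1 / real (Suc n) \<le> G n (F n x)"
    proof (intro always_eventually allI)
      fix n
      have "M x - 1 / real (Suc n) = (real (Suc n) * M x - 1) / real (Suc n)"
        by (simp add: diff_divide_distrib del: of_nat_Suc)
      also have "\<dots> \<le> G n (F n x)"
        unfolding F_def G_def by (intro divide_right_mono) linarith+
      finally show "M x - 1 / real (Suc n) \<le> G n (F n x)" .
    qed
    show "\<forall>\<^sub>F n in sequentially. G n (F n x) \<le> M x"
      unfolding F_def G_def by (intro always_eventually allI) (simp add: field_simps del: of_nat_Suc)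
    show "(\<lambda>n. M x - 1 / real (Suc n)) \<longlonglongrightarrow> M x"
      using tendsto_diff[OF tendsto_const[of "M x"] LIMSEQ_inverse_real_of_nat] by (simp add: inverse_eq_divide)
  qed simp
  have "emeasure lborel {x. x + M x *\<^sub>R w \<in> A} = (\<integral>\<^sup>+x. indicator {x. x + M x *\<^sub>R w \<in> A} x \<partial>lborel)"
    by (rule nn_integral_indicator[symmetric]) measurable
  also have "\<dots> \<le> (\<integral>\<^sup>+x. liminf (\<lambda>n. indicator {x. x + G n (F n x) *\<^sub>R w \<in> A} x) \<partial>lborel)"
  proof (rule nn_integral_mono)
    fix x
    show "indicator {x. x + M x *\<^sub>R w \<in> A} x \<le> liminf (\<lambda>n. indicator {x. x + G n (F n x) *\<^sub>R w \<in> A} x :: ennreal)"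
    proof (cases "x + M x *\<^sub>R w \<in> A")
      case True
      have "(\<lambda>n. x + G n (F n x) *\<^sub>R w) \<longlonglongrightarrow> x + M x *\<^sub>R w"
        by (intro tendsto_intros lim)
      then have ev: "\<forall>\<^sub>F n in sequentially. x + G n (F n x) *\<^sub>R w \<in> A"
        using A True topological_tendstoD by blast
      have "1 \<le> liminf (\<lambda>n. indicator {x. x + G n (F n x) *\<^sub>R w \<in> A} x :: ennreal)"
        by (rule Liminf_bounded) (use ev in \<open>auto elim!: eventually_mono\<close>)
      with True show ?thesis by simp
    qed simp
  qed
  also have "\<dots> \<le> liminf (\<lambda>n. \<integral>\<^sup>+x. indicator {x. x + G n (F n x) *\<^sub>R w \<in> A} x \<partial>lborel)"
    by (rule nn_integral_liminf) (unfold G_def, measurable)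
  also have "\<dots> = liminf (\<lambda>n. emeasure lborel {x. x + G n (F n x) *\<^sub>R w \<in> A})"
    by (subst nn_integral_indicator) (auto simp: G_def)
  also have "\<dots> = emeasure lborel A" by (simp add: eq Liminf_const)
  finally show ?thesis .
qed

text \<open>Outer regularity carries the bound from open sets to Borel sets.\<close>

lemma emeasure_shear_le:
  fixes M :: "'a::euclidean_space \<Rightarrow> real"
  assumes M[measurable]: "M \<in> borel_measurable borel"
    and inv: "\<And>x s. M (x + s *\<^sub>R w) = M x"
    and A[measurable]: "A \<in> sets borel"
  shows "emeasure lborel {x. x + M x *\<^sub>R w \<in> A} \<le> emeasure lborel A"
proof (rule ennreal_le_epsilon)
  fix e :: real assume e: "0 < e" and fin: "emeasure lborel A < top"
  obtain U where U: "open U" "A \<subseteq> U" "emeasure lborel (U - A) < ennreal e"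
    using outer_regular_lborel[OF A e] by metis
  have [measurable]: "U \<in> sets borel" using U by auto
  have "emeasure lborel {x. x + M x *\<^sub>R w \<in> A} \<le> emeasure lborel {x. x + M x *\<^sub>R w \<in> U}"
    by (rule emeasure_mono) (use U in auto)
  also have "\<dots> \<le> emeasure lborel U"
    by (rule emeasure_shear_open_le[OF M inv U(1)])
  also have "\<dots> \<le> emeasure lborel A + emeasure lborel (U - A)"
    by (metis A U(2) \<open>U \<in> sets borel\<close> Diff_partition emeasure_subadditive sets.Diff sets_lborel)
  also have "\<dots> \<le> emeasure lborel A + ennreal e" using U by (intro add_left_mono) auto
  finally show "emeasure lborel {x. x + M x *\<^sub>R w \<in> A} \<le> emeasure lborel A + ennreal e" .
qed

text \<open>The reverse inequality is the one-sided bound for the shear by \<open>- M\<close>, which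
  is the inverse map precisely because \<open>M\<close> is constant along \<open>w\<close>.\<close>

lemma distr_lborel_shear:
  fixes M :: "'a::euclidean_space \<Rightarrow> real"
  assumes M[measurable]: "M \<in> borel_measurable borel"
    and inv: "\<And>x s. M (x + s *\<^sub>R w) = M x"
  shows "distr lborel borel (\<lambda>x. x + M x *\<^sub>R w) = lborel"
proof (rule measure_eqI)
  fix A assume "A \<in> sets (distr lborel borel (\<lambda>x. x + M x *\<^sub>R w))"
  then have A[measurable]: "A \<in> sets borel" by simp
  have 1: "emeasure lborel {x. x + M x *\<^sub>R w \<in> A} \<le> emeasure lborel A"
    by (rule emeasure_shear_le[OF M inv A])
  let ?B = "{x. x + M x *\<^sub>R w \<in> A}"
  have B: "?B \<in> sets borel" by measurable
  have inv': "- M (x + s *\<^sub>R w) = - M x" for x s by (simp add: inv)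
  have "emeasure lborel {x. x + (- M x) *\<^sub>R w \<in> ?B} \<le> emeasure lborel ?B"
    by (rule emeasure_shear_le[OF _ inv' B]) measurable
  also have "{x. x + (- M x) *\<^sub>R w \<in> ?B} = A" by (simp only: mem_Collect_eq inv) auto
  finally show "emeasure (distr lborel borel (\<lambda>x. x + M x *\<^sub>R w)) A = emeasure lborel A"
    using 1 by (subst emeasure_distr) (auto simp: vimage_def)
qed simp

lemma lborel_integral_shear:
  fixes M :: "'a::euclidean_space \<Rightarrow> real" and g :: "'a \<Rightarrow> 'b::{banach, second_countable_topology}"
  assumes M[measurable]: "M \<in> borel_measurable borel"
    and inv: "\<And>x s. M (x + s *\<^sub>R w) = M x"
    and g: "g \<in> borel_measurable borel"
  shows "(LINT x|lborel. g (x + M x *\<^sub>R w)) = (LINT x|lborel. g x)"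
  by (subst (2) distr_lborel_shear[OF M inv, symmetric], subst integral_distr) (use g in auto)

section \<open>Linear changes of variables\<close>

lemma distr_density_comp:
  fixes f g :: "'a::euclidean_space \<Rightarrow> 'a"
  assumes f: "f \<in> borel_measurable borel" "distr lborel borel f = density lborel (\<lambda>_. ennreal C)"
    and g: "g \<in> borel_measurable borel" "distr lborel borel g = density lborel (\<lambda>_. ennreal D)"
    and "C \<ge> 0" "D \<ge> 0"
  shows "distr lborel borel (f \<circ> g) = density lborel (\<lambda>_. ennreal (C * D))"
proof (rule measure_eqI)
  fix A assume "A \<in> sets (distr lborel borel (f \<circ> g))"
  then have A: "A \<in> sets borel" by simp
  have fA: "f -` A \<in> sets borel" using measurable_sets_borel[OF f(1) A] by simp
  have F: "emeasure lborel (f -` A) = ennreal C * emeasure lborel A"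
    using arg_cong[OF f(2), of "\<lambda>M. emeasure M A"] A f(1)
    by (simp add: emeasure_distr emeasure_density nn_integral_cmult)
  have G: "emeasure lborel (g -` B) = ennreal D * emeasure lborel B" if "B \<in> sets borel" for B
    using arg_cong[OF g(2), of "\<lambda>M. emeasure M B"] that g(1)
    by (simp add: emeasure_distr emeasure_density nn_integral_cmult)
  show "emeasure (distr lborel borel (f \<circ> g)) A = emeasure (density lborel (\<lambda>_. ennreal (C * D))) A"
    using A f(1) g(1) measurable_comp[OF g(1) f(1)] G[OF fA] F \<open>C \<ge> 0\<close> \<open>D \<ge> 0\<close>
    by (subst emeasure_distr)
       (auto simp: emeasure_density nn_integral_cmult vimage_comp[symmetric] ennreal_mult mult_ac
          intro: measurable_compose)
qed simp

lemma distr_lborel_coordinate_scaling: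
  fixes c :: "'n::finite \<Rightarrow> real"
  assumes c: "\<And>i. c i \<noteq> 0"
  shows "distr lborel borel (\<lambda>x::real^'n. \<chi> i. c i * x $ i) = density lborel (\<lambda>_. ennreal (inverse (\<Prod>i\<in>UNIV. \<bar>c i\<bar>)))"
proof -
  \<comment> \<open>The affine change of variables is indexed by basis vectors, so \<open>c\<close>
    is transported along \<open>i \<mapsto> axis i 1\<close>.\<close>
  define c' where "c' = (\<lambda>j::real^'n. c (THE i. j = axis i 1))"
  have c'_axis: "c' (axis i 1) = c i" for i
    unfolding c'_def by (rule arg_cong[where f=c], rule the_equality) (auto simp: axis_eq_axis)
  have basis: "(Basis :: (real^'n) set) = (\<lambda>i. axis i 1) ` UNIV"
    by (auto simp: Basis_vec_def)
  have inj: "inj (\<lambda>i::'n. axis i (1::real))" by (auto simp: inj_on_def axis_eq_axis)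
  define T :: "real^'n \<Rightarrow> real^'n" where "T = (\<lambda>x. \<chi> i. c i * x $ i)"
  have T: "(0 + (\<Sum>j\<in>Basis. (c' j * (x \<bullet> j)) *\<^sub>R j)) = T x" for x :: "real^'n"
    unfolding basis
    by (subst sum.reindex[OF inj])
       (use basis_expansion[of "T x"] in \<open>simp add: c'_axis T_def inner_axis scalar_mult_eq_scaleR\<close>)
  have c'nz: "\<And>j. j \<in> Basis \<Longrightarrow> c' j \<noteq> 0" using c by (auto simp: basis c'_axis)
  have P: "(\<Prod>j\<in>Basis. \<bar>c' j\<bar>) = (\<Prod>i\<in>UNIV. \<bar>c i\<bar>)"
    unfolding basis by (subst prod.reindex[OF inj]) (simp add: c'_axis)
  let ?P = "\<Prod>i\<in>UNIV. \<bar>c i\<bar>"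
  have Ppos: "?P > 0" using c by (intro prod_pos) auto
  have eq: "lborel = density (distr lborel borel T) (\<lambda>_. ennreal ?P)"
    by (rule lborel_affine_euclidean[where c = c' and t = 0, OF c'nz, unfolded T P])
  have Tm: "T \<in> borel_measurable borel"
    unfolding T_def by (intro borel_measurable_continuous_onI continuous_intros)
  have "density lborel (\<lambda>_. ennreal (inverse ?P)) = density (density (distr lborel borel T) (\<lambda>_. ennreal ?P)) (\<lambda>_. ennreal (inverse ?P))"
    using eq by simp
  also have "\<dots> = density (distr lborel borel T) (\<lambda>_. ennreal ?P * ennreal (inverse ?P))"
    by (subst density_density_eq) auto
  also have "ennreal ?P * ennreal (inverse ?P) = 1"
    using Ppos by (simp flip: ennreal_mult add: less_imp_le prod_nonneg del: prod_pos) (metis ennreal_1 less_numeral_extra(3) right_inverse)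
  also have "density (distr lborel borel T) (\<lambda>_. 1) = distr lborel borel T"
    by (rule density_1)
  finally show ?thesis by (simp add: T_def)
qed

lemma distr_lborel_elementary_shear:
  fixes m n :: "'n::finite"
  assumes "m \<noteq> n"
  shows "distr lborel borel (\<lambda>x::real^'n. \<chi> i. if i = m then x$m + c * x$n else x$i) = lborel"
proof -
  have "distr lborel borel (\<lambda>x::real^'n. x + (c * x $ n) *\<^sub>R axis m 1) = lborel"
    by (rule distr_lborel_shear) (use assms in \<open>auto simp: axis_def algebra_simps\<close>)
  also have "(\<lambda>x::real^'n. x + (c * x $ n) *\<^sub>R axis m 1) = (\<lambda>x. \<chi> i. if i = m then x$m + c * x$n else x$i)"
    by (auto simp: fun_eq_iff vec_eq_iff axis_def)
  finally show ?thesis .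
qed

text \<open>Jacobian factors multiply under composition, so induction over elementary maps applies.
  Only the existence of a positive factor is recorded: later it cancels from an inequality with
  right-hand side 0 or is determined by testing on a ball.\<close>

lemma distr_lborel_linear:
  fixes f :: "real^'n::finite \<Rightarrow> real^'n"
  assumes "linear f" "inj f"
  shows "\<exists>C>0. distr lborel borel f = density lborel (\<lambda>_. ennreal C)"
proof -
  let ?P = "\<lambda>f::real^'n \<Rightarrow> real^'n. linear f \<longrightarrow> inj f \<longrightarrow> (\<exists>C>0. distr lborel borel f = density lborel (\<lambda>_. ennreal C))"
  have meas: "f \<in> borel_measurable borel" if "linear f" for f :: "real^'n \<Rightarrow> real^'n"
    using that by (intro borel_measurable_continuous_onI linear_continuous_on linear_conv_bounded_linear[THEN iffD1])
  have d1: "density lborel (\<lambda>_. 1) = (lborel :: (real^'n) measure)" by (rule density_1)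
  have shear: "distr lborel borel (\<lambda>x::real^'n. \<chi> i. if i = m then x$m + c * x$n else x$i) = density lborel (\<lambda>_. ennreal 1)"
    if "m \<noteq> n" for m n c
    using distr_lborel_elementary_shear[OF that, of c] by (simp add: d1)
  have shm: "(\<lambda>x::real^'n. \<chi> i. if i = m then x$m + c * x$n else x$i) \<in> borel_measurable borel" for m n c
    by (intro meas linearI) (auto simp: vec_eq_iff algebra_simps)
  have "?P f"
  proof (rule induct_linear_elementary[OF \<open>linear f\<close>])
    fix f g :: "real^'n \<Rightarrow> real^'n"
    assume f: "linear f" and g: "linear g" and "?P f" "?P g"
    show "?P (f \<circ> g)"
    proof (intro impI)
      assume "inj (f \<circ> g)"
      then have "inj g" by (rule inj_on_imageI2)
      then have "surj g" using g linear_injective_imp_surjective by blast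
      then have "inj f" using \<open>inj (f \<circ> g)\<close>
        by (metis inj_on_imageI)
      obtain C D where "C > 0" "D > 0" "distr lborel borel f = density lborel (\<lambda>_. ennreal C)"
        "distr lborel borel g = density lborel (\<lambda>_. ennreal D)"
        using \<open>?P f\<close> \<open>?P g\<close> f g \<open>inj f\<close> \<open>inj g\<close> by blast
      then show "\<exists>C>0. distr lborel borel (f \<circ> g) = density lborel (\<lambda>_. ennreal C)"
        using distr_density_comp[OF meas[OF f] _ meas[OF g], of C D]
        by (intro exI[of _ "C * D"]) auto
    qed
  next
    fix f :: "real^'n \<Rightarrow> real^'n" and i assume f: "linear f" and 0: "\<And>x. f x $ i = 0"
    have "\<not> surj f"
    proof
      assume "surj f" then obtain x where "f x = axis i 1" by (metis surjD)
      with 0[of x] show False by (simp add: axis_def)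
    qed
    then show "?P f" using linear_injective_imp_surjective by blast
  next
    fix c :: "'n \<Rightarrow> real"
    show "?P (\<lambda>x. \<chi> i. c i * x $ i)"
    proof (intro impI)
      assume inj: "inj (\<lambda>x::real^'n. \<chi> i. c i * x $ i)"
      have c: "c i \<noteq> 0" for i
      proof
        assume "c i = 0"
        then have "(\<chi> j. c j * (axis i 1 :: real^'n) $ j) = (\<chi> j. c j * 0 $ j)"
          by (auto simp: vec_eq_iff axis_def)
        from injD[OF inj this] show False by simp
      qed
      show "\<exists>C>0. distr lborel borel (\<lambda>x::real^'n. \<chi> i. c i * x $ i) = density lborel (\<lambda>_. ennreal C)"
        using c by (intro exI[of _ "inverse (\<Prod>i\<in>UNIV. \<bar>c i\<bar>)"] conjI distr_lborel_coordinate_scaling)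
          (auto intro!: prod_pos)
    qed
  next
    fix m n :: 'n assume mn: "m \<noteq> n"
    \<comment> \<open>A coordinate swap consists of three shears and a sign change:
      \<open>(a, b)\<close> goes to \<open>(a + b, b)\<close>, then \<open>(a + b, - a)\<close>,
      then \<open>(b, - a)\<close>, then \<open>(b, a)\<close>.\<close>
    let ?S1 = "\<lambda>x::real^'n. \<chi> i. if i = m then x$m + 1 * x$n else x$i"
    let ?S2 = "\<lambda>x::real^'n. \<chi> i. if i = n then x$n + (-1) * x$m else x$i"
    let ?N = "\<lambda>x::real^'n. \<chi> i. (if i = n then -1 else 1) * x$i"
    have N: "distr lborel borel ?N = density lborel (\<lambda>_. ennreal 1)"
      by (subst distr_lborel_coordinate_scaling) (auto simp: if_distrib cong: if_cong)
    have lin: "linear ?S1" "linear ?S2" by (auto intro!: linearI simp: vec_eq_iff algebra_simps)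
    have Nm: "?N \<in> borel_measurable borel" by (intro meas linearI) (auto simp: vec_eq_iff)
    have "distr lborel borel (?N \<circ> (?S1 \<circ> (?S2 \<circ> ?S1))) = density lborel (\<lambda>_. ennreal (1 * (1 * (1 * 1))))"
      by (intro distr_density_comp shear N Nm shm meas[OF linear_compose] linear_compose lin mn mn[symmetric]) auto
    also have "?N \<circ> (?S1 \<circ> (?S2 \<circ> ?S1)) = (\<lambda>x. \<chi> i. x $ Transposition.transpose m n i)"
      using mn by (auto simp: fun_eq_iff vec_eq_iff transpose_def)
    finally show "?P (\<lambda>x. \<chi> i. x $ Transposition.transpose m n i)"
      by (auto intro!: exI[of _ 1])
  next
    fix m n :: 'n assume mn: "m \<noteq> n"
    show "?P (\<lambda>x. \<chi> i. if i = m then x$m + x$n else x$i)"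
      using shear[OF mn, of 1] unfolding mult_1 by (intro impI exI[of _ 1]) (simp del: ennreal_1)
  qed
  with assms show ?thesis by blast
qed

lemma lborel_integral_linear:
  fixes f :: "real^'n::finite \<Rightarrow> real^'n"
  assumes "linear f" "inj f"
  obtains C where "C > 0"
    "\<And>g::real^'n \<Rightarrow> real. g \<in> borel_measurable borel \<Longrightarrow> (LINT x|lborel. g (f x)) = C * (LINT x|lborel. g x)"
proof -
  obtain C where C: "C > 0" "distr lborel borel f = density lborel (\<lambda>_. ennreal C)"
    using distr_lborel_linear[OF assms] by blast
  have fm: "f \<in> borel_measurable borel"
    using assms(1) by (intro borel_measurable_continuous_onI linear_continuous_on linear_conv_bounded_linear[THEN iffD1])
  have "(LINT x|lborel. g (f x)) = C * (LINT x|lborel. g x)" if g: "g \<in> borel_measurable borel" for g :: "real^'n \<Rightarrow> real"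
  proof -
    have "(LINT x|lborel. g (f x)) = (LINT x|distr lborel borel f. g x)"
      using fm g by (subst integral_distr) auto
    also have "\<dots> = C * (LINT x|lborel. g x)"
      unfolding C(2) using C(1) g by (subst integral_density) auto
    finally show ?thesis .
  qed
  then show ?thesis using C(1) that[of C] by blast
qed

text \<open>The unit ball is its own preimage and has positive finite measure, which forces the
  factor to be 1.\<close>

lemma distr_lborel_orthogonal:
  fixes f :: "real^'n::finite \<Rightarrow> real^'n"
  assumes f: "orthogonal_transformation f"
  shows "distr lborel borel f = lborel"
proof -
  have lin: "linear f" "inj f"
    using f by (auto simp: orthogonal_transformation_linear orthogonal_transformation_inj)
  obtain C where C: "C > 0" "distr lborel borel f = density lborel (\<lambda>_. ennreal C)"
    using distr_lborel_linear[OF lin] by blast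
  have fm: "f \<in> borel_measurable borel"
    using lin by (intro borel_measurable_continuous_onI linear_continuous_on linear_conv_bounded_linear[THEN iffD1])
  let ?B = "ball (0::real^'n) 1"
  have "emeasure (distr lborel borel f) ?B = ennreal C * emeasure lborel ?B"
    unfolding C(2) by (subst emeasure_density) (auto simp: nn_integral_cmult_indicator)
  moreover have "emeasure (distr lborel borel f) ?B = emeasure lborel (f -` ?B)"
    using fm by (subst emeasure_distr) auto
  moreover have "f -` ?B = ?B"
    using orthogonal_transformation_norm[OF f] by auto
  ultimately have eq: "ennreal C * emeasure lborel ?B = emeasure lborel ?B" by simp
  have b: "emeasure lborel ?B = ennreal (measure lborel ?B)"
    using emeasure_lborel_ball_finite[of "0::real^'n" 1] by (simp add: emeasure_eq_ennreal_measure)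
  have "measure lborel ?B > 0" using content_ball_pos[of 1 "0::real^'n"] by simp
  with eq C(1) have "C = 1" unfolding b by (simp flip: ennreal_mult)
  then show ?thesis by (simp add: C(2) density_1)
qed

lemma lborel_integral_orthogonal:
  fixes f :: "real^'n::finite \<Rightarrow> real^'n" and g :: "real^'n \<Rightarrow> 'b::{banach, second_countable_topology}"
  assumes f: "orthogonal_transformation f" and g: "g \<in> borel_measurable borel"
  shows "(LINT x|lborel. g (f x)) = (LINT x|lborel. g x)"
proof -
  have "f \<in> borel_measurable borel"
    using f by (intro borel_measurable_continuous_onI linear_continuous_on
      linear_conv_bounded_linear[THEN iffD1] orthogonal_transformation_linear)
  then show ?thesis
    using g by (subst (2) distr_lborel_orthogonal[OF f, symmetric], subst integral_distr) auto
qed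

section \<open>Moments of convex bodies\<close>

lemma integral_uniform_lborel:
  fixes f :: "'a::euclidean_space \<Rightarrow> 'b::{banach, second_countable_topology}"
  assumes K: "K \<in> sets borel" "emeasure lborel K < \<infinity>" "0 < measure lborel K"
    and f: "f \<in> borel_measurable borel"
  shows "(LINT x|uniform_measure lborel K. f x) = (LINT x:K|lborel. f x) /\<^sub>R measure lborel K"
proof -
  let ?v = "measure lborel K"
  have v: "emeasure lborel K = ennreal ?v"
    using K(2) by (simp add: emeasure_eq_ennreal_measure)
  have dens: "indicator K x / emeasure lborel K = ennreal (indicator K x / ?v)" for x
    unfolding v using K(3) by (auto simp: indicator_def divide_ennreal[symmetric] ennreal_1[symmetric] simp del: ennreal_1)
  have "(LINT x|uniform_measure lborel K. f x) = (LINT x|lborel. (indicator K x / ?v) *\<^sub>R f x)"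
    unfolding uniform_measure_def dens using K f by (subst integral_density) auto
  also have "\<dots> = (LINT x|lborel. (1 / ?v) *\<^sub>R (indicator K x *\<^sub>R f x))"
    by (simp add: field_simps)
  also have "\<dots> = (LINT x:K|lborel. f x) /\<^sub>R ?v"
    by (subst integral_scaleR_right) (auto simp: set_lebesgue_integral_def inverse_eq_divide)
  finally show ?thesis .
qed

lemma convex_body_measure:
  assumes "convex_body K"
  shows "compact K" "convex K" "K \<in> sets borel" "emeasure lborel K < \<infinity>" "0 < measure lborel K"
proof -
  show K: "compact K" "convex K" using assms by (auto simp: convex_body_def)
  then show "K \<in> sets borel" "emeasure lborel K < \<infinity>"
    using emeasure_compact_finite[of K] by (auto intro: borel_compact simp: top.not_eq_extremum)
  obtain x e where "e > 0" "ball x e \<subseteq> K"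
    using assms by (auto simp: convex_body_def mem_interior)
  then have "measure lborel (ball x e) \<le> measure lborel K"
    using K \<open>emeasure lborel K < \<infinity>\<close> \<open>K \<in> sets borel\<close>
    by (intro measure_mono_fmeasurable fmeasurableI) auto
  then show "0 < measure lborel K"
    using content_ball_pos[OF \<open>e > 0\<close>, of x] by linarith
qed

lemma set_integrable_continuous_compact:
  fixes f :: "'a::euclidean_space \<Rightarrow> 'b::{banach, second_countable_topology}"
  assumes "compact K" "continuous_on UNIV f"
  shows "set_integrable lborel K f"
  unfolding set_integrable_def
  by (rule borel_integrable_compact[OF assms(1)]) (rule continuous_on_subset[OF assms(2)], simp)

lemma lborel_integral_reflect:
  fixes g :: "'a::euclidean_space \<Rightarrow> 'b::{banach, second_countable_topology}"
  assumes "g \<in> borel_measurable borel"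
  shows "(LINT x|lborel. g (c - x)) = (LINT x|lborel. g x)"
proof -
  have "lborel = density (distr lborel borel (\<lambda>x::'a. c + (-1) *\<^sub>R x)) (\<lambda>_. ennreal (\<bar>-1\<bar> ^ DIM('a)))"
    using lborel_affine[of "-1" c] by simp
  then have "lborel = distr lborel borel (\<lambda>x::'a. c - x)"
    by (simp add: density_1)
  then have "(LINT x|lborel. g x) = (LINT x|distr lborel borel (\<lambda>x::'a. c - x). g x)" by simp
  also have "\<dots> = (LINT x|lborel. g (c - x))"
    using assms by (subst integral_distr) auto
  finally show ?thesis by simp
qed

lemma set_integral_reflect:
  fixes g :: "'a::euclidean_space \<Rightarrow> 'b::{banach, second_countable_topology}"
  assumes "K \<in> sets borel" "g \<in> borel_measurable borel" "\<And>x. c - x \<in> K \<longleftrightarrow> x \<in> K"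
  shows "(LINT x:K|lborel. g (c - x)) = (LINT x:K|lborel. g x)"
proof -
  have "(LINT x|lborel. indicat_real K (c - x) *\<^sub>R g (c - x)) = (LINT x|lborel. indicat_real K x *\<^sub>R g x)"
    by (rule lborel_integral_reflect) (use assms in measurable)
  moreover have "indicat_real K (c - x) = indicat_real K x" for x
    using assms(3) by (auto simp: indicator_def)
  ultimately show ?thesis by (simp add: set_lebesgue_integral_def)
qed

text \<open>Reflection in \<open>c\<close> preserves \<open>K\<close>, so \<open>x\<close> and
  \<open>2 c - x\<close> have the same integral over \<open>K\<close>.\<close>

lemma barycenter_symmetric:
  assumes K: "convex_body K" and sym: "\<And>x. 2 *\<^sub>R c - x \<in> K \<longleftrightarrow> x \<in> K"
  shows "barycenter K = c"
proof -
  note m = convex_body_measure[OF K]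
  have int: "set_integrable lborel K (\<lambda>x. x)" "set_integrable lborel K (\<lambda>x. 2 *\<^sub>R c)"
    by (auto intro!: set_integrable_continuous_compact m continuous_intros)
  have "(LINT x:K|lborel. 2 *\<^sub>R c - x) = (LINT x:K|lborel. x)"
    by (rule set_integral_reflect) (use m sym in auto)
  moreover have "(LINT x:K|lborel. 2 *\<^sub>R c - x) = (LINT x:K|lborel. 2 *\<^sub>R c) - (LINT x:K|lborel. x)"
    using int by (rule set_integral_diff(2)[rotated])
  moreover have "(LINT x:K|lborel. 2 *\<^sub>R c) = measure lborel K *\<^sub>R (2 *\<^sub>R c)"
    using m unfolding set_lebesgue_integral_def by (simp add: integral_indicator)
  ultimately have "(LINT x:K|lborel. x) + (LINT x:K|lborel. x) = measure lborel K *\<^sub>R (2 *\<^sub>R c)"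
    by (metis diff_add_cancel)
  then have "2 *\<^sub>R (LINT x:K|lborel. x) = 2 *\<^sub>R (measure lborel K *\<^sub>R c)"
    unfolding scaleR_2[of "LINT x:K|lborel. x"] by (simp only: scaleR_scaleR mult.commute)
  then have "(LINT x:K|lborel. x) = measure lborel K *\<^sub>R c"
    by (metis scaleR_cancel_left zero_neq_numeral)
  then show ?thesis
    unfolding barycenter_def using m by (subst integral_uniform_lborel) auto
qed

lemma covariance_matrix_symmetric:
  fixes K :: "(real^'n::finite) set"
  assumes K: "convex_body K" and sym: "\<And>x. - x \<in> K \<longleftrightarrow> x \<in> K"
  shows "covariance_matrix K = (\<chi> i j. (LINT x:K|lborel. x $ i * x $ j) / measure lborel K)"
proof -
  note m = convex_body_measure[OF K]
  have "barycenter K = 0" by (rule barycenter_symmetric[OF K]) (use sym in simp)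
  then show ?thesis
    unfolding covariance_matrix_def using m
    by (subst integral_uniform_lborel) (auto simp: field_simps)
qed

lemma hausdorff_dist_le:
  assumes "A \<noteq> {}" "B \<noteq> {}"
    and "\<And>a. a \<in> A \<Longrightarrow> \<exists>b\<in>B. dist a b \<le> e" "\<And>b. b \<in> B \<Longrightarrow> \<exists>a\<in>A. dist b a \<le> e"
  shows "hausdorff_dist A B \<le> e"
  unfolding hausdorff_dist_def
  using assms by (intro max.boundedI cSUP_least) (auto intro: infdist_le2)

lemma centrally_symmetricI:
  assumes "\<And>x. - x \<in> K \<longleftrightarrow> x \<in> K"
  shows "centrally_symmetric K"
  unfolding centrally_symmetric_def
  by (rule exI[of _ 0]) (use assms in \<open>auto simp: image_iff, metis minus_minus\<close>)

text \<open>A form of local maximality without roots: \<open>A_Z\<close> is the identity, so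
  comparing isotropic constants amounts to comparing \<open>det A_K\<close> with a quotient of
  squared volumes. Competitors are centered at the origin, where the covariance is the plain second
  moment matrix.\<close>

lemma isotropic_local_maximizer_det:
  fixes Z :: "(real^'n::finite) set"
  assumes "isotropic Z"
    and lm: "local_maximizer_isotropic_constant {K. convex_body K \<and> centrally_symmetric K} Z"
  obtains \<epsilon> where "\<epsilon> > 0"
    "\<And>K. convex_body K \<Longrightarrow> (\<And>x. - x \<in> K \<longleftrightarrow> x \<in> K) \<Longrightarrow> hausdorff_dist K Z < \<epsilon> \<Longrightarrow>
      det (\<chi> i j. (LINT x:K|lborel. x $ i * x $ j) / measure lborel K) * (measure lborel Z)\<^sup>2 \<le> (measure lborel K)\<^sup>2"
proof -
  obtain \<epsilon> where e: "\<epsilon> > 0" "\<And>K. convex_body K \<Longrightarrow> centrally_symmetric K \<Longrightarrow> hausdorff_dist K Z < \<epsilon> \<Longrightarrow>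
     isotropic_constant K \<le> isotropic_constant Z" and Z: "convex_body Z"
    using lm unfolding local_maximizer_isotropic_constant_def by auto
  have "det (\<chi> i j. (LINT x:K|lborel. x $ i * x $ j) / measure lborel K) * (measure lborel Z)\<^sup>2 \<le> (measure lborel K)\<^sup>2"
    if K: "convex_body K" "\<And>x. - x \<in> K \<longleftrightarrow> x \<in> K" "hausdorff_dist K Z < \<epsilon>" for K
  proof -
    have "isotropic_constant K \<le> isotropic_constant Z"
      by (rule e(2)) (use K in \<open>auto intro: centrally_symmetricI\<close>)
    then have "det (covariance_matrix K) / (measure lborel K)\<^sup>2 \<le> 1 / (measure lborel Z)\<^sup>2"
      unfolding isotropic_constant_def using \<open>isotropic Z\<close>
      by (simp add: isotropic_def det_I)
    then show ?thesis
      unfolding covariance_matrix_symmetric[OF K(1,2)]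
      using convex_body_measure(5)[OF Z] convex_body_measure(5)[OF K(1)] by (simp add: field_simps)
  qed
  with e(1) that show ?thesis by blast
qed

section \<open>Steiner symmetrization\<close>

lemma matrix_add_rdistrib_real:
  fixes A B C :: "real^'n^'n"
  shows "(A + B) ** C = A ** C + B ** C"
  by (simp add: vec_eq_iff matrix_matrix_mult_def algebra_simps sum.distrib)

definition outer :: "real^'n \<Rightarrow> real^'n \<Rightarrow> real^'n^'n" where
  "outer u v = (\<chi> i j. u $ i * v $ j)"

text \<open>Only row \<open>k\<close> differs from the identity; adding to it multiples of the other
  rows, which are unit vectors, connects the matrix with a diagonal one.\<close>

lemma det_one_plus_axis_outer:
  fixes v :: "real^'n::finite"
  shows "det (mat 1 + outer (axis k 1) v) = 1 + v $ k"
proof -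
  define A :: "real^'n^'n" where "A = (\<chi> i j. if i = j then (if i = k then 1 + v $ k else 1) else 0)"
  define x where "x = (\<Sum>j\<in>UNIV - {k}. v $ j *s axis j 1)"
  have rowA: "row i A = (if i = k then (1 + v $ k) *s axis k 1 else axis i 1)" for i
    by (auto simp: A_def row_def vec_eq_iff axis_def)
  have xs: "x \<in> vec.span {row j A |j. j \<noteq> k}"
    unfolding x_def by (intro vec.span_sum vec.span_scale vec.span_base) (auto simp: rowA)
  have xj: "x $ j = (if j = k then 0 else v $ j)" for j
    unfolding x_def by (auto simp: sum_component axis_def if_distrib cong: if_cong)
  have "det (\<chi> l. if l = k then row k A + x else row l A) = det A"
    by (rule det_row_span[OF xs])
  also have "(\<chi> l. if l = k then row k A + x else row l A) = mat 1 + outer (axis k 1) v"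
    by (auto simp: vec_eq_iff rowA xj mat_def outer_def axis_def)
  also have "det A = (\<Prod>i\<in>UNIV. A $ i $ i)"
    by (rule det_diagonal) (auto simp: A_def)
  also have "\<dots> = 1 + v $ k"
    by (simp add: A_def prod.delta)
  finally show ?thesis .
qed

text \<open>An orthogonal conjugation turns \<open>u\<close> into a multiple of
  \<open>axis k 1\<close>, which is the case already treated.\<close>

lemma det_one_plus_outer:
  fixes u v :: "real^'n::finite"
  shows "det (mat 1 + outer u v) = 1 + u \<bullet> v"
proof -
  obtain k :: 'n where True by simp
  have "norm (axis k (norm u) :: real^'n) = norm u"
    by (simp add: norm_eq_sqrt_inner inner_axis_axis)
  from orthogonal_transformation_exists[OF this] obtain f :: "real^'n \<Rightarrow> real^'n"
    where f: "orthogonal_transformation f" "f (axis k (norm u)) = u" by blast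
  define Q where "Q = matrix f"
  have Q: "orthogonal_matrix Q" "Q *v axis k (norm u) = u"
    using f by (auto simp: Q_def orthogonal_transformation_matrix matrix_works)
  have QQ: "transpose Q ** Q = mat 1" "Q ** transpose Q = mat 1"
    using Q(1) by (auto simp: orthogonal_matrix_def)
  define v' where "v' = norm u *s (transpose Q *v v)"
  have "Q ** (mat 1 + outer (axis k 1) v') ** transpose Q = mat 1 + outer u v"
  proof -
    have o: "Q ** outer a b ** transpose Q = outer (Q *v a) (Q *v b)" for a b
      by (simp add: vec_eq_iff matrix_matrix_mult_def outer_def matrix_vector_mult_def transpose_def
          sum_distrib_left sum_distrib_right mult_ac)
    have "outer (axis k 1) v' = outer (axis k (norm u)) (transpose Q *v v)"
      by (auto simp: outer_def v'_def vec_eq_iff axis_def)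
    moreover have QQv: "Q *v (transpose Q *v v) = v"
      by (simp only: matrix_vector_mul_assoc QQ matrix_vector_mul_lid)
    ultimately have "Q ** outer (axis k 1) v' ** transpose Q = outer u v"
      using QQv by (simp add: o Q(2) del: transpose_matrix_vector)
    then show ?thesis
      by (simp add: matrix_add_ldistrib matrix_add_rdistrib_real QQ)
  qed
  then have "det (mat 1 + outer u v) = det Q * det (mat 1 + outer (axis k 1) v') * det Q"
    by (metis det_mul det_transpose)
  also have "\<dots> = (det Q * det Q) * (1 + v' $ k)"
    by (simp add: det_one_plus_axis_outer)
  also have "det Q * det Q = 1"
    using QQ(1) by (metis det_I det_mul det_transpose)
  also have "v' $ k = u \<bullet> v"
  proof -
    have "v' $ k = axis k (norm u) \<bullet> (transpose Q *v v)"
      by (simp add: v'_def inner_axis')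
    also have "\<dots> = (Q *v axis k (norm u)) \<bullet> v"
      by (metis dot_lmul_matrix transpose_matrix_vector transpose_transpose)
    finally show ?thesis by (simp add: Q)
  qed
  finally show ?thesis by simp
qed

text \<open>This is the covariance matrix of \<open>x + M(x) w\<close> for isotropic
  \<open>x\<close>, with \<open>c = E[M(x) x]\<close> and \<open>\<tau> = E[M(x)^2]\<close>. It
  factors as \<open>(1 + w c^T) (1 + ?k w w^T) (1 + c w^T)\<close>, and since \<open>c\<close> is
  orthogonal to \<open>w\<close> the outer factors have determinant 1.\<close>

lemma det_shear_covariance:
  fixes c w :: "real^'n::finite"
  assumes "norm w = 1" "c \<bullet> w = 0"
  shows "det (\<chi> i j. (if i = j then 1 else 0) + w $ j * c $ i + w $ i * c $ j + \<tau> * w $ i * w $ j) = 1 + \<tau> - c \<bullet> c"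
proof -
  let ?k = "\<tau> - c \<bullet> c"
  have m: "outer a b ** outer a' b' = (b \<bullet> a') *\<^sub>R outer a b'" for a b a' b' :: "real^'n"
    by (simp add: vec_eq_iff matrix_matrix_mult_def outer_def inner_vec_def sum_distrib_left sum_distrib_right mult_ac)
  have ww: "w \<bullet> w = 1" using assms(1) by (simp add: norm_eq_sqrt_inner)
  have cw: "w \<bullet> c = 0" using assms(2) by (simp add: inner_commute)
  have s: "outer (a *\<^sub>R x) y = a *\<^sub>R outer x y" for a and x y :: "real^'n"
    by (simp add: vec_eq_iff outer_def)
  have s2: "outer x (a *\<^sub>R y) = a *\<^sub>R outer x y" for a and x y :: "real^'n"
    by (simp add: vec_eq_iff outer_def)
  have a1: "outer (x + y) v = outer x v + outer y v" for x y v :: "real^'n"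
    by (simp add: vec_eq_iff outer_def algebra_simps)
  have a2: "outer v (x + y) = outer v x + outer v y" for x y v :: "real^'n"
    by (simp add: vec_eq_iff outer_def algebra_simps)
  have "(mat 1 + outer w c) ** (mat 1 + outer (?k *\<^sub>R w) w) = mat 1 + outer w (c + ?k *\<^sub>R w)"
    by (simp add: matrix_add_ldistrib matrix_add_rdistrib_real m assms(2))
      (simp add: s s2 a2)
  then have "(mat 1 + outer w c) ** (mat 1 + outer (?k *\<^sub>R w) w) ** (mat 1 + outer c w)
      = (mat 1 + outer w (c + ?k *\<^sub>R w)) ** (mat 1 + outer c w)" by simp
  also have "\<dots> = mat 1 + outer w (c + ?k *\<^sub>R w) + outer c w + (c \<bullet> c) *\<^sub>R outer w w"
    by (simp add: matrix_add_ldistrib matrix_add_rdistrib_real m inner_add_left cw)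
  also have "\<dots> = mat 1 + outer w c + outer c w + \<tau> *\<^sub>R outer w w"
    by (simp add: vec_eq_iff outer_def ring_distribs)
  also have "\<dots> = (\<chi> i j. (if i = j then 1 else 0) + w $ j * c $ i + w $ i * c $ j + \<tau> * w $ i * w $ j)"
    by (auto simp: vec_eq_iff mat_def outer_def)
  finally have "det (\<chi> i j. (if i = j then 1 else 0) + w $ j * c $ i + w $ i * c $ j + \<tau> * w $ i * w $ j)
     = det ((mat 1 + outer w c) ** (mat 1 + outer (?k *\<^sub>R w) w) ** (mat 1 + outer c w))" by simp
  then show ?thesis by (simp add: det_mul det_one_plus_outer ww cw assms(2))
qed

section \<open>Fibres of a convex body parallel to a direction\<close>

lemma fibre_sup:
  fixes K :: "'a::euclidean_space set"
  assumes K: "compact K" and w: "norm w = 1"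
  obtains u where "u \<in> borel_measurable borel"
    "\<And>x s. x + s *\<^sub>R w \<in> K \<Longrightarrow> s \<le> u x \<and> x + u x *\<^sub>R w \<in> K"
proof -
  define S where "S = (\<lambda>x. {s. x + s *\<^sub>R w \<in> K})"
  define u where "u = (\<lambda>x. if S x = {} then 0 else Sup (S x))"
  have ww: "w \<bullet> w = 1" using w by (simp add: norm_eq_sqrt_inner)
  have closedS: "closed (S x)" for x
  proof -
    have "S x = (\<lambda>s. x + s *\<^sub>R w) -` K" by (auto simp: S_def)
    then show ?thesis
      using compact_imp_closed[OF K] by (auto intro!: continuous_closed_vimage continuous_intros)
  qed
  have bddS: "bdd_above (S x)" for x
  proof -
    obtain B where B: "\<And>y. y \<in> K \<Longrightarrow> norm y \<le> B" using compact_imp_bounded[OF K] bounded_iff by blast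
    show ?thesis
    proof (rule bdd_aboveI)
      fix s assume "s \<in> S x"
      then have "norm (x + s *\<^sub>R w) \<le> B" by (auto simp: S_def B)
      moreover have "\<bar>s\<bar> = norm ((x + s *\<^sub>R w) - x)" using w by simp
      ultimately show "s \<le> B + norm x"
        using norm_triangle_ineq4[of "x + s *\<^sub>R w" x] by linarith
    qed
  qed
  have u: "s \<le> u x \<and> x + u x *\<^sub>R w \<in> K" if "x + s *\<^sub>R w \<in> K" for x s
  proof -
    have s: "s \<in> S x" using that by (simp add: S_def)
    then have "Sup (S x) \<in> S x" using closed_contains_Sup[OF _ bddS closedS] by blast
    moreover have "s \<le> Sup (S x)" by (rule cSup_upper[OF s bddS])
    ultimately show ?thesis using s by (auto simp: u_def S_def)
  qed
  \<comment> \<open>The superlevel sets of the upper end: points from which \<open>K\<close> is met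
    at height at least \<open>c\<close>. Such a set is the sum of the compact \<open>K\<close> and a
    closed ray, hence closed.\<close>
  define U where "U = (\<lambda>c. {x. \<exists>s\<ge>c. x + s *\<^sub>R w \<in> K})"
  have closedU: "closed (U c)" for c
  proof -
    let ?L = "{y. y = (y \<bullet> w) *\<^sub>R w} \<inter> {y. y \<bullet> w \<le> - c}"
    have "closed ?L"
      by (intro closed_Int closed_Collect_eq closed_Collect_le continuous_intros)
    then have "closed (\<Union>x\<in>K. \<Union>y\<in>?L. {x + y})"
      by (rule compact_closed_sums[OF K])
    also have "(\<Union>x\<in>K. \<Union>y\<in>?L. {x + y}) = U c"
    proof safe
      fix x y assume "x \<in> K" "y = (y \<bullet> w) *\<^sub>R w" "y \<bullet> w \<le> - c"
      then show "x + y \<in> U c"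
      proof -
        have "x + y + (- (y \<bullet> w)) *\<^sub>R w = x"
          by (subst (1) \<open>y = (y \<bullet> w) *\<^sub>R w\<close>) simp
        then show ?thesis
          unfolding U_def using \<open>x \<in> K\<close> \<open>y \<bullet> w \<le> - c\<close> by (intro CollectI exI[of _ "- (y \<bullet> w)"]) auto
      qed
    next
      fix x assume "x \<in> U c"
      then obtain s where s: "s \<ge> c" "x + s *\<^sub>R w \<in> K" by (auto simp: U_def)
      have "x = (x + s *\<^sub>R w) + (- s) *\<^sub>R w" by simp
      moreover have "(- s) *\<^sub>R w \<in> ?L" using s by (simp add: ww)
      ultimately show "x \<in> (\<Union>x\<in>K. \<Union>y\<in>?L. {x + y})" using s(2) by blast
    qed
    finally show ?thesis .
  qed
  have [measurable]: "U c \<in> sets borel" for c using closedU by auto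
  \<comment> \<open>The union of the lines that meet \<open>K\<close>. Off \<open>T\<close> the
    default value \<open>u x = 0\<close> adds the complement of \<open>T\<close> to every superlevel
    set of level \<open>c \<le> 0\<close>.\<close>
  define T where "T = (\<Union>n::nat. U (- real n))"
  have T: "x \<in> T \<longleftrightarrow> S x \<noteq> {}" for x
  proof
    assume "S x \<noteq> {}"
    then obtain s where s: "x + s *\<^sub>R w \<in> K" by (auto simp: S_def)
    obtain n where "- s \<le> real n" using real_arch_simple by blast
    then show "x \<in> T" using s by (auto simp: T_def U_def intro!: exI[of _ n] exI[of _ s])
  qed (auto simp: T_def U_def S_def)
  have [measurable]: "T \<in> sets borel" unfolding T_def by measurable
  have "u \<in> borel_measurable borel"
  proof (rule borel_measurableI_ge)
    fix c
    have "{x \<in> space borel. c \<le> u x} = U c \<union> (if c \<le> 0 then - T else {})"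
    proof (intro set_eqI iffI)
      fix x assume x: "x \<in> {x \<in> space borel. c \<le> u x}"
      show "x \<in> U c \<union> (if c \<le> 0 then - T else {})"
      proof (cases "S x = {}")
        case True then show ?thesis using x T[of x] by (auto simp: u_def)
      next
        case False
        then show ?thesis using x u by (auto simp: U_def S_def)
      qed
    next
      fix x assume "x \<in> U c \<union> (if c \<le> 0 then - T else {})"
      then show "x \<in> {x \<in> space borel. c \<le> u x}"
      proof (cases "x \<in> U c")
        case True
        then obtain s where "s \<ge> c" "x + s *\<^sub>R w \<in> K" by (auto simp: U_def)
        with u[of x s] show ?thesis by auto
      next
        case False
        then have "c \<le> 0" "S x = {}"
          using \<open>x \<in> U c \<union> (if c \<le> 0 then - T else {})\<close> T[of x] by (auto split: if_splits)
        then show ?thesis by (simp add: u_def)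
      qed
    qed
    also have "\<dots> \<in> sets borel" by auto
    finally show "{x \<in> space borel. c \<le> u x} \<in> sets borel" .
  qed
  with u that show ?thesis by blast
qed

text \<open>The lower end of a fibre is the upper end in direction \<open>- w\<close>, and convexity
  fills in the segment. Positions are measured from \<open>x\<close> itself, so both ends shift by
  \<open>- t\<close> when \<open>x\<close> moves by \<open>t\<close> along \<open>w\<close>.\<close>

lemma fibre_interval:
  fixes K :: "'a::euclidean_space set"
  assumes K: "compact K" "convex K" and w: "norm w = 1"
  obtains l u where "l \<in> borel_measurable borel" "u \<in> borel_measurable borel"
    "\<And>x s. x + s *\<^sub>R w \<in> K \<Longrightarrow> (\<forall>r. x + r *\<^sub>R w \<in> K \<longleftrightarrow> l x \<le> r \<and> r \<le> u x)"
proof -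
  obtain u where u: "u \<in> borel_measurable borel"
    "\<And>x s. x + s *\<^sub>R w \<in> K \<Longrightarrow> s \<le> u x \<and> x + u x *\<^sub>R w \<in> K"
    using fibre_sup[OF K(1) w] by blast
  have "norm (- w) = 1" using w by simp
  then obtain v where v: "v \<in> borel_measurable borel"
    "\<And>x s. x + s *\<^sub>R (- w) \<in> K \<Longrightarrow> s \<le> v x \<and> x + v x *\<^sub>R (- w) \<in> K"
    using fibre_sup[OF K(1)] by blast
  have "x + r *\<^sub>R w \<in> K \<longleftrightarrow> - v x \<le> r \<and> r \<le> u x" if xs: "x + s *\<^sub>R w \<in> K" for x s r
  proof
    assume "x + r *\<^sub>R w \<in> K"
    then show "- v x \<le> r \<and> r \<le> u x" using u(2)[of x r] v(2)[of x "- r"] by auto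
  next
    assume r: "- v x \<le> r \<and> r \<le> u x"
    have "x + u x *\<^sub>R w \<in> K" "x + (- v x) *\<^sub>R w \<in> K" using u(2)[OF xs] v(2)[of x "- s"] xs by auto
    moreover have "closed_segment (- v x) (u x) = {- v x..u x}" using r by (simp add: closed_segment_eq_real_ivl)
    then have "r \<in> closed_segment (- v x) (u x)" using r by auto
    then obtain t where t: "0 \<le> t" "t \<le> 1" "r = (1 - t) * (- v x) + t * u x"
      by (auto simp: closed_segment_def)
    have "x + r *\<^sub>R w = (1 - t) *\<^sub>R (x + (- v x) *\<^sub>R w) + t *\<^sub>R (x + u x *\<^sub>R w)"
      unfolding t(3) by (simp add: algebra_simps)
    ultimately show "x + r *\<^sub>R w \<in> K" using K(2) t by (auto intro: convexD_alt)
  qed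
  then show ?thesis using u(1) v(1) by (intro that[of "\<lambda>x. - v x" u]) auto
qed

section \<open>Bodies with a given Steiner symmetral\<close>

lemma set_integral_sum:
  fixes f :: "'i \<Rightarrow> 'a \<Rightarrow> real"
  assumes "\<And>i. i \<in> I \<Longrightarrow> set_integrable M A (f i)"
  shows "set_integrable M A (\<lambda>x. \<Sum>i\<in>I. f i x)"
    "(LINT x:A|M. \<Sum>i\<in>I. f i x) = (\<Sum>i\<in>I. LINT x:A|M. f i x)"
  using assms unfolding set_integrable_def set_lebesgue_integral_def
  by (simp_all add: sum_distrib_left Bochner_Integration.integral_sum)

lemma set_integrable_bounded_compact:
  fixes f :: "'a::euclidean_space \<Rightarrow> real"
  assumes "compact K" "f \<in> borel_measurable borel" "\<And>x. x \<in> K \<Longrightarrow> \<bar>f x\<bar> \<le> B"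
  shows "set_integrable lborel K f"
  unfolding set_integrable_def
proof (rule Bochner_Integration.integrable_bound)
  show "integrable lborel (\<lambda>x. indicator K x * B)"
    using emeasure_compact_finite[OF assms(1)] borel_compact[OF assms(1)]
    by (intro integrable_mult_left integrable_real_indicator) (auto simp: top.not_eq_extremum)
  show "(\<lambda>x. indicator K x *\<^sub>R f x) \<in> borel_measurable lborel"
    using assms borel_compact[OF assms(1)] by auto
  show "AE x in lborel. norm (indicator K x *\<^sub>R f x) \<le> norm (indicator K x * B)"
    using assms(3) by (intro AE_I2) (force simp: indicator_def)
qed

text \<open>The set equation below says that \<open>Z\<close> is the Steiner symmetral of \<open>K\<close> in direction \<open>w\<close>.\<close>

lemma steiner_symmetral_shear:
  fixes Z K :: "(real^'n::finite) set"
  assumes Z: "convex_body Z" "\<And>x. - x \<in> Z \<longleftrightarrow> x \<in> Z" "isotropic Z"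
    and K: "convex_body K"
    and w: "norm w = 1"
    and ZK: "Z = {x. \<exists>s. x + s *\<^sub>R w \<in> K \<and> x + (s - 2 * (x \<bullet> w)) *\<^sub>R w \<in> K}"
    and det: "det (\<chi> i j. (LINT x:K|lborel. x $ i * x $ j) / measure lborel K) * (measure lborel Z)\<^sup>2 \<le> (measure lborel K)\<^sup>2"
  obtains c where "c \<bullet> w = 0" "\<And>x. x \<in> Z \<Longrightarrow> x + (c \<bullet> x) *\<^sub>R w \<in> K"
proof -
  note Zm = convex_body_measure[OF Z(1)] and Km = convex_body_measure[OF K]
  have ww: "w \<bullet> w = 1" using w by (simp add: norm_eq_sqrt_inner)
  obtain l u where [measurable]: "l \<in> borel_measurable borel" "u \<in> borel_measurable borel"
    and lu: "\<And>x s. x + s *\<^sub>R w \<in> K \<Longrightarrow> (\<forall>r. x + r *\<^sub>R w \<in> K \<longleftrightarrow> l x \<le> r \<and> r \<le> u x)"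
    using fibre_interval[OF Km(1,2) w] by blast
  define T where "T = {x. \<exists>s. x + s *\<^sub>R w \<in> K}"
  have T_eq: "T = {x. x + u x *\<^sub>R w \<in> K}"
    unfolding T_def using lu by (auto, meson order_refl order_trans)
  have [measurable]: "K \<in> sets borel" "Z \<in> sets borel" using Km Zm by auto
  have [measurable]: "T \<in> sets borel" unfolding T_eq by measurable
  \<comment> \<open>The midpoint of the fibre of \<open>K\<close> through \<open>x\<close>, measured
    from the hyperplane orthogonal to \<open>w\<close>. The summand \<open>x \<bullet> w\<close>
    compensates that \<open>l\<close> and \<open>u\<close> are measured from \<open>x\<close>, and
    makes \<open>M\<close> constant along \<open>w\<close>.\<close>
  define M where "M = (\<lambda>x. if x \<in> T then (l x + u x) / 2 + x \<bullet> w else 0)"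
  have Mm[measurable]: "M \<in> borel_measurable borel" unfolding M_def by measurable
  have T_shift: "x + t *\<^sub>R w \<in> T \<longleftrightarrow> x \<in> T" for x t
  proof -
    have "x + t *\<^sub>R w \<in> T \<Longrightarrow> x \<in> T" for x t
      unfolding T_def by (auto simp: add.assoc simp flip: scaleR_add_left)
    from this[of x t] this[of "x + t *\<^sub>R w" "- t"] show ?thesis by auto
  qed
  have lu_shift: "l (x + t *\<^sub>R w) = l x - t \<and> u (x + t *\<^sub>R w) = u x - t" if "x \<in> T" for x t
  proof -
    from that obtain s where s: "x + s *\<^sub>R w \<in> K" by (auto simp: T_def)
    then have s': "(x + t *\<^sub>R w) + (s - t) *\<^sub>R w \<in> K" by (simp add: algebra_simps)
    have eq: "l (x + t *\<^sub>R w) \<le> r - t \<and> r - t \<le> u (x + t *\<^sub>R w) \<longleftrightarrow> l x \<le> r \<and> r \<le> u x" for r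
    proof -
      have "(x + t *\<^sub>R w) + (r - t) *\<^sub>R w = x + r *\<^sub>R w" by (simp add: algebra_simps)
      then show ?thesis using lu[OF s] lu[OF s'] by metis
    qed
    have "l x \<le> u x" using lu[OF s] s order_trans by blast
    moreover have "l (x + t *\<^sub>R w) \<le> u (x + t *\<^sub>R w)" using lu[OF s'] s' order_trans by blast
    ultimately show ?thesis
      using eq[of "l x"] eq[of "u x"] eq[of "l (x + t *\<^sub>R w) + t"] eq[of "u (x + t *\<^sub>R w) + t"] by auto
  qed
  have Minv: "M (x + t *\<^sub>R w) = M x" for x t
  proof (cases "x \<in> T")
    case True
    have "(l x - t + (u x - t)) / 2 + (x \<bullet> w + t) = (l x + u x) / 2 + x \<bullet> w"
      by (simp add: diff_divide_distrib add_divide_distrib)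
    then show ?thesis using lu_shift[OF True, of t] T_shift[of x t] True
      by (simp only: M_def inner_add_left ww inner_scaleR_left mult_1_right if_True)
  qed (simp add: M_def T_shift)
  \<comment> \<open>Both memberships say that \<open>\<bar>x \<bullet> w\<bar>\<close> is at most
    half the length \<open>b - a\<close> of the fibre, which is the form
    \<open>2 * \<bar>X\<bar> \<le> b - a\<close> below.\<close>
  have ZM: "x \<in> Z \<longleftrightarrow> x + M x *\<^sub>R w \<in> K" for x
  proof (cases "x \<in> T")
    case False
    then show ?thesis unfolding ZK by (auto simp: T_def)
  next
    case True
    then obtain s where s: "x + s *\<^sub>R w \<in> K" by (auto simp: T_def)
    define a b X where "a = l x" and "b = u x" and "X = x \<bullet> w"
    have Mx: "M x = (a + b) / 2 + X" using True by (simp add: M_def a_def b_def X_def)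
    have "x + M x *\<^sub>R w \<in> K \<longleftrightarrow> a \<le> M x \<and> M x \<le> b" using lu[OF s] by (simp add: a_def b_def)
    moreover have "\<dots> \<longleftrightarrow> 2 * \<bar>X\<bar> \<le> b - a" 
    proof
      assume "a \<le> M x \<and> M x \<le> b"
      then show "2 * \<bar>X\<bar> \<le> b - a" unfolding Mx by (elim conjE) argo
    next
      assume "2 * \<bar>X\<bar> \<le> b - a"
      then show "a \<le> M x \<and> M x \<le> b" unfolding Mx by (intro conjI) argo+
    qed
    moreover have "x \<in> Z \<longleftrightarrow> (\<exists>s. (a \<le> s \<and> s \<le> b) \<and> a \<le> s - 2 * X \<and> s - 2 * X \<le> b)"
      unfolding ZK mem_Collect_eq a_def b_def X_def using lu[OF s] by presburger
    moreover have "\<dots> \<longleftrightarrow> 2 * \<bar>X\<bar> \<le> b - a"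
    proof
      assume "2 * \<bar>X\<bar> \<le> b - a"
      then have "2 * X \<le> b - a" "2 * (- X) \<le> b - a"
        by (meson abs_ge_self abs_ge_minus_self mult_left_mono order_trans zero_le_numeral)+
      then have "a \<le> (a + b) / 2 + X" "(a + b) / 2 + X \<le> b"
        "a \<le> (a + b) / 2 + X - 2 * X" "(a + b) / 2 + X - 2 * X \<le> b" by argo+
      then show "\<exists>s. (a \<le> s \<and> s \<le> b) \<and> a \<le> s - 2 * X \<and> s - 2 * X \<le> b" by blast
    next
      assume "\<exists>s. (a \<le> s \<and> s \<le> b) \<and> a \<le> s - 2 * X \<and> s - 2 * X \<le> b"
      then show "2 * \<bar>X\<bar> \<le> b - a" by (elim exE conjE) argo
    qed
    ultimately show ?thesis by blast
  qed
  have transfer: "(LINT x:K|lborel. g x) = (LINT x:Z|lborel. g (x + M x *\<^sub>R w))"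
    if [measurable]: "g \<in> borel_measurable borel" for g :: "real^'n \<Rightarrow> real"
  proof -
    have "(LINT x|lborel. indicat_real K x * g x) = (LINT x|lborel. indicat_real K (x + M x *\<^sub>R w) * g (x + M x *\<^sub>R w))"
      by (rule lborel_integral_shear[OF Mm Minv, symmetric]) measurable
    moreover have "indicat_real K (x + M x *\<^sub>R w) = indicat_real Z x" for x
      using ZM[of x] by (auto simp: indicator_def)
    ultimately show ?thesis by (simp add: set_lebesgue_integral_def)
  qed
  define V where "V = measure lborel Z"
  have V: "V > 0" using Zm by (simp add: V_def)
  have VK: "measure lborel K = V"
    using transfer[of "\<lambda>_. 1"] Km Zm by (simp add: V_def set_lebesgue_integral_def)
  obtain B where B: "\<And>x. x \<in> Z \<Longrightarrow> norm x \<le> B" "\<And>x. x \<in> K \<Longrightarrow> norm x \<le> B" "B \<ge> 0"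
  proof -
    obtain B1 B2 where "\<And>x. x \<in> Z \<Longrightarrow> norm x \<le> B1" "\<And>x. x \<in> K \<Longrightarrow> norm x \<le> B2"
      using compact_imp_bounded[OF Zm(1)] compact_imp_bounded[OF Km(1)] unfolding bounded_iff by metis
    then show ?thesis by (intro that[of "max 0 (max B1 B2)"]) (force simp: le_max_iff_disj)+
  qed
  have MB: "\<bar>M x\<bar> \<le> 2 * B" if "x \<in> Z" for x
  proof -
    have "\<bar>M x\<bar> = norm ((x + M x *\<^sub>R w) - x)" using w by simp
    also have "\<dots> \<le> norm (x + M x *\<^sub>R w) + norm x" by (rule norm_triangle_ineq4)
    also have "\<dots> \<le> B + B" using B that ZM by (intro add_mono) auto
    finally show ?thesis by simp
  qed
  have xB: "\<bar>x $ i\<bar> \<le> B" if "x \<in> Z" for x i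
    using component_le_norm_cart[of x i] B(1)[OF that] by linarith
  have int1: "set_integrable lborel Z (\<lambda>x. x $ i * x $ j)" for i j
    by (rule set_integrable_continuous_compact[OF Zm(1)]) (intro continuous_intros)
  have int2: "set_integrable lborel Z (\<lambda>x. x $ i * M x)" for i
    by (rule set_integrable_bounded_compact[OF Zm(1), of _ "B * (2 * B)"])
      (auto simp: abs_mult intro!: mult_mono xB MB B)
  have int3: "set_integrable lborel Z (\<lambda>x. M x * M x)"
  proof (rule set_integrable_bounded_compact[OF Zm(1)])
    fix x assume "x \<in> Z"
    then show "\<bar>M x * M x\<bar> \<le> (2 * B) * (2 * B)"
      unfolding abs_mult using MB B(3) by (intro mult_mono) auto
  qed measurable
  \<comment> \<open>Since \<open>Z\<close> is isotropic, \<open>x \<mapsto> c \<bullet> x\<close> is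
    the best linear approximation of \<open>M\<close> in mean square over \<open>Z\<close>, and
    \<open>\<tau>\<close> is the mean square of \<open>M\<close>.\<close>
  define c where "c = (\<chi> i. (LINT x:Z|lborel. x $ i * M x) / V)"
  define \<tau> where "\<tau> = (LINT x:Z|lborel. M x * M x) / V"
  have cV: "(LINT x:Z|lborel. x $ i * M x) = V * c $ i" for i using V by (simp add: c_def)
  have tV: "(LINT x:Z|lborel. M x * M x) = V * \<tau>" using V by (simp add: \<tau>_def)
  have cov: "(LINT x:Z|lborel. x $ i * x $ j) = V * (if i = j then 1 else 0)" for i j
  proof -
    have "covariance_matrix Z $ i $ j = (mat 1 :: real^'n^'n) $ i $ j"
      using Z(3) by (simp add: isotropic_def)
    then show ?thesis
      unfolding covariance_matrix_symmetric[OF Z(1,2)] using V by (auto simp: mat_def V_def)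
  qed
  have int_lin: "set_integrable lborel Z (\<lambda>x. (a \<bullet> x) * M x)"
    "(LINT x:Z|lborel. (a \<bullet> x) * M x) = V * (a \<bullet> c)" for a
  proof -
    have eq: "(a \<bullet> x) * M x = (\<Sum>i\<in>UNIV. a $ i * (x $ i * M x))" for x
      by (simp add: inner_vec_def sum_distrib_right mult.assoc)
    show "set_integrable lborel Z (\<lambda>x. (a \<bullet> x) * M x)"
      unfolding eq by (intro set_integral_sum(1)) (auto intro: int2)
    have "(LINT x:Z|lborel. (a \<bullet> x) * M x) = (\<Sum>i\<in>UNIV. LINT x:Z|lborel. a $ i * (x $ i * M x))"
      unfolding eq by (rule set_integral_sum(2)) (auto intro: int2)
    also have "\<dots> = V * (a \<bullet> c)"
      by (simp add: cV inner_vec_def sum_distrib_left mult.left_commute[of V])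
    finally show "(LINT x:Z|lborel. (a \<bullet> x) * M x) = V * (a \<bullet> c)" .
  qed
  have int_quad: "set_integrable lborel Z (\<lambda>x. (a \<bullet> x) * (a \<bullet> x))"
    "(LINT x:Z|lborel. (a \<bullet> x) * (a \<bullet> x)) = V * (a \<bullet> a)" for a
  proof -
    have eq: "(a \<bullet> x) * (a \<bullet> x) = (\<Sum>i\<in>UNIV. \<Sum>j\<in>UNIV. (a $ i * a $ j) * (x $ i * x $ j))" for x
      by (simp add: inner_vec_def sum_product algebra_simps)
    show "set_integrable lborel Z (\<lambda>x. (a \<bullet> x) * (a \<bullet> x))"
      by (rule set_integrable_continuous_compact[OF Zm(1)]) (intro continuous_intros)
    have "(LINT x:Z|lborel. (a \<bullet> x) * (a \<bullet> x)) = (\<Sum>i\<in>UNIV. LINT x:Z|lborel. \<Sum>j\<in>UNIV. (a $ i * a $ j) * (x $ i * x $ j))"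
      unfolding eq by (rule set_integral_sum(2)) (auto intro!: set_integral_sum(1) int1)
    also have "\<dots> = (\<Sum>i\<in>UNIV. \<Sum>j\<in>UNIV. LINT x:Z|lborel. (a $ i * a $ j) * (x $ i * x $ j))"
      by (intro sum.cong refl set_integral_sum(2)) (auto intro!: int1)
    also have "\<dots> = V * (a \<bullet> a)"
    proof -
      have "(LINT x:Z|lborel. (a $ i * a $ j) * (x $ i * x $ j)) = (if j = i then V * (a $ i * a $ i) else 0)" for i j
        by (simp add: cov)
      then show ?thesis by (simp add: inner_vec_def sum_distrib_left)
    qed
    finally show "(LINT x:Z|lborel. (a \<bullet> x) * (a \<bullet> x)) = V * (a \<bullet> a)" .
  qed
  \<comment> \<open>Both \<open>Z\<close> and \<open>M\<close> are invariant under the reflection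
    along \<open>w\<close>, so \<open>(w \<bullet> x) * M x\<close> is odd and integrates to 0; this
    is \<open>c \<bullet> w = 0\<close>.\<close>
  define refl where "refl = (\<lambda>x::real^'n. x - (2 * (x \<bullet> w)) *\<^sub>R w)"
  have refl_lin: "linear refl" unfolding refl_def by (intro linearI) (auto simp: algebra_simps inner_add_left)
  have refl_orth: "orthogonal_transformation refl"
    unfolding orthogonal_transformation_def using refl_lin
    by (auto simp: refl_def inner_diff_left inner_diff_right ww inner_commute algebra_simps)
  have refl_M: "M (refl x) = M x" for x
    using Minv[of x "- (2 * (x \<bullet> w))"] by (simp add: refl_def)
  have refl_w: "w \<bullet> refl x = - (w \<bullet> x)" for x
    by (simp add: refl_def inner_diff_right ww inner_commute)
  have refl_w': "refl x \<bullet> w = - (x \<bullet> w)" for x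
    using refl_w[of x] by (simp add: inner_commute)
  have refl_Z: "refl x \<in> Z \<longleftrightarrow> x \<in> Z" for x
  proof -
    have 1: "refl x \<in> Z" if x: "x \<in> Z" for x
    proof -
      obtain s where "x + s *\<^sub>R w \<in> K" "x + (s - 2 * (x \<bullet> w)) *\<^sub>R w \<in> K" using x unfolding ZK by blast
      moreover have "refl x + s *\<^sub>R w = x + (s - 2 * (x \<bullet> w)) *\<^sub>R w"
        "refl x + (s - 2 * (refl x \<bullet> w)) *\<^sub>R w = x + s *\<^sub>R w"
        unfolding refl_w'[of x] by (simp_all add: refl_def scaleR_diff_left scaleR_add_left)
      ultimately show ?thesis unfolding ZK mem_Collect_eq by metis
    qed
    have "refl (refl x) = refl x - (2 * (refl x \<bullet> w)) *\<^sub>R w" by (subst refl_def) (rule refl)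
    then have "refl (refl x) = x" unfolding refl_w' by (simp add: refl_def)
    then show ?thesis using 1[of x] 1[of "refl x"] by auto
  qed
  have "(LINT x:Z|lborel. (w \<bullet> x) * M x) = (LINT x:Z|lborel. (w \<bullet> refl x) * M (refl x))"
  proof -
    have "(LINT x|lborel. indicat_real Z (refl x) * ((w \<bullet> refl x) * M (refl x))) = (LINT x|lborel. indicat_real Z x * ((w \<bullet> x) * M x))"
      by (rule lborel_integral_orthogonal[OF refl_orth]) measurable
    moreover have "indicat_real Z (refl x) = indicat_real Z x" for x by (simp add: indicator_def refl_Z)
    ultimately show ?thesis by (simp add: set_lebesgue_integral_def)
  qed
  also have "\<dots> = - (LINT x:Z|lborel. (w \<bullet> x) * M x)"
    by (simp add: refl_w refl_M set_lebesgue_integral_def)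
  finally have cw: "c \<bullet> w = 0" using V int_lin(2)[of w] by (simp add: inner_commute)
  have covK: "(LINT x:K|lborel. x $ i * x $ j) / V =
      (if i = j then 1 else 0) + w $ j * c $ i + w $ i * c $ j + \<tau> * w $ i * w $ j" for i j
  proof -
    have "(LINT x:K|lborel. x $ i * x $ j) = (LINT x:Z|lborel. x $ i * x $ j + w $ j * (x $ i * M x) + w $ i * (x $ j * M x) + (w $ i * w $ j) * (M x * M x))"
      by (subst transfer) (auto simp: algebra_simps)
    also have "\<dots> = V * ((if i = j then 1 else 0) + w $ j * c $ i + w $ i * c $ j + \<tau> * w $ i * w $ j)"
      using int1 int2 int3
      by (simp add: set_integral_add set_integrable_mult_right cov cV tV ring_distribs mult.left_commute[of _ V])
    finally show ?thesis using V by simp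
  qed
  \<comment> \<open>The determinant inequality says that \<open>\<tau> - c \<bullet> c\<close> is
    not positive, while the same number is the mean of the square of
    \<open>M x - c \<bullet> x\<close>; hence \<open>M\<close> is linear almost everywhere on
    \<open>Z\<close>.\<close>
  have "1 + \<tau> - c \<bullet> c \<le> 1"
    using det V unfolding VK covK det_shear_covariance[OF w cw] V_def[symmetric] by simp
  then have tau: "\<tau> \<le> c \<bullet> c" by simp
  have int_sq: "set_integrable lborel Z (\<lambda>x. (M x - c \<bullet> x)\<^sup>2)"
    and "(LINT x:Z|lborel. (M x - c \<bullet> x)\<^sup>2) = V * (\<tau> - c \<bullet> c)"
  proof -
    have eq: "(M x - c \<bullet> x)\<^sup>2 = M x * M x + (-2) * ((c \<bullet> x) * M x) + (c \<bullet> x) * (c \<bullet> x)" for x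
      by (simp add: power2_eq_square algebra_simps)
    note i = int3 int_lin[of c] int_quad[of c]
    show "set_integrable lborel Z (\<lambda>x. (M x - c \<bullet> x)\<^sup>2)"
      unfolding eq by (intro set_integral_add set_integrable_mult_right i)
    show "(LINT x:Z|lborel. (M x - c \<bullet> x)\<^sup>2) = V * (\<tau> - c \<bullet> c)"
      unfolding eq using i by (simp add: set_integral_add set_integrable_mult_right tV ring_distribs)
  qed
  moreover have "V * (\<tau> - c \<bullet> c) \<le> 0" using V tau by (simp add: mult_nonneg_nonpos)
  moreover have "(LINT x:Z|lborel. (M x - c \<bullet> x)\<^sup>2) \<ge> 0"
    by (auto simp: set_lebesgue_integral_def)
  ultimately have "(LINT x|lborel. indicat_real Z x *\<^sub>R (M x - c \<bullet> x)\<^sup>2) = 0"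
    by (simp add: set_lebesgue_integral_def)
  then have "AE x in lborel. indicat_real Z x *\<^sub>R (M x - c \<bullet> x)\<^sup>2 = 0"
    using int_sq by (subst (asm) integral_nonneg_eq_0_iff_AE) (auto simp: set_integrable_def)
  then have ae: "AE x in lborel. x \<in> Z \<longrightarrow> x + (c \<bullet> x) *\<^sub>R w \<in> K"
  proof (rule AE_mp, intro AE_I2 impI)
    fix x assume "indicat_real Z x *\<^sub>R (M x - c \<bullet> x)\<^sup>2 = 0" "x \<in> Z"
    then have "M x = c \<bullet> x" by simp
    with ZM[of x] \<open>x \<in> Z\<close> show "x + (c \<bullet> x) *\<^sub>R w \<in> K" by simp
  qed
  have "x + (c \<bullet> x) *\<^sub>R w \<in> K" if "x \<in> Z" for x
  proof (rule ccontr)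
    \<comment> \<open>A single exception would produce an open set of exceptions, as
      \<open>K\<close> is closed; it meets the interior of \<open>Z\<close>, which is dense in
      \<open>Z\<close>, in a set of positive measure.\<close>
    assume neg: "x + (c \<bullet> x) *\<^sub>R w \<notin> K"
    define U where "U = {y. y + (c \<bullet> y) *\<^sub>R w \<in> - K}"
    have "U = (\<lambda>y. y + (c \<bullet> y) *\<^sub>R w) -` (- K)" by (auto simp: U_def)
    then have "open U"
      using compact_imp_closed[OF Km(1)] by (auto intro!: open_vimage continuous_intros simp: open_Compl)
    have "x \<in> closure (interior Z)"
      using that Zm(2) Z(1) convex_closure_interior[of Z] closure_subset by (auto simp: convex_body_def)
    moreover have "x \<in> U" using neg by (simp add: U_def)
    ultimately have "U \<inter> interior Z \<noteq> {}"
      using \<open>open U\<close> open_Int_closure_eq_empty[of U "interior Z"] by auto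
    moreover have op: "open (U \<inter> interior Z)" using \<open>open U\<close> by auto
    ultimately have "\<not> negligible (U \<inter> interior Z)" using open_not_negligible by blast
    moreover have "AE y in lborel. y \<notin> U \<inter> interior Z"
      using ae interior_subset[of Z] by (auto simp: U_def elim!: eventually_mono)
    then have "U \<inter> interior Z \<in> null_sets lborel"
      using op by (subst (asm) AE_iff_null_sets[symmetric]) auto
    then have "negligible (U \<inter> interior Z)"
      by (simp add: negligible_iff_null_sets null_sets_completionI)
    ultimately show False by blast
  qed
  with cw that show ?thesis by blast
qed

section \<open>Zonotopes\<close>

definition zon :: "nat set \<Rightarrow> (nat \<Rightarrow> 'a::euclidean_space) \<Rightarrow> 'a set" where
  "zon I z = {\<Sum>i\<in>I. r i *\<^sub>R z i | r. \<forall>i\<in>I. \<bar>r i\<bar> \<le> 1}"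

definition zon_support :: "nat set \<Rightarrow> (nat \<Rightarrow> 'a::euclidean_space) \<Rightarrow> 'a \<Rightarrow> real" where
  "zon_support I z a = (\<Sum>i\<in>I. \<bar>a \<bullet> z i\<bar>)"

text \<open>As \<open>sgn 0 = 0\<close>, generators orthogonal to \<open>a\<close> contribute
  nothing: this is not a vertex but the center of the face on which \<open>a\<close> is
  maximal.\<close>

definition zon_max :: "nat set \<Rightarrow> (nat \<Rightarrow> 'a::euclidean_space) \<Rightarrow> 'a \<Rightarrow> 'a" where
  "zon_max I z a = (\<Sum>i\<in>I. sgn (a \<bullet> z i) *\<^sub>R z i)"

text \<open>Independence of an indexed family rather than of a set of vectors, so that a repeated
  vector counts as a dependency.\<close>

definition lin_indep :: "nat set \<Rightarrow> (nat \<Rightarrow> 'a::euclidean_space) \<Rightarrow> bool" where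
  "lin_indep I z \<longleftrightarrow> (\<forall>u. (\<Sum>i\<in>I. u i *\<^sub>R z i) = 0 \<longrightarrow> (\<forall>i\<in>I. u i = 0))"

lemma closed_segment_symmetric: "closed_segment (- v) (v::'a::real_vector) = {r *\<^sub>R v | r. \<bar>r\<bar> \<le> 1}"
proof safe
  fix x assume "x \<in> closed_segment (- v) v"
  then obtain u where "0 \<le> u" "u \<le> 1" "x = (1 - u) *\<^sub>R (- v) + u *\<^sub>R v" by (auto simp: closed_segment_def)
  then show "\<exists>r. x = r *\<^sub>R v \<and> \<bar>r\<bar> \<le> 1"
    by (intro exI[of _ "2 * u - 1"]) (auto simp: algebra_simps simp flip: scaleR_add_left)
next
  fix r :: real assume "\<bar>r\<bar> \<le> 1"
  then show "r *\<^sub>R v \<in> closed_segment (- v) v"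
    unfolding closed_segment_def
    by (intro CollectI exI[of _ "(r + 1) / 2"]) (auto simp flip: scaleR_add_left scaleR_minus_left simp: scaleR_minus_right[symmetric] field_simps)
qed

lemma zon_eq_sum:
  assumes "finite I"
  shows "(\<Sum>i\<in>I. closed_segment (- z i) (z i)) = zon I z"
proof -
  have "(\<Sum>i\<in>I. closed_segment (- z i) (z i)) = {\<Sum>i\<in>I. s i | s. \<forall>i\<in>I. s i \<in> closed_segment (- z i) (z i)}"
    using set_sum_alt[OF assms] by auto
  also have "\<dots> = zon I z"
  proof safe
    fix s assume "\<forall>i\<in>I. s i \<in> closed_segment (- z i) (z i)"
    then have "\<forall>i\<in>I. \<exists>r. s i = r *\<^sub>R z i \<and> \<bar>r\<bar> \<le> 1" by (auto simp: closed_segment_symmetric)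
    then obtain r where "\<forall>i\<in>I. s i = r i *\<^sub>R z i \<and> \<bar>r i\<bar> \<le> 1" by metis
    then show "(\<Sum>i\<in>I. s i) \<in> zon I z" unfolding zon_def by (auto intro!: exI[of _ r] sum.cong)
  next
    fix x assume "x \<in> zon I z"
    then obtain r where "x = (\<Sum>i\<in>I. r i *\<^sub>R z i)" "\<forall>i\<in>I. \<bar>r i\<bar> \<le> 1" by (auto simp: zon_def)
    then show "\<exists>s. x = (\<Sum>i\<in>I. s i) \<and> (\<forall>i\<in>I. s i \<in> closed_segment (- z i) (z i))"
      by (intro exI[of _ "\<lambda>i. r i *\<^sub>R z i"]) (auto simp: closed_segment_symmetric)
  qed
  finally show ?thesis .
qed

lemma zonI: "(\<And>i. i \<in> I \<Longrightarrow> \<bar>r i\<bar> \<le> 1) \<Longrightarrow> (\<Sum>i\<in>I. r i *\<^sub>R z i) \<in> zon I z"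
  unfolding zon_def by blast

lemma zonE:
  assumes "x \<in> zon I z"
  obtains r where "\<And>i. i \<in> I \<Longrightarrow> \<bar>r i\<bar> \<le> 1" "x = (\<Sum>i\<in>I. r i *\<^sub>R z i)"
  using assms unfolding zon_def by blast

lemma zon_uminus: "- x \<in> zon I z \<longleftrightarrow> x \<in> zon I z"
proof -
  have "- x \<in> zon I z" if x: "x \<in> zon I z" for x
  proof -
    obtain r where r: "\<And>i. i \<in> I \<Longrightarrow> \<bar>r i\<bar> \<le> 1" "x = (\<Sum>i\<in>I. r i *\<^sub>R z i)" using zonE[OF x] by blast
    have "- x = (\<Sum>i\<in>I. (- r i) *\<^sub>R z i)" unfolding r(2) by (simp add: sum_negf)
    also have "\<dots> \<in> zon I z" by (rule zonI) (simp add: r(1))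
    finally show ?thesis .
  qed
  from this[of x] this[of "- x"] show ?thesis by auto
qed

lemma zon_convex_hull:
  assumes "finite I"
  shows "zon I z = convex hull (\<Sum>i\<in>I. {- z i, z i})" "finite (\<Sum>i\<in>I. {- z i, z i})"
proof -
  have "zon I z = (\<Sum>i\<in>I. convex hull {- z i, z i})"
    by (simp add: zon_eq_sum[OF assms, symmetric] segment_convex_hull)
  then show "zon I z = convex hull (\<Sum>i\<in>I. {- z i, z i})" by (simp add: convex_hull_set_sum)
  show "finite (\<Sum>i\<in>I. {- z i, z i})" using assms by (induction I) (auto intro: finite_set_plus)
qed

lemma zon_polytope: "finite I \<Longrightarrow> polytope (zon I z)"
  using zon_convex_hull polytope_def by metis

lemma zon_compact: "finite I \<Longrightarrow> compact (zon I z)"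
  using zon_polytope polytope_imp_compact by blast

lemma zon_convex: "finite I \<Longrightarrow> convex (zon I z)"
  using zon_polytope polytope_imp_convex by blast

lemma zon_zero: "0 \<in> zon I z"
  using zonI[of I "\<lambda>_. 0" z] by simp

lemma zon_le_support:
  assumes "x \<in> zon I z"
  shows "a \<bullet> x \<le> zon_support I z a"
proof -
  obtain r where r: "\<And>i. i \<in> I \<Longrightarrow> \<bar>r i\<bar> \<le> 1" "x = (\<Sum>i\<in>I. r i *\<^sub>R z i)" using zonE[OF assms] by blast
  have "r i * (a \<bullet> z i) \<le> \<bar>a \<bullet> z i\<bar>" if "i \<in> I" for i
    using r(1)[OF that] by (metis abs_ge_self abs_mult abs_ge_zero mult_left_le_one_le order_trans)
  then show ?thesis unfolding r(2) zon_support_def by (simp add: inner_sum_right sum_mono)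
qed

lemma zon_max_in: "zon_max I z a \<in> zon I z"
  unfolding zon_max_def by (rule zonI) (simp add: sgn_if)

lemma zon_max_support: "a \<bullet> zon_max I z a = zon_support I z a"
  unfolding zon_max_def zon_support_def
  by (simp add: inner_sum_right sgn_mult_self_eq) (auto intro!: sum.cong simp: sgn_if abs_if)

lemma zon_mem_iff:
  assumes "finite I"
  shows "x \<in> zon I z \<longleftrightarrow> (\<forall>a. a \<bullet> x \<le> zon_support I z a)"
proof
  assume R: "\<forall>a. a \<bullet> x \<le> zon_support I z a"
  show "x \<in> zon I z"
  proof (rule ccontr)
    assume "x \<notin> zon I z"
    then obtain a b where ab: "a \<bullet> x < b" "\<And>y. y \<in> zon I z \<Longrightarrow> a \<bullet> y > b"
      using separating_hyperplane_closed_point[OF zon_convex[OF assms] compact_imp_closed[OF zon_compact[OF assms]], of x] by metis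
    have "a \<bullet> zon_max I z (- a) > b" by (rule ab(2)[OF zon_max_in])
    with ab(1) have "(- a) \<bullet> x > (- a) \<bullet> zon_max I z (- a)" by simp
    with R[rule_format, of "- a"] show False by (simp only: zon_max_support)
  qed
qed (use zon_le_support in blast)

lemma zon_eq_iff_support:
  assumes "finite I" "finite J" "\<And>a. zon_support I z a = zon_support J y a"
  shows "zon I z = zon J y"
  using assms by (auto simp: zon_mem_iff)

text \<open>The set of points where a linear functional attains its maximum.\<close>

lemma zon_face:
  assumes "finite I"
  shows "zon I z \<inter> {x. a \<bullet> x = zon_support I z a} = (\<lambda>x. zon_max I z a + x) ` zon {i \<in> I. a \<bullet> z i = 0} z"
    (is "?L = ?R")
proof (intro equalityI subsetI)
  fix x assume x: "x \<in> ?L"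
  then obtain r where r: "\<And>i. i \<in> I \<Longrightarrow> \<bar>r i\<bar> \<le> 1" "x = (\<Sum>i\<in>I. r i *\<^sub>R z i)" using zonE by blast
  have le: "r i * (a \<bullet> z i) \<le> \<bar>a \<bullet> z i\<bar>" if "i \<in> I" for i
    using r(1)[OF that] by (metis abs_ge_self abs_mult abs_ge_zero mult_left_le_one_le order_trans)
  have "(\<Sum>i\<in>I. r i * (a \<bullet> z i)) = (\<Sum>i\<in>I. \<bar>a \<bullet> z i\<bar>)"
    using x unfolding r(2) zon_support_def by (simp add: inner_sum_right)
  then have eq: "r i * (a \<bullet> z i) = \<bar>a \<bullet> z i\<bar>" if "i \<in> I" for i
    using sum_mono_inv[of "\<lambda>i. r i * (a \<bullet> z i)" I "\<lambda>i. \<bar>a \<bullet> z i\<bar>", OF _ le that assms] by blast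
  have rs: "r i = sgn (a \<bullet> z i)" if "i \<in> I" "a \<bullet> z i \<noteq> 0" for i
    using eq[OF that(1)] that(2) by (metis abs_sgn mult.commute mult_cancel_left)
  have "x = (\<Sum>i\<in>I. sgn (a \<bullet> z i) *\<^sub>R z i + (if a \<bullet> z i = 0 then r i *\<^sub>R z i else 0))"
    unfolding r(2) by (rule sum.cong) (auto simp: rs)
  also have "\<dots> = zon_max I z a + (\<Sum>i\<in>{i \<in> I. a \<bullet> z i = 0}. r i *\<^sub>R z i)"
    using assms by (simp add: sum.distrib zon_max_def sum.inter_filter)
  finally show "x \<in> ?R" using r(1) by (auto intro!: zonI)
next
  fix x assume "x \<in> ?R"
  then obtain y where "y \<in> zon {i \<in> I. a \<bullet> z i = 0} z" and x: "x = zon_max I z a + y" by auto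
  then obtain r where r: "\<And>i. i \<in> {i \<in> I. a \<bullet> z i = 0} \<Longrightarrow> \<bar>r i\<bar> \<le> 1" "y = (\<Sum>i\<in>{i \<in> I. a \<bullet> z i = 0}. r i *\<^sub>R z i)"
    using zonE by blast
  have "x = (\<Sum>i\<in>I. (if a \<bullet> z i = 0 then r i else sgn (a \<bullet> z i)) *\<^sub>R z i)"
  proof -
    have "(\<Sum>i\<in>I. (if a \<bullet> z i = 0 then r i else sgn (a \<bullet> z i)) *\<^sub>R z i)
      = (\<Sum>i\<in>I. sgn (a \<bullet> z i) *\<^sub>R z i + (if a \<bullet> z i = 0 then r i *\<^sub>R z i else 0))"
      by (rule sum.cong) auto
    then show ?thesis using assms by (simp add: x r(2) sum.distrib zon_max_def sum.inter_filter)
  qed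
  also have "\<dots> \<in> zon I z" by (rule zonI) (auto simp: r sgn_if)
  finally have "x \<in> zon I z" .
  moreover have "a \<bullet> y = 0" unfolding r(2) by (simp add: inner_sum_right)
  ultimately show "x \<in> ?L" by (simp add: x inner_add_right zon_max_support)
qed

lemma zon_subset_span: "zon I z \<subseteq> span (z ` I)"
  by (auto simp: zon_def intro: span_sum span_mul span_base)

lemma zon_interior_span:
  assumes "interior (zon I z) \<noteq> {}"
  shows "span (z ` I) = (UNIV :: 'a::euclidean_space set)"
proof (rule ccontr)
  assume "span (z ` I) \<noteq> UNIV"
  then have "dim (zon I z) < DIM('a)"
    by (metis dim_eq_full dim_span dim_subset_UNIV dim_subset le_neq_implies_less order.trans zon_subset_span not_le)
  then show False using assms empty_interior_lowdim by blast
qed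

lemma zon_zero_interior:
  assumes "finite I" "interior (zon I z) \<noteq> {}"
  shows "0 \<in> interior (zon I z)"
proof -
  obtain x where x: "x \<in> interior (zon I z)" using assms by auto
  have "uminus ` zon I z = zon I z" using zon_uminus by (auto simp: image_iff) (metis minus_minus zon_uminus)
  then have "- x \<in> interior (zon I z)" using x interior_negations[of "zon I z"] by force
  then have "(1/2) *\<^sub>R x + (1/2) *\<^sub>R (- x) \<in> interior (zon I z)"
    by (intro convexD[OF convex_interior[OF zon_convex[OF assms(1)]]] x) auto
  then show ?thesis by simp
qed

section \<open>Generic functionals, independent families and small perturbations\<close>

text \<open>Every \<open>y\<close> that is not a multiple of \<open>z\<close> rules out a proper
  subspace of the vectors orthogonal to \<open>z\<close>, and finitely many proper subspaces do not
  exhaust them. The induction adds a multiple of a vector \<open>b\<close> that is good for the new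
  \<open>y\<close>.\<close>

lemma generic_orthogonal:
  fixes z :: "'a::euclidean_space"
  assumes "finite Y" "\<And>y. y \<in> Y \<Longrightarrow> y \<notin> span {z}"
  shows "\<exists>a. a \<bullet> z = 0 \<and> (\<forall>y\<in>Y. a \<bullet> y \<noteq> 0)"
  using assms
proof (induction Y)
  case empty
  show ?case by (rule exI[of _ 0]) simp
next
  case (insert y Y)
  then obtain a where a: "a \<bullet> z = 0" "\<forall>y\<in>Y. a \<bullet> y \<noteq> 0" by auto
  obtain b where b: "b \<bullet> z = 0" "b \<bullet> y \<noteq> 0"
  proof (rule ccontr)
    assume "\<not> thesis"
    then have *: "b \<bullet> y = 0" if "b \<bullet> z = 0" for b using that \<open>\<And>b. b \<bullet> z = 0 \<Longrightarrow> b \<bullet> y \<noteq> 0 \<Longrightarrow> thesis\<close> by blast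
    obtain p q where pq: "p \<in> span {z}" "\<And>w. w \<in> span {z} \<Longrightarrow> orthogonal q w" "y = p + q"
      using orthogonal_subspace_decomp_exists by blast
    have "q \<bullet> z = 0" using pq(2)[of z] by (simp add: span_base orthogonal_def)
    then have "q \<bullet> y = 0" by (rule *)
    moreover have "q \<bullet> p = 0" using pq by (simp add: orthogonal_def)
    ultimately have "q = 0" using pq(3) by (simp add: inner_add_right)
    then show False using pq insert.prems by auto
  qed
  \<comment> \<open>Each old \<open>v\<close> with \<open>b \<bullet> v\<close> nonzero rules out
    the value at which \<open>(a + s *\<^sub>R b) \<bullet> v\<close> vanishes; 0 is ruled out
    because the sum has to be nonzero on \<open>y\<close>.\<close>
  have fin: "finite ({0} \<union> (\<lambda>v. - (a \<bullet> v) / (b \<bullet> v)) ` Y)" using insert.hyps by auto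
  obtain s where s: "s \<notin> {0} \<union> (\<lambda>v. - (a \<bullet> v) / (b \<bullet> v)) ` Y"
    using ex_new_if_finite[OF infinite_UNIV_char_0 fin] by blast
  show ?case
  proof (cases "a \<bullet> y = 0")
    case False then show ?thesis using a by auto
  next
    case True
    have "(a + s *\<^sub>R b) \<bullet> v \<noteq> 0" if "v \<in> Y" for v
    proof
      assume 0: "(a + s *\<^sub>R b) \<bullet> v = 0"
      show False
      proof (cases "b \<bullet> v = 0")
        case True with 0 a that show False by (simp add: inner_add_left)
      next
        case False
        with 0 have "s = - (a \<bullet> v) / (b \<bullet> v)" by (simp add: inner_add_left field_simps)
        with s that show False by auto
      qed
    qed
    moreover have "(a + s *\<^sub>R b) \<bullet> y \<noteq> 0" using True s b by (simp add: inner_add_left)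
    moreover have "(a + s *\<^sub>R b) \<bullet> z = 0" using a b by (simp add: inner_add_left)
    ultimately show ?thesis by auto
  qed
qed

lemma lin_indep_mono: "lin_indep J z \<Longrightarrow> I \<subseteq> J \<Longrightarrow> finite J \<Longrightarrow> lin_indep I z"
  unfolding lin_indep_def
proof (intro allI impI ballI)
  fix u i assume J: "\<forall>u. (\<Sum>i\<in>J. u i *\<^sub>R z i) = 0 \<longrightarrow> (\<forall>i\<in>J. u i = 0)" and I: "I \<subseteq> J" "finite J"
    and u: "(\<Sum>i\<in>I. u i *\<^sub>R z i) = 0" and i: "i \<in> I"
  have "(\<Sum>i\<in>J. (if i \<in> I then u i else 0) *\<^sub>R z i) = (\<Sum>i\<in>I. u i *\<^sub>R z i)"
    using I by (intro sum.mono_neutral_cong_right) auto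
  then have "\<forall>i\<in>J. (if i \<in> I then u i else 0) = 0" using J[rule_format, of "\<lambda>i. if i \<in> I then u i else 0"] u by simp
  then show "u i = 0" using i I by force
qed

lemma lin_indep_inj_independent:
  assumes "finite I" "lin_indep I z"
  shows "inj_on z I" "independent (z ` I)"
proof -
  show inj: "inj_on z I"
  proof (rule inj_onI, rule ccontr)
    fix i j assume ij: "i \<in> I" "j \<in> I" "z i = z j" "i \<noteq> j"
    have "(\<Sum>k\<in>I. ((if k = i then 1 else 0) - (if k = j then 1 else 0)) *\<^sub>R z k) = 0"
      using ij assms(1) by (simp add: scaleR_diff_left sum_subtractf if_distrib[of "\<lambda>c. c *\<^sub>R _"] cong: if_cong)
    then have "\<forall>k\<in>I. (if k = i then 1 else 0) - (if k = j then 1 else 0) = (0::real)"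
      using assms(2)[unfolded lin_indep_def, rule_format, of "\<lambda>k. (if k = i then 1 else 0) - (if k = j then 1 else 0)"] by blast
    with ij show False by force
  qed
  show "independent (z ` I)"
  proof (rule independent_if_scalars_zero)
    fix f x assume f: "(\<Sum>x\<in>z ` I. f x *\<^sub>R x) = 0" and x: "x \<in> z ` I"
    have "(\<Sum>i\<in>I. f (z i) *\<^sub>R z i) = 0" using f by (simp add: sum.reindex[OF inj] comp_def)
    with assms(2) x show "f x = 0" unfolding lin_indep_def by (auto dest!: spec[of _ "\<lambda>i. f (z i)"])
  qed (use assms in simp)
qed

lemma lin_indepI:
  assumes "finite I" "inj_on z I" "independent (z ` I)"
  shows "lin_indep I z"
  unfolding lin_indep_def
proof (intro allI impI ballI)
  fix u i assume u: "(\<Sum>i\<in>I. u i *\<^sub>R z i) = 0" and i: "i \<in> I"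
  define f where "f = (\<lambda>x. u (the_inv_into I z x))"
  have "(\<Sum>x\<in>z ` I. f x *\<^sub>R x) = 0"
    using u by (simp add: sum.reindex[OF assms(2)] f_def the_inv_into_f_f[OF assms(2)] cong: sum.cong)
  then have "f (z i) = 0" using assms(1,3) i independentD[of "z ` I" "z ` I" f "z i"] by auto
  then show "u i = 0" using the_inv_into_f_f[OF assms(2) i] by (simp add: f_def)
qed

lemma lin_indep_functional:
  fixes z :: "nat \<Rightarrow> 'a::euclidean_space"
  assumes "finite I" "lin_indep I z"
  obtains a where "\<And>i. i \<in> I \<Longrightarrow> a \<bullet> z i = t i"
proof -
  note ii = lin_indep_inj_independent[OF assms]
  obtain g :: "'a \<Rightarrow> real" where g: "linear g" "\<forall>x\<in>z ` I. g x = t (the_inv_into I z x)"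
    using linear_independent_extend[OF ii(2), of "\<lambda>x. t (the_inv_into I z x)"] by blast
  have "adjoint g 1 \<bullet> z i = t i" if "i \<in> I" for i
    using g that adjoint_works[OF g(1), of "z i" 1] the_inv_into_f_f[OF ii(1) that]
    by (simp add: inner_commute)
  then show ?thesis using that by blast
qed

text \<open>Provides one step size for which finitely many perturbed terms keep their signs; it
  serves to make support functions behave linearly along a perturbation.\<close>

lemma uniform_small_scale:
  fixes f g :: "'b \<Rightarrow> real"
  assumes "finite Y" "\<And>y. y \<in> Y \<Longrightarrow> f y > 0"
  obtains e where "e > 0" "\<And>y t. y \<in> Y \<Longrightarrow> 0 \<le> t \<Longrightarrow> t \<le> e \<Longrightarrow> t * g y \<le> f y"
proof -
  have "\<exists>e>0. \<forall>y\<in>Y. \<forall>t. 0 \<le> t \<and> t \<le> e \<longrightarrow> t * g y \<le> f y"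
    using assms
  proof (induction Y)
    case empty show ?case by (rule exI[of _ 1]) simp
  next
    case (insert y Y)
    then obtain e where e: "e > 0" "\<forall>y\<in>Y. \<forall>t. 0 \<le> t \<and> t \<le> e \<longrightarrow> t * g y \<le> f y" by auto
    define d where "d = f y / (\<bar>g y\<bar> + 1)"
    have fy: "f y > 0" using insert.prems by simp
    have d: "d > 0" using fy by (simp add: d_def)
    have "t * g y \<le> f y" if t: "0 \<le> t" "t \<le> d" for t
    proof -
      have "t * g y \<le> t * (\<bar>g y\<bar> + 1)" using t by (intro mult_left_mono) auto
      also have "\<dots> \<le> d * (\<bar>g y\<bar> + 1)" using t by (intro mult_right_mono) auto
      also have "\<dots> = f y" by (simp add: d_def)
      finally show ?thesis .
    qed
    then show ?case using e d by (intro exI[of _ "min e d"]) auto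
  qed
  with that show ?thesis by blast
qed

text \<open>The absolute value is linear between \<open>u - v\<close> and \<open>u + v\<close> when
  0 is not strictly between them, so its second difference vanishes.\<close>

lemma abs_add_abs_diff:
  fixes u v :: real
  assumes "\<bar>v\<bar> \<le> \<bar>u\<bar>"
  shows "\<bar>u + v\<bar> + \<bar>u - v\<bar> = 2 * \<bar>u\<bar>"
  using assms by linarith

text \<open>The right-hand sides can be normalised to 1 because 0 is interior. The last conclusion
  records that the inequalities are facets: the generators parallel to a facet span the whole
  hyperplane orthogonal to its normal.\<close>

lemma zon_facets:
  fixes z :: "nat \<Rightarrow> 'a::euclidean_space"
  assumes I: "finite I" and int: "interior (zon I z) \<noteq> {}"
  obtains A where "finite A" "zon I z = {x. \<forall>b\<in>A. b \<bullet> x \<le> 1}"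
    "\<And>b. b \<in> A \<Longrightarrow> zon_support I z b = 1"
    "\<And>b v. b \<in> A \<Longrightarrow> b \<bullet> v = 0 \<Longrightarrow> v \<in> span (z ` {i \<in> I. b \<bullet> z i = 0})"
proof -
  let ?Z = "zon I z"
  have "polyhedron ?Z" using zon_polytope[OF I] polytope_imp_polyhedron by blast
  then obtain F where F: "finite F" "?Z = (affine hull ?Z) \<inter> \<Inter>F"
    "\<And>h. h \<in> F \<Longrightarrow> \<exists>a b. a \<noteq> 0 \<and> h = {x. a \<bullet> x \<le> b}"
    "\<And>F'. F' \<subset> F \<Longrightarrow> ?Z \<subset> (affine hull ?Z) \<inter> \<Inter>F'"
    unfolding polyhedron_Int_affine_minimal by metis
  have "\<exists>ab. \<forall>h\<in>F. fst (ab h) \<noteq> 0 \<and> h = {x. fst (ab h) \<bullet> x \<le> snd (ab h)}"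
    using F(3) by (intro bchoice ballI) (metis fst_conv snd_conv)
  then obtain ab where ab: "\<And>h. h \<in> F \<Longrightarrow> fst (ab h) \<noteq> 0 \<and> h = {x. fst (ab h) \<bullet> x \<le> snd (ab h)}" by metis
  have aff: "affine hull ?Z = UNIV"
    using int affine_hull_nonempty_interior by blast
  have facet: "(?Z \<inter> {x. fst (ab h) \<bullet> x = snd (ab h)}) facet_of ?Z" if "h \<in> F" for h
    using facet_of_polyhedron_explicit[OF F(1,2), of "fst \<circ> ab" "snd \<circ> ab"] ab F(4) that by auto
  have Z0: "0 \<in> interior ?Z" by (rule zon_zero_interior[OF I int])
  have pos: "snd (ab h) > 0" if h: "h \<in> F" for h
  proof -
    obtain e where e: "e > 0" "ball 0 e \<subseteq> ?Z" using Z0 by (auto simp: mem_interior)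
    let ?a = "fst (ab h)"
    have a0: "norm ?a > 0" using ab[OF h] by simp
    have "(e / (2 * norm ?a)) *\<^sub>R ?a \<in> ball 0 e" using e(1) a0 by simp
    then have "(e / (2 * norm ?a)) *\<^sub>R ?a \<in> h" using e(2) F(2) h by blast
    then have "(e / (2 * norm ?a)) * (?a \<bullet> ?a) \<le> snd (ab h)" using ab[OF h] by (metis inner_scaleR_right mem_Collect_eq)
    moreover have "(e / (2 * norm ?a)) * (?a \<bullet> ?a) > 0" using e(1) a0 by simp
    ultimately show ?thesis by linarith
  qed
  define nb where "nb = (\<lambda>h. fst (ab h) /\<^sub>R snd (ab h))"
  have nb_le: "nb h \<bullet> x \<le> 1 \<longleftrightarrow> x \<in> h" if "h \<in> F" for h x
    using ab[OF that] pos[OF that] by (auto simp: nb_def divide_simps inverse_eq_divide)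
  have nb_eq: "nb h \<bullet> x = 1 \<longleftrightarrow> fst (ab h) \<bullet> x = snd (ab h)" if "h \<in> F" for h x
    using pos[OF that] by (auto simp: nb_def divide_simps inverse_eq_divide)
  have Zeq: "?Z = {x. \<forall>b\<in>nb ` F. b \<bullet> x \<le> 1}"
    using F(2) aff nb_le by auto
  have supp: "zon_support I z b = 1" if bF: "b \<in> nb ` F" for b
  proof -
    obtain h where h: "h \<in> F" "b = nb h" using bF by auto
    have "?Z \<inter> {x. fst (ab h) \<bullet> x = snd (ab h)} \<noteq> {}" using facet[OF h(1)] by (auto simp: facet_of_def)
    then obtain x where "x \<in> ?Z" "b \<bullet> x = 1" using nb_eq[OF h(1)] h(2) by auto
    then have "1 \<le> zon_support I z b" using zon_le_support by metis
    moreover have "b \<bullet> zon_max I z b \<le> 1" using zon_max_in[of I z b] Zeq bF by blast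
    ultimately show ?thesis by (simp add: zon_max_support)
  qed
  have sp: "v \<in> span (z ` {i \<in> I. b \<bullet> z i = 0})" if bF: "b \<in> nb ` F" and bv: "b \<bullet> v = 0" for b v
  proof -
    obtain h where h: "h \<in> F" "b = nb h" using bF by auto
    let ?J = "{i \<in> I. b \<bullet> z i = 0}"
    let ?C = "?Z \<inter> {x. b \<bullet> x = 1}"
    have "?C facet_of ?Z" using facet[OF h(1)] nb_eq[OF h(1)] h(2) by simp
    then have "aff_dim ?C = aff_dim ?Z - 1" by (simp add: facet_of_def)
    also have "aff_dim ?Z = int DIM('a)" using int aff_dim_nonempty_interior by blast
    finally have dC: "aff_dim ?C = int DIM('a) - 1" .
    \<comment> \<open>The facet is a translate of the zonotope on the generators in
      \<open>?J\<close>, so their span has at least the dimension of the facet.\<close>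
    have "?C = (+) (zon_max I z b) ` zon ?J z"
      using zon_face[OF I, of z b] supp[OF bF] by simp
    then have "aff_dim ?C = aff_dim (zon ?J z)" by (simp add: aff_dim_translation_eq)
    also have "\<dots> \<le> aff_dim (span (z ` ?J))" by (rule aff_dim_subset[OF zon_subset_span])
    also have "\<dots> = int (dim (span (z ` ?J)))" by (rule aff_dim_subspace) (rule subspace_span)
    finally have ge: "DIM('a) - 1 \<le> dim (span (z ` ?J))" using dC by linarith
    have b0: "b \<noteq> 0" using supp[OF bF] by (auto simp: zon_support_def)
    have sub: "span (z ` ?J) \<subseteq> {x. b \<bullet> x = 0}"
      by (rule span_minimal) (auto simp: subspace_hyperplane)
    have "span (z ` ?J) = {x. b \<bullet> x = 0}"
      by (rule subspace_dim_equal[OF subspace_span subspace_hyperplane sub]) (use ge b0 in \<open>simp add: dim_hyperplane\<close>)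
    then show ?thesis using bv by auto
  qed
  show ?thesis using that[of "nb ` F"] F(1) Zeq supp sp by blast
qed

text \<open>Generators show up as kinks of the support function. At a generic functional orthogonal
  to \<open>z j\<close>, the support function has a kink in direction \<open>z j\<close>; seen from
  the parallelepiped, this kink needs an edge parallel to \<open>z j\<close>. Hence the generators
  are nonzero multiples of distinct members of \<open>B\<close>.\<close>

lemma parallelepiped_lin_indep:
  fixes z :: "nat \<Rightarrow> real^'n::finite"
  assumes J: "finite J" and np: "\<And>i j. i \<in> J \<Longrightarrow> j \<in> J \<Longrightarrow> i \<noteq> j \<Longrightarrow> z i \<notin> span {z j}"
    and nz: "\<And>j. j \<in> J \<Longrightarrow> z j \<noteq> 0"
    and P: "parallelepiped ((\<lambda>x. p + x) ` zon J z)"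
  shows "lin_indep J z"
proof -
  obtain c B where B: "independent B" and eq: "(\<lambda>x. p + x) ` zon J z = {c} + (\<Sum>b\<in>B. closed_segment 0 b)"
    using P by (auto simp: parallelepiped_def)
  have finB: "finite B" using B independent_imp_finite by blast
  have seg: "closed_segment 0 b = {t *\<^sub>R b |t. 0 \<le> t \<and> t \<le> 1}" for b :: "real^'n"
    by (auto simp: closed_segment_def)
  have sumB: "(\<Sum>b\<in>B. closed_segment 0 b) = {\<Sum>b\<in>B. t b *\<^sub>R b | t. \<forall>b\<in>B. 0 \<le> t b \<and> t b \<le> 1}"
  proof -
    have "(\<Sum>b\<in>B. closed_segment 0 b) = {\<Sum>b\<in>B. s b | s. \<forall>b\<in>B. s b \<in> closed_segment 0 b}"
      using set_sum_alt[OF finB] by auto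
    also have "\<dots> = {\<Sum>b\<in>B. t b *\<^sub>R b | t. \<forall>b\<in>B. 0 \<le> t b \<and> t b \<le> 1}"
    proof safe
      fix s assume "\<forall>b\<in>B. s b \<in> closed_segment 0 b"
      then have "\<forall>b\<in>B. \<exists>t. s b = t *\<^sub>R b \<and> 0 \<le> t \<and> t \<le> 1" unfolding seg by blast
      then obtain t where "\<forall>b\<in>B. s b = t b *\<^sub>R b \<and> 0 \<le> t b \<and> t b \<le> 1" by metis
      then show "\<exists>t. (\<Sum>b\<in>B. s b) = (\<Sum>b\<in>B. t b *\<^sub>R b) \<and> (\<forall>b\<in>B. 0 \<le> t b \<and> t b \<le> 1)"
        by (intro exI[of _ t]) (auto intro!: sum.cong)
    next
      fix t :: "real^'n \<Rightarrow> real" assume "\<forall>b\<in>B. 0 \<le> t b \<and> t b \<le> 1"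
      then show "\<exists>s. (\<Sum>b\<in>B. t b *\<^sub>R b) = (\<Sum>b\<in>B. s b) \<and> (\<forall>b\<in>B. s b \<in> closed_segment 0 b)"
        unfolding seg by (intro exI[of _ "\<lambda>b. t b *\<^sub>R b"]) auto
    qed
    finally show ?thesis .
  qed
  have mem: "p + y \<in> {c} + (\<Sum>b\<in>B. closed_segment 0 b) \<longleftrightarrow> y \<in> zon J z" for y
    unfolding eq[symmetric] by auto
  have S1: "a \<bullet> p + zon_support J z a = a \<bullet> c + (\<Sum>b\<in>B. max 0 (a \<bullet> b))" for a
  proof (rule antisym)
    have "p + zon_max J z a \<in> {c} + (\<Sum>b\<in>B. closed_segment 0 b)" using zon_max_in mem by blast
    then obtain t where t: "p + zon_max J z a = c + (\<Sum>b\<in>B. t b *\<^sub>R b)" "\<forall>b\<in>B. 0 \<le> t b \<and> t b \<le> 1"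
      unfolding sumB by (auto simp: set_plus_def)
    have "a \<bullet> p + zon_support J z a = a \<bullet> (p + zon_max J z a)" by (simp add: inner_add_right zon_max_support)
    also have "\<dots> = a \<bullet> c + (\<Sum>b\<in>B. t b * (a \<bullet> b))" unfolding t(1) by (simp add: inner_add_right inner_sum_right)
    also have "(\<Sum>b\<in>B. t b * (a \<bullet> b)) \<le> (\<Sum>b\<in>B. max 0 (a \<bullet> b))"
    proof (rule sum_mono)
      fix b assume "b \<in> B"
      then have "0 \<le> t b" "t b \<le> 1" using t by auto
      then show "t b * (a \<bullet> b) \<le> max 0 (a \<bullet> b)"
        by (cases "a \<bullet> b \<ge> 0") (auto simp: mult_left_le_one_le mult_nonneg_nonpos intro: max.coboundedI1)
    qed
    finally show "a \<bullet> p + zon_support J z a \<le> a \<bullet> c + (\<Sum>b\<in>B. max 0 (a \<bullet> b))" by simp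
  next
    define q where "q = (\<Sum>b\<in>B. (if a \<bullet> b > 0 then 1 else 0) *\<^sub>R b)"
    have "c + q \<in> {c} + (\<Sum>b\<in>B. closed_segment 0 b)"
      unfolding sumB q_def by (intro set_plus_intro CollectI exI[of _ "\<lambda>b. if a \<bullet> b > 0 then 1 else 0"]) auto
    then have "c + q - p \<in> zon J z" using mem[of "c + q - p"] by simp
    then have "a \<bullet> (c + q - p) \<le> zon_support J z a" by (rule zon_le_support)
    moreover have "a \<bullet> q = (\<Sum>b\<in>B. max 0 (a \<bullet> b))"
      unfolding q_def by (auto simp: inner_sum_right intro!: sum.cong)
    ultimately show "a \<bullet> c + (\<Sum>b\<in>B. max 0 (a \<bullet> b)) \<le> a \<bullet> p + zon_support J z a"
      by (simp add: inner_diff_right inner_add_right)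
  qed
  \<comment> \<open>Adding the values at \<open>a\<close> and \<open>- a\<close> eliminates the
    translations \<open>p\<close> and \<open>c\<close>. The factor 2 arises because generators stand
    for \<open>[-z, z]\<close> but edges for \<open>[0, b]\<close>.\<close>
  have S: "2 * zon_support J z a = (\<Sum>b\<in>B. \<bar>a \<bullet> b\<bar>)" for a
  proof -
    have "2 * zon_support J z a = (a \<bullet> p + zon_support J z a) + ((- a) \<bullet> p + zon_support J z (- a))"
      by (simp add: zon_support_def)
    also have "\<dots> = (\<Sum>b\<in>B. max 0 (a \<bullet> b)) + (\<Sum>b\<in>B. max 0 ((- a) \<bullet> b))"
      unfolding S1 by simp
    also have "\<dots> = (\<Sum>b\<in>B. \<bar>a \<bullet> b\<bar>)"
      unfolding sum.distrib[symmetric] by (rule sum.cong) auto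
    finally show ?thesis .
  qed
  have ex: "\<exists>b\<in>B. b \<in> span {z j}" if j: "j \<in> J" for j
  proof (rule ccontr)
    assume "\<not> (\<exists>b\<in>B. b \<in> span {z j})"
    then have "\<And>y. y \<in> B \<union> z ` (J - {j}) \<Longrightarrow> y \<notin> span {z j}" using np j by auto
    then obtain a where a: "a \<bullet> z j = 0" "\<forall>y\<in>B \<union> z ` (J - {j}). a \<bullet> y \<noteq> 0"
      using generic_orthogonal[of "B \<union> z ` (J - {j})" "z j"] finB J by auto
    \<comment> \<open>For this \<open>e\<close> none of the terms other than that of
      \<open>z j\<close> has a second difference between \<open>a - e *\<^sub>R z j\<close> and
      \<open>a + e *\<^sub>R z j\<close>, whereas \<open>z j\<close> itself contributes
      \<open>2 * e * (z j \<bullet> z j)\<close>.\<close>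
    obtain e where e: "e > 0" "\<And>y t. y \<in> B \<union> z ` (J - {j}) \<Longrightarrow> 0 \<le> t \<Longrightarrow> t \<le> e \<Longrightarrow> t * \<bar>z j \<bullet> y\<bar> \<le> \<bar>a \<bullet> y\<bar>"
      using uniform_small_scale[of "B \<union> z ` (J - {j})" "\<lambda>y. \<bar>a \<bullet> y\<bar>" "\<lambda>y. \<bar>z j \<bullet> y\<bar>"] a finB J by (metis (no_types, lifting) finite_Diff finite_UnI finite_imageI zero_less_abs_iff)
    have lin: "\<bar>(a + e *\<^sub>R z j) \<bullet> y\<bar> + \<bar>(a - e *\<^sub>R z j) \<bullet> y\<bar> = 2 * \<bar>a \<bullet> y\<bar>" if "y \<in> B \<union> z ` (J - {j})" for y
      unfolding inner_add_left inner_diff_left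
      by (rule abs_add_abs_diff) (use e(2)[OF that, of e] e(1) in \<open>simp add: abs_mult\<close>)
    have 1: "zon_support J z (a + e *\<^sub>R z j) + zon_support J z (a - e *\<^sub>R z j) = 2 * zon_support J z a"
    proof -
      have "2 * (zon_support J z (a + e *\<^sub>R z j) + zon_support J z (a - e *\<^sub>R z j)) = (\<Sum>b\<in>B. 2 * \<bar>a \<bullet> b\<bar>)"
        unfolding distrib_left S sum.distrib[symmetric] by (rule sum.cong) (auto intro: lin)
      also have "\<dots> = 2 * (2 * zon_support J z a)" unfolding S by (simp add: sum_distrib_left)
      finally show ?thesis by simp
    qed
    have "zon_support J z b = \<bar>b \<bullet> z j\<bar> + (\<Sum>i\<in>J - {j}. \<bar>b \<bullet> z i\<bar>)" for b
      unfolding zon_support_def using J j by (simp add: sum.remove)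
    moreover have "(\<Sum>i\<in>J - {j}. \<bar>(a + e *\<^sub>R z j) \<bullet> z i\<bar>) + (\<Sum>i\<in>J - {j}. \<bar>(a - e *\<^sub>R z j) \<bullet> z i\<bar>) = 2 * (\<Sum>i\<in>J - {j}. \<bar>a \<bullet> z i\<bar>)"
      unfolding sum.distrib[symmetric] sum_distrib_left by (rule sum.cong) (auto intro: lin)
    ultimately have "\<bar>(a + e *\<^sub>R z j) \<bullet> z j\<bar> + \<bar>(a - e *\<^sub>R z j) \<bullet> z j\<bar> = 2 * \<bar>a \<bullet> z j\<bar>"
      using 1 by simp
    then have "e * (z j \<bullet> z j) = 0" using a(1) e(1) by (simp add: inner_add_left inner_diff_left)
    then show False using e(1) nz[OF j] by simp
  qed
  then obtain g where g: "\<And>j. j \<in> J \<Longrightarrow> g j \<in> B \<and> g j \<in> span {z j}" by metis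
  have B0: "0 \<notin> B" using B dependent_zero by blast
  have "\<exists>r. r \<noteq> 0 \<and> z j = r *\<^sub>R g j" if j: "j \<in> J" for j
  proof -
    obtain r where r: "g j = r *\<^sub>R z j" using g[OF j] by (auto simp: span_singleton)
    then have "r \<noteq> 0" using g[OF j] B0 by auto
    then show ?thesis using r by (intro exI[of _ "inverse r"]) auto
  qed
  then obtain r where r: "\<And>j. j \<in> J \<Longrightarrow> r j \<noteq> 0 \<and> z j = r j *\<^sub>R g j" by metis
  have inj: "inj_on g J"
  proof (rule inj_onI, rule ccontr)
    fix i j assume ij: "i \<in> J" "j \<in> J" "g i = g j" "i \<noteq> j"
    have "z i = r i *\<^sub>R g j" using r ij by simp
    also have "\<dots> \<in> span {z j}" using g[OF ij(2)] by (auto intro: span_mul)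
    finally show False using np ij by blast
  qed
  show ?thesis unfolding lin_indep_def
  proof (intro allI impI ballI)
    fix u i assume u: "(\<Sum>i\<in>J. u i *\<^sub>R z i) = 0" and i: "i \<in> J"
    have li: "lin_indep J g"
      by (rule lin_indepI[OF J inj], rule independent_mono[OF B]) (use g in auto)
    have "(\<Sum>i\<in>J. (u i * r i) *\<^sub>R g i) = (\<Sum>i\<in>J. u i *\<^sub>R z i)"
      by (rule sum.cong) (use r in auto)
    then have "\<forall>i\<in>J. u i * r i = 0" using li[unfolded lin_indep_def, rule_format, of "\<lambda>i. u i * r i"] u by simp
    then show "u i = 0" using i r by auto
  qed
qed

text \<open>A nonzero functional orthogonal to \<open>z k\<close> is maximal on a proper face that
  still has the segment of \<open>z k\<close> as a summand. This face belongs to the zone, so it is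
  a parallelepiped, and its generators are the \<open>z i\<close> orthogonal to
  \<open>a\<close>.\<close>

lemma zone_lin_indep:
  fixes z :: "nat \<Rightarrow> real^'n::finite"
  assumes I: "finite I" and np: "\<And>i j. i \<in> I \<Longrightarrow> j \<in> I \<Longrightarrow> i \<noteq> j \<Longrightarrow> z i \<notin> span {z j}"
    and nz: "\<And>j. j \<in> I \<Longrightarrow> z j \<noteq> 0"
    and int: "interior (zon I z) \<noteq> {}"
    and cub: "\<And>F. F \<in> zone (zon I z) (z k) \<Longrightarrow> parallelepiped F"
    and k: "k \<in> I" and a: "a \<noteq> 0" "a \<bullet> z k = 0"
  shows "lin_indep {i \<in> I. a \<bullet> z i = 0} z"
proof -
  let ?J = "{i \<in> I. a \<bullet> z i = 0}"
  let ?F = "zon I z \<inter> {x. a \<bullet> x = zon_support I z a}"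
  have F: "?F = (\<lambda>x. zon_max I z a + x) ` zon ?J z" by (rule zon_face[OF I])
  have "?F \<in> zone (zon I z) (z k)"
    unfolding zone_def mem_Collect_eq
  proof (intro conjI)
    show "?F face_of zon I z"
      by (rule face_of_Int_supporting_hyperplane_le[OF zon_convex[OF I]]) (rule zon_le_support)
    show "?F \<noteq> {}" unfolding F using zon_zero by auto
    show "?F \<noteq> zon I z"
    proof
      assume eq: "?F = zon I z"
      then have "0 \<in> ?F" using zon_zero by auto
      then have s0: "zon_support I z a = 0" by simp
      obtain e where e: "e > 0" "ball 0 e \<subseteq> zon I z" using zon_zero_interior[OF I int] by (auto simp: mem_interior)
      have "(e / (2 * norm a)) *\<^sub>R a \<in> ball 0 e" using e(1) a by simp
      then have "(e / (2 * norm a)) *\<^sub>R a \<in> ?F" using e(2) eq by auto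
      then have "(e / (2 * norm a)) * (a \<bullet> a) = 0" using s0 by simp
      then show False using e(1) a by simp
    qed
    have finJ: "finite ?J" using I by simp
    have kJ: "k \<in> ?J" using k a by simp
    have "zon ?J z = closed_segment (- z k) (z k) + zon (?J - {k}) z"
      unfolding zon_eq_sum[OF finJ, symmetric] zon_eq_sum[OF finite_Diff[OF finJ], symmetric]
      by (rule sum.remove[OF finJ kJ])
    then have "?F = closed_segment (- z k) (z k) + (\<lambda>x. zon_max I z a + x) ` zon (?J - {k}) z"
      unfolding F by (auto simp: set_plus_def image_iff) (metis add.left_commute)+
    moreover have "compact ((\<lambda>x. zon_max I z a + x) ` zon (?J - {k}) z)" "convex ((\<lambda>x. zon_max I z a + x) ` zon (?J - {k}) z)"
      using zon_compact[of "?J - {k}" z] zon_convex[of "?J - {k}" z] finJ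
      by (auto intro: compact_translation convex_translation)
    moreover have "(\<lambda>x. zon_max I z a + x) ` zon (?J - {k}) z \<noteq> {}" using zon_zero by auto
    ultimately show "minkowski_summand (closed_segment (- z k) (z k)) ?F"
      unfolding minkowski_summand_def by blast
  qed
  then have "parallelepiped ?F" by (rule cub)
  then show ?thesis
    unfolding F by (rule parallelepiped_lin_indep[rotated -1]) (use I np nz in auto)
qed

section \<open>Movements compatible with a reflection\<close>

lemma convex_body_zon:
  fixes z :: "nat \<Rightarrow> real^'n::finite"
  assumes "finite I" "interior (zon I z) \<noteq> {}"
  shows "convex_body (zon I z)"
  using assms by (simp add: convex_body_def zon_compact zon_convex)

text \<open>The ball bounds the support function below by \<open>\<rho> * norm a\<close>, and moving
  the generators costs at most their total displacement times \<open>norm a\<close>; a smaller ball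
  survives.\<close>

lemma zon_perturb_interior:
  fixes z y :: "nat \<Rightarrow> 'a::euclidean_space"
  assumes I: "finite I" and r: "cball 0 \<rho> \<subseteq> zon I z" "\<rho> \<ge> 0" and small: "(\<Sum>i\<in>I. norm (y i - z i)) < \<rho>"
  shows "interior (zon I y) \<noteq> {}"
proof -
  define D where "D = (\<Sum>i\<in>I. norm (y i - z i))"
  have sz: "\<rho> * norm a \<le> zon_support I z a" for a
  proof (cases "a = 0")
    case False
    have "(\<rho> / norm a) *\<^sub>R a \<in> zon I z" using r False by (intro subsetD[OF r(1)]) simp
    from zon_le_support[OF this, of a] show ?thesis
      using False by (simp add: power2_norm_eq_inner[symmetric] power2_eq_square)
  qed (simp add: zon_support_def)
  have "zon_support I z a \<le> zon_support I y a + D * norm a" for a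
  proof -
    have "zon_support I z a \<le> (\<Sum>i\<in>I. \<bar>a \<bullet> y i\<bar> + norm (y i - z i) * norm a)"
      unfolding zon_support_def
    proof (rule sum_mono)
      fix i
      have "\<bar>a \<bullet> z i\<bar> = \<bar>a \<bullet> y i - a \<bullet> (y i - z i)\<bar>" by (simp add: inner_diff_right)
      also have "\<dots> \<le> \<bar>a \<bullet> y i\<bar> + \<bar>a \<bullet> (y i - z i)\<bar>" by linarith
      also have "\<bar>a \<bullet> (y i - z i)\<bar> \<le> norm (y i - z i) * norm a"
        using Cauchy_Schwarz_ineq2[of a "y i - z i"] by (simp add: mult.commute)
      finally show "\<bar>a \<bullet> z i\<bar> \<le> \<bar>a \<bullet> y i\<bar> + norm (y i - z i) * norm a" by simp
    qed
    then show ?thesis by (simp add: zon_support_def D_def sum.distrib sum_distrib_right)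
  qed
  note zy = this
  have sy: "(\<rho> - D) * norm a \<le> zon_support I y a" for a
    using sz[of a] zy[of a] unfolding left_diff_distrib by linarith
  have "ball 0 (\<rho> - D) \<subseteq> zon I y"
  proof
    fix x :: 'a assume "x \<in> ball 0 (\<rho> - D)"
    then have "norm x \<le> \<rho> - D" by simp
    have "a \<bullet> x \<le> zon_support I y a" for a
    proof -
      have "a \<bullet> x \<le> norm a * norm x" by (rule norm_cauchy_schwarz)
      also have "\<dots> \<le> norm a * (\<rho> - D)" using \<open>norm x \<le> \<rho> - D\<close> by (intro mult_left_mono) auto
      also have "\<dots> \<le> zon_support I y a" using sy[of a] by (simp only: mult.commute)
      finally show ?thesis .
    qed
    then show "x \<in> zon I y" using zon_mem_iff[OF I] by blast
  qed
  moreover have "\<rho> - D > 0" using small by (simp add: D_def)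
  ultimately show ?thesis
    by (metis centre_in_ball empty_iff mem_interior)
qed

lemma zon_perturb_hausdorff:
  fixes z y :: "nat \<Rightarrow> 'a::euclidean_space"
  assumes I: "finite I"
  shows "hausdorff_dist (zon I y) (zon I z) \<le> (\<Sum>i\<in>I. norm (y i - z i))"
proof -
  have *: "\<exists>b\<in>zon I z. dist a b \<le> (\<Sum>i\<in>I. norm (y i - z i))" if a: "a \<in> zon I y" for a and y z :: "nat \<Rightarrow> 'a"
  proof -
    obtain r where r: "\<And>i. i \<in> I \<Longrightarrow> \<bar>r i\<bar> \<le> 1" "a = (\<Sum>i\<in>I. r i *\<^sub>R y i)" using zonE[OF a] by blast
    have "dist a (\<Sum>i\<in>I. r i *\<^sub>R z i) = norm (\<Sum>i\<in>I. r i *\<^sub>R (y i - z i))"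
      unfolding r(2) dist_norm by (simp add: sum_subtractf scaleR_diff_right)
    also have "\<dots> \<le> (\<Sum>i\<in>I. norm (y i - z i))"
      by (rule sum_norm_le) (use r(1) in \<open>simp add: mult_left_le_one_le\<close>)
    finally show ?thesis using zonI[of I r z] r(1) by blast
  qed
  show ?thesis
    by (rule hausdorff_dist_le)
      (use *[of _ y z] *[of _ z y] zon_zero[of I y] zon_zero[of I z] in \<open>auto simp: norm_minus_commute\<close>)
qed

text \<open>Moving every generator \<open>z i\<close> to \<open>z i + (t * d i) w\<close> yields bodies whose Steiner
  symmetral in direction \<open>w\<close> is the original zonotope, provided that \<open>d\<close> is compatible with the
  reflection and, on the generators of every facet transversal to \<open>w\<close>, is induced by a linear functional.\<close>

lemma mirror_movement_linear:
  fixes z :: "nat \<Rightarrow> real^'n::finite"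
  assumes I: "finite I" and int: "interior (zon I z) \<noteq> {}"
    and iso: "isotropic (zon I z)"
    and lm: "local_maximizer_isotropic_constant {K. convex_body K \<and> centrally_symmetric K} (zon I z)"
    and A: "finite A" "zon I z = {x. \<forall>b\<in>A. b \<bullet> x \<le> 1}" "\<And>b. b \<in> A \<Longrightarrow> zon_support I z b = 1"
    and w: "norm w = 1"
    and \<pi>: "bij_betw \<pi> I I"
    and \<epsilon>: "\<And>i. i \<in> I \<Longrightarrow> \<bar>\<epsilon> i\<bar> = 1"
    and mirror: "\<And>i. i \<in> I \<Longrightarrow> z i - (2 * (z i \<bullet> w)) *\<^sub>R w = \<epsilon> i *\<^sub>R z (\<pi> i)"
    and d: "\<And>i. i \<in> I \<Longrightarrow> d (\<pi> i) = \<epsilon> i * d i"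
    and d0: "\<And>i. i \<in> I \<Longrightarrow> z i \<in> span {w} \<Longrightarrow> d i = 0"
    and lin: "\<And>b. b \<in> A \<Longrightarrow> b \<bullet> w \<noteq> 0 \<Longrightarrow>
      \<exists>a. a \<bullet> w = 0 \<and> (\<forall>i\<in>I. b \<bullet> z i = 0 \<longrightarrow> a \<bullet> z i = - (d i * (b \<bullet> w)))"
  obtains c where "c \<bullet> w = 0" "\<And>i. i \<in> I \<Longrightarrow> c \<bullet> z i = d i"
proof -
  let ?Z = "zon I z"
  have ww: "w \<bullet> w = 1" using w by (simp add: norm_eq_sqrt_inner)
  define R where "R = (\<lambda>x::real^'n. x - (2 * (x \<bullet> w)) *\<^sub>R w)"
  have Rinner: "a \<bullet> R x = R a \<bullet> x" for a x
    by (simp add: R_def inner_diff_left inner_diff_right inner_commute)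
  have Rw: "R (x + s *\<^sub>R w) = R x - s *\<^sub>R w" for x s
  proof -
    have "(2 * s) *\<^sub>R w = s *\<^sub>R w + s *\<^sub>R w" by (metis mult_2 scaleR_add_left)
    then show ?thesis by (simp add: R_def inner_add_left ww distrib_left scaleR_add_left)
  qed
  have RR: "R (R x) = x" for x
    by (simp add: R_def inner_diff_left ww)
  define y where "y = (\<lambda>t i. z i + (t * d i) *\<^sub>R w)"
  define K where "K = (\<lambda>t. zon I (y t))"
  have K0: "K 0 = ?Z" by (simp add: K_def y_def)
  have Ry: "R (y t i) = \<epsilon> i *\<^sub>R y (- t) (\<pi> i)" if "i \<in> I" for t i
  proof -
    have "R (y t i) = R (z i) - (t * d i) *\<^sub>R w" unfolding y_def by (rule Rw)
    also have "R (z i) = \<epsilon> i *\<^sub>R z (\<pi> i)" using mirror[OF that] by (simp add: R_def)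
    also have "\<epsilon> i * \<epsilon> i = 1" using \<epsilon>[OF that] by (metis abs_mult_self_eq mult_1)
    then have "d i = \<epsilon> i * d (\<pi> i)" using d[OF that] by (simp add: mult.assoc[symmetric])
    then have "(t * d i) *\<^sub>R w = \<epsilon> i *\<^sub>R ((t * d (\<pi> i)) *\<^sub>R w)" by simp
    finally show ?thesis by (simp add: y_def algebra_simps)
  qed
  \<comment> \<open>Up to order and sign, the reflection carries the generators of
    \<open>K t\<close> to those of \<open>K (- t)\<close>.\<close>
  have RK: "R x \<in> K (- t)" if x: "x \<in> K t" for x t
    unfolding K_def zon_mem_iff[OF I]
  proof
    fix a
    have "a \<bullet> R x = R a \<bullet> x" by (rule Rinner)
    also have "\<dots> \<le> zon_support I (y t) (R a)" using x unfolding K_def by (rule zon_le_support)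
    also have "\<dots> = (\<Sum>i\<in>I. \<bar>a \<bullet> y (- t) (\<pi> i)\<bar>)"
      unfolding zon_support_def Rinner[symmetric] by (rule sum.cong) (simp_all add: Ry abs_mult \<epsilon>)
    also have "\<dots> = zon_support I (y (- t)) a"
      unfolding zon_support_def by (rule sum.reindex_bij_betw[OF \<pi>])
    finally show "a \<bullet> R x \<le> zon_support I (y (- t)) a" .
  qed
  have RZ: "R x \<in> ?Z" if "x \<in> ?Z" for x using RK[of x 0] that K0 by simp
  have up: "(\<Sum>i\<in>I. r i *\<^sub>R z i) + (t * (\<Sum>i\<in>I. r i * d i)) *\<^sub>R w \<in> K t"
    if "\<And>i. i \<in> I \<Longrightarrow> \<bar>r i\<bar> \<le> 1" for r t
  proof -
    have "(\<Sum>i\<in>I. r i *\<^sub>R z i) + (t * (\<Sum>i\<in>I. r i * d i)) *\<^sub>R w = (\<Sum>i\<in>I. r i *\<^sub>R y t i)"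
      by (simp add: y_def scaleR_add_right sum.distrib sum_distrib_left scaleR_sum_left mult_ac)
    then show ?thesis unfolding K_def using zonI[of I r "y t"] that by simp
  qed
  \<comment> \<open>\<open>b + t *\<^sub>R a b\<close> is the normal of the moved facet. As
    \<open>a b\<close> is orthogonal to \<open>w\<close>, its product with the moved generator is
    exactly \<open>b \<bullet> z i + t * (a b \<bullet> z i + d i * (b \<bullet> w))\<close>, which
    is 0 for the generators of the facet.\<close>
  have "\<exists>a. \<forall>b\<in>A. b \<bullet> w \<noteq> 0 \<longrightarrow> a b \<bullet> w = 0 \<and> (\<forall>i\<in>I. b \<bullet> z i = 0 \<longrightarrow> a b \<bullet> z i = - (d i * (b \<bullet> w)))"
    using lin by (intro bchoice) blast
  then obtain a where a: "\<And>b. b \<in> A \<Longrightarrow> b \<bullet> w \<noteq> 0 \<Longrightarrow> a b \<bullet> w = 0"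
    "\<And>b i. b \<in> A \<Longrightarrow> b \<bullet> w \<noteq> 0 \<Longrightarrow> i \<in> I \<Longrightarrow> b \<bullet> z i = 0 \<Longrightarrow> a b \<bullet> z i = - (d i * (b \<bullet> w))" by blast
  \<comment> \<open>Up to \<open>e0\<close>, generators outside the facet stay on their side of the
    moved hyperplane.\<close>
  obtain e0 where e0: "e0 > 0" "\<And>b i t. b \<in> A \<Longrightarrow> i \<in> I \<Longrightarrow> b \<bullet> z i \<noteq> 0 \<Longrightarrow> 0 \<le> t \<Longrightarrow> t \<le> e0 \<Longrightarrow>
      t * \<bar>a b \<bullet> z i + d i * (b \<bullet> w)\<bar> \<le> \<bar>b \<bullet> z i\<bar>"
  proof -
    let ?Y = "{p \<in> A \<times> I. fst p \<bullet> z (snd p) \<noteq> 0}"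
    have "finite ?Y" using A(1) I by simp
    then obtain e where "e > 0" "\<And>p t. p \<in> ?Y \<Longrightarrow> 0 \<le> t \<Longrightarrow> t \<le> e \<Longrightarrow>
        t * \<bar>a (fst p) \<bullet> z (snd p) + d (snd p) * (fst p \<bullet> w)\<bar> \<le> \<bar>fst p \<bullet> z (snd p)\<bar>"
      using uniform_small_scale[of ?Y "\<lambda>p. \<bar>fst p \<bullet> z (snd p)\<bar>" "\<lambda>p. \<bar>a (fst p) \<bullet> z (snd p) + d (snd p) * (fst p \<bullet> w)\<bar>"]
      by (metis (mono_tags, lifting) mem_Collect_eq zero_less_abs_iff)
    then show ?thesis by (intro that[of e]) force+
  qed
  obtain \<delta> where \<delta>: "\<delta> > 0"
    "\<And>K. convex_body K \<Longrightarrow> (\<And>x. - x \<in> K \<longleftrightarrow> x \<in> K) \<Longrightarrow> hausdorff_dist K ?Z < \<delta> \<Longrightarrow>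
      det (\<chi> i j. (LINT x:K|lborel. x $ i * x $ j) / measure lborel K) * (measure lborel ?Z)\<^sup>2 \<le> (measure lborel K)\<^sup>2"
    using isotropic_local_maximizer_det[OF iso lm] by blast
  obtain \<rho> where \<rho>: "\<rho> > 0" "cball 0 \<rho> \<subseteq> ?Z"
    using zon_zero_interior[OF I int] by (auto simp: mem_interior_cball)
  define D where "D = (\<Sum>i\<in>I. \<bar>d i\<bar>)"
  have D0: "D \<ge> 0" by (simp add: D_def sum_nonneg)
  \<comment> \<open>One movement size for three demands: \<open>e0\<close> for \<open>mid\<close>,
    \<open>\<delta>\<close> for local maximality and \<open>\<rho>\<close> for a nonempty interior.
    The summand 1 in \<open>D + 1\<close> avoids a division by 0.\<close>
  define t where "t = min e0 (min \<delta> \<rho> / (2 * (D + 1)))"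
  have t0: "t > 0" using e0(1) \<delta>(1) \<rho>(1) D0 by (simp add: t_def)
  have te: "t \<le> e0" by (simp add: t_def)
  have tD: "t * D < min \<delta> \<rho>"
  proof -
    have "t * D \<le> (min \<delta> \<rho> / (2 * (D + 1))) * D" using D0 by (intro mult_right_mono) (auto simp: t_def)
    also have "\<dots> < min \<delta> \<rho>"
    proof -
      have *: "x / (2 * (D + 1)) * D < x" if "x > 0" for x
        using that D0 by (simp add: field_simps add_nonneg_pos)
      show ?thesis by (rule *) (use \<delta>(1) \<rho>(1) in simp)
    qed
    finally show ?thesis .
  qed
  have sumD: "(\<Sum>i\<in>I. norm (y t i - z i)) = t * D"
    using t0 w by (simp add: y_def D_def abs_mult sum_distrib_left)
  \<comment> \<open>The constraint of \<open>K t\<close> with normal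
    \<open>b + t *\<^sub>R a b\<close> and that of \<open>K (- t)\<close> with normal
    \<open>b - t *\<^sub>R a b\<close> are averaged. Their support values add up to twice that of
    \<open>b\<close> on \<open>?Z\<close>, because no generator changes side. Constraints with
    \<open>b\<close> orthogonal to \<open>w\<close> are unaffected by the movement.\<close>
  have mid: "x \<in> ?Z" if x1: "x + s *\<^sub>R w \<in> K t" and x2: "x - s *\<^sub>R w \<in> K (- t)" for x s
  proof -
    have "b \<bullet> x \<le> 1" if b: "b \<in> A" for b
    proof (cases "b \<bullet> w = 0")
      case True
      have "b \<bullet> x = b \<bullet> (x + s *\<^sub>R w)" using True by (simp add: inner_add_right)
      also have "\<dots> \<le> zon_support I (y t) b" using x1 unfolding K_def by (rule zon_le_support)
      also have "\<dots> = zon_support I z b" using True by (simp add: zon_support_def y_def inner_add_right)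
      finally show ?thesis using A(3)[OF b] by simp
    next
      case False
      let ?a = "a b"
      have a0: "?a \<bullet> w = 0" by (rule a(1)[OF b False])
      have "(b + t *\<^sub>R ?a) \<bullet> (x + s *\<^sub>R w) + (b - t *\<^sub>R ?a) \<bullet> (x - s *\<^sub>R w) = 2 * (b \<bullet> x)"
        using a0 by (simp add: inner_add_left inner_add_right inner_diff_left inner_diff_right)
      moreover have "(b + t *\<^sub>R ?a) \<bullet> (x + s *\<^sub>R w) \<le> zon_support I (y t) (b + t *\<^sub>R ?a)"
        using x1 unfolding K_def by (rule zon_le_support)
      moreover have "(b - t *\<^sub>R ?a) \<bullet> (x - s *\<^sub>R w) \<le> zon_support I (y (- t)) (b - t *\<^sub>R ?a)"
        using x2 unfolding K_def by (rule zon_le_support)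
      moreover have "zon_support I (y t) (b + t *\<^sub>R ?a) + zon_support I (y (- t)) (b - t *\<^sub>R ?a) = 2 * zon_support I z b"
        unfolding zon_support_def sum.distrib[symmetric] sum_distrib_left
      proof (rule sum.cong[OF refl])
        fix i assume i: "i \<in> I"
        let ?v = "t * (?a \<bullet> z i + d i * (b \<bullet> w))"
        have e1: "(b + t *\<^sub>R ?a) \<bullet> y t i = b \<bullet> z i + ?v"
          using a0 by (simp add: y_def inner_add_left inner_add_right algebra_simps)
        have e2: "(b - t *\<^sub>R ?a) \<bullet> y (- t) i = b \<bullet> z i - ?v"
          using a0 by (simp add: y_def inner_add_left inner_add_right inner_diff_left inner_diff_right algebra_simps)
        have "\<bar>?v\<bar> \<le> \<bar>b \<bullet> z i\<bar>"
        proof (cases "b \<bullet> z i = 0")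
          case True then show ?thesis using a(2)[OF b False i] by simp
        next
          case nz: False
          show ?thesis using e0(2)[OF b i nz _ te] t0 by (simp add: abs_mult)
        qed
        then show "\<bar>(b + t *\<^sub>R ?a) \<bullet> y t i\<bar> + \<bar>(b - t *\<^sub>R ?a) \<bullet> y (- t) i\<bar> = 2 * \<bar>b \<bullet> z i\<bar>"
          unfolding e1 e2 by (rule abs_add_abs_diff)
      qed
      ultimately show ?thesis using A(3)[OF b] by linarith
    qed
    then show ?thesis using A(2) by blast
  qed
  have ZK: "?Z = {x. \<exists>s. x + s *\<^sub>R w \<in> K t \<and> x + (s - 2 * (x \<bullet> w)) *\<^sub>R w \<in> K t}"
  proof (intro equalityI subsetI CollectI)
    fix x assume x: "x \<in> ?Z"
    obtain r where r: "\<And>i. i \<in> I \<Longrightarrow> \<bar>r i\<bar> \<le> 1" "x = (\<Sum>i\<in>I. r i *\<^sub>R z i)" using zonE[OF x] by blast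
    define s where "s = t * (\<Sum>i\<in>I. r i * d i)"
    have "x + s *\<^sub>R w \<in> K t" unfolding r(2) s_def by (rule up[OF r(1)])
    moreover have "x + (- s) *\<^sub>R w \<in> K (- t)" using up[of r "- t"] r by (simp add: s_def)
    then have "R (x + (- s) *\<^sub>R w) \<in> K t" using RK[of _ "- t"] by simp
    then have "x + (s - 2 * (x \<bullet> w)) *\<^sub>R w \<in> K t" unfolding Rw by (simp add: R_def algebra_simps)
    ultimately show "\<exists>s. x + s *\<^sub>R w \<in> K t \<and> x + (s - 2 * (x \<bullet> w)) *\<^sub>R w \<in> K t" by blast
  next
    fix x assume "x \<in> {x. \<exists>s. x + s *\<^sub>R w \<in> K t \<and> x + (s - 2 * (x \<bullet> w)) *\<^sub>R w \<in> K t}"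
    then obtain s where s: "x + s *\<^sub>R w \<in> K t" "x + (s - 2 * (x \<bullet> w)) *\<^sub>R w \<in> K t" by blast
    have "R (x + (s - 2 * (x \<bullet> w)) *\<^sub>R w) = x - s *\<^sub>R w" unfolding Rw by (simp add: R_def algebra_simps)
    with RK[OF s(2)] have "x - s *\<^sub>R w \<in> K (- t)" by simp
    with s(1) show "x \<in> ?Z" by (rule mid)
  qed
  have intK: "interior (K t) \<noteq> {}"
    unfolding K_def by (rule zon_perturb_interior[OF I \<rho>(2)]) (use \<rho>(1) sumD tD in auto)
  have cbK: "convex_body (K t)"
    using convex_body_zon[OF I] intK by (simp add: K_def)
  have "hausdorff_dist (K t) ?Z \<le> t * D"
    unfolding K_def sumD[symmetric] by (rule zon_perturb_hausdorff[OF I])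
  then have "hausdorff_dist (K t) ?Z < \<delta>" using tD by simp
  then have det: "det (\<chi> i j. (LINT x:K t|lborel. x $ i * x $ j) / measure lborel (K t)) * (measure lborel ?Z)\<^sup>2 \<le> (measure lborel (K t))\<^sup>2"
    by (intro \<delta>(2) cbK) (simp_all add: K_def zon_uminus)
  obtain c where c: "c \<bullet> w = 0" "\<And>x. x \<in> ?Z \<Longrightarrow> x + (c \<bullet> x) *\<^sub>R w \<in> K t"
    using steiner_symmetral_shear[OF convex_body_zon[OF I int] zon_uminus iso cbK w ZK det] by blast
  have c': "x - (c \<bullet> x) *\<^sub>R w \<in> K (- t)" if "x \<in> ?Z" for x
  proof -
    have "R x + (c \<bullet> R x) *\<^sub>R w \<in> K t" by (rule c(2)[OF RZ[OF that]])
    moreover have "c \<bullet> R x = c \<bullet> x" using c(1) by (simp add: R_def inner_diff_right)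
    ultimately have "R x + (c \<bullet> x) *\<^sub>R w \<in> K t" by simp
    from RK[OF this] show ?thesis by (simp add: Rw RR)
  qed
  \<comment> \<open>If \<open>s1\<close> exceeded \<open>s2\<close>, then \<open>mid\<close> would
    put into \<open>?Z\<close> a point beyond \<open>x\<close> in direction \<open>w\<close>,
    although the functional \<open>b\<close> is maximal at \<open>x\<close> and increases along
    \<open>w\<close>. So boundary points facing \<open>w\<close> admit only one shift.\<close>
  have comp: "s1 \<le> s2" if "x + s1 *\<^sub>R w \<in> K t" "x - s2 *\<^sub>R w \<in> K (- t)" "b \<bullet> w > 0" "b \<bullet> x = zon_support I z b" for x s1 s2 b
  proof -
    let ?m = "x + ((s1 - s2) / 2) *\<^sub>R w"
    have e: "?m + ((s1 + s2) / 2) *\<^sub>R w = x + s1 *\<^sub>R w" "?m - ((s1 + s2) / 2) *\<^sub>R w = x - s2 *\<^sub>R w"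
      by (simp_all add: add.assoc diff_divide_distrib add_divide_distrib flip: scaleR_add_left)
        (simp_all add: algebra_simps flip: scaleR_add_left)
    have "?m \<in> ?Z" by (rule mid[of _ "(s1 + s2) / 2"]) (simp_all only: e that)
    from zon_le_support[OF this, of b] have "(s1 - s2) / 2 * (b \<bullet> w) \<le> 0"
      using that(4) by (simp add: inner_add_right)
    then show ?thesis using that(3) by (simp add: mult_le_0_iff)
  qed
  have eqc: "c \<bullet> (\<Sum>i\<in>I. r i *\<^sub>R z i) = t * (\<Sum>i\<in>I. r i * d i)"
    if r: "\<And>i. i \<in> I \<Longrightarrow> \<bar>r i\<bar> \<le> 1" and b: "b \<bullet> w > 0" "b \<bullet> (\<Sum>i\<in>I. r i *\<^sub>R z i) = zon_support I z b" for r b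
  proof (rule antisym)
    let ?x = "\<Sum>i\<in>I. r i *\<^sub>R z i"
    have xZ: "?x \<in> ?Z" by (rule zonI) (rule r)
    have u1: "?x + (t * (\<Sum>i\<in>I. r i * d i)) *\<^sub>R w \<in> K t" by (rule up[OF r])
    have u2: "?x - (t * (\<Sum>i\<in>I. r i * d i)) *\<^sub>R w \<in> K (- t)" using up[of r "- t"] r by simp
    show "c \<bullet> ?x \<le> t * (\<Sum>i\<in>I. r i * d i)" by (rule comp[OF c(2)[OF xZ] u2 b])
    show "t * (\<Sum>i\<in>I. r i * d i) \<le> c \<bullet> ?x" by (rule comp[OF u1 c'[OF xZ] b])
  qed
  have "c \<bullet> z i = t * d i" if i: "i \<in> I" for i
  proof (cases "z i \<in> span {w}")
    case True
    then obtain k where "z i = k *\<^sub>R w" by (auto simp: span_singleton)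
    then show ?thesis using d0[OF i True] c(1) by simp
  next
    case False
    \<comment> \<open>\<open>q\<close> is the part of \<open>w\<close> orthogonal to
      \<open>z i\<close>. The face where \<open>q\<close> is maximal faces \<open>w\<close> and
      contains both its center and the center plus \<open>z i\<close>. The shift is known at both
      points, and the difference is \<open>c \<bullet> z i = t * d i\<close>.\<close>
    obtain p q where pq: "p \<in> span {z i}" "\<And>v. v \<in> span {z i} \<Longrightarrow> orthogonal q v" "w = p + q"
      using orthogonal_subspace_decomp_exists by blast
    have qz: "q \<bullet> z i = 0" using pq(2)[of "z i"] by (simp add: span_base orthogonal_def)
    have "q \<noteq> 0"
    proof
      assume "q = 0"
      then have "w \<in> span {z i}" using pq by simp
      then obtain k where k: "w = k *\<^sub>R z i" by (auto simp: span_singleton)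
      then have "k \<noteq> 0" using ww by auto
      then have "z i = inverse k *\<^sub>R w" using k by simp
      then show False using False by (auto intro: span_mul span_base)
    qed
    have "q \<bullet> p = 0" using pq by (simp add: orthogonal_def)
    then have qw: "q \<bullet> w > 0" using pq(3) \<open>q \<noteq> 0\<close> by (simp add: inner_add_right)
    define r where "r = (\<lambda>j. sgn (q \<bullet> z j))"
    define r' where "r' = (\<lambda>j. if j = i then 1 else sgn (q \<bullet> z j))"
    have s0: "(\<Sum>j\<in>I. r' j *\<^sub>R z j) = (\<Sum>j\<in>I. r j *\<^sub>R z j) + z i"
      using I i by (simp add: sum.remove[of I i] r_def r'_def qz)
    have s1: "(\<Sum>j\<in>I. r' j * d j) = (\<Sum>j\<in>I. r j * d j) + d i"
      using I i by (simp add: sum.remove[of I i] r_def r'_def qz)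
    have m: "q \<bullet> (\<Sum>j\<in>I. r j *\<^sub>R z j) = zon_support I z q"
      using zon_max_support[of q I z] by (simp add: zon_max_def r_def)
    have "c \<bullet> (\<Sum>j\<in>I. r j *\<^sub>R z j) = t * (\<Sum>j\<in>I. r j * d j)"
      by (rule eqc[OF _ qw m]) (simp add: r_def sgn_if)
    moreover have "c \<bullet> (\<Sum>j\<in>I. r' j *\<^sub>R z j) = t * (\<Sum>j\<in>I. r' j * d j)"
      by (rule eqc[OF _ qw]) (simp_all add: r'_def sgn_if s0[unfolded r'_def] inner_add_right m qz)
    ultimately show ?thesis unfolding s0 s1 by (simp add: inner_add_right distrib_left)
  qed
  then have "(c /\<^sub>R t) \<bullet> z i = d i" if "i \<in> I" for i using that t0 by (simp add: field_simps)
  moreover have "(c /\<^sub>R t) \<bullet> w = 0" using c(1) by simp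
  ultimately show ?thesis using that by blast
qed

section \<open>First-order conditions at a facet\<close>

text \<open>\<open>Z\<close> is given by facet inequalities, and the facet \<open>a \<bullet> x = 1\<close> is the parallelepiped
  \<open>\<eta> $ k = 1\<close>, \<open>\<bar>\<eta> $ i\<bar> \<le> 1\<close> for \<open>i \<noteq> k\<close>, in the coordinates \<open>x = L \<eta>\<close>. The body
  \<open>tilt t v\<close> replaces the normal \<open>a\<close> by \<open>a + t v\<close>; the condition \<open>x / 2 \<in> Z\<close> only ensures
  boundedness. Blowing up the difference of \<open>tilt t v\<close> and \<open>Z\<close> near the facet by \<open>stretch t\<close>
  gives \<open>wedge v\<close> in the limit \<open>t \<rightarrow> 0\<close>.\<close>

locale facet_variation =
  fixes Z :: "(real^'n::finite) set" and a :: "real^'n" and B :: "(real^'n) set"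
    and L :: "real^'n \<Rightarrow> real^'n" and k :: 'n
  assumes body: "convex_body Z" and sym: "- x \<in> Z \<longleftrightarrow> x \<in> Z"
    and finB: "finite B"
    and Z_eq: "Z = {x. \<bar>a \<bullet> x\<bar> \<le> 1 \<and> (\<forall>b\<in>B. \<bar>b \<bullet> x\<bar> \<le> 1)}"
    and linL: "linear L" and injL: "inj L"
    and aL: "a \<bullet> L \<eta> = \<eta> $ k"
    and face_out: "\<eta> $ k = 1 \<Longrightarrow> L \<eta> \<in> Z \<Longrightarrow> i \<noteq> k \<Longrightarrow> \<bar>\<eta> $ i\<bar> \<le> 1"
    and face_in: "\<eta> $ k = 1 \<Longrightarrow> (\<And>i. i \<noteq> k \<Longrightarrow> \<bar>\<eta> $ i\<bar> < 1) \<Longrightarrow> b \<in> B \<Longrightarrow> \<bar>b \<bullet> L \<eta>\<bar> < 1"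
begin

definition tilt :: "real \<Rightarrow> real^'n \<Rightarrow> (real^'n) set" where
  "tilt t v = {x. (1/2) *\<^sub>R x \<in> Z \<and> (\<forall>b\<in>B. \<bar>b \<bullet> x\<bar> \<le> 1) \<and> \<bar>(a + t *\<^sub>R v) \<bullet> x\<bar> \<le> 1}"

definition stretch :: "real \<Rightarrow> real^'n \<Rightarrow> real^'n" where
  "stretch t \<eta> = (\<chi> i. if i = k then 1 + t * \<eta> $ i else \<eta> $ i)"

text \<open>The limit of the difference of two indicators: 1 where the tilt gains, -1 where it
  loses. With \<open>a \<bullet> x = 1 + t * \<eta> $ k\<close>, the tilted inequality
  \<open>(a + t *\<^sub>R v) \<bullet> x \<le> 1\<close> reads
  \<open>t * (\<eta> $ k + v \<bullet> x) \<le> 0\<close>, and \<open>x\<close> tends to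
  \<open>L (stretch 0 \<eta>)\<close>.\<close>

definition wedge :: "real^'n \<Rightarrow> real^'n \<Rightarrow> real" where
  "wedge v \<eta> = (if \<forall>i. i \<noteq> k \<longrightarrow> \<bar>\<eta> $ i\<bar> \<le> 1
     then (if \<eta> $ k + v \<bullet> L (stretch 0 \<eta>) \<le> 0 then 1 else 0) - (if \<eta> $ k \<le> 0 then 1 else 0) else 0)"

lemma contL: "continuous_on S L"
  using linL by (simp add: linear_continuous_on linear_conv_bounded_linear)

lemma measL[measurable]: "L \<in> borel_measurable borel"
  by (intro borel_measurable_continuous_onI contL)

lemma cont_stretch: "continuous_on S (stretch t)"
  unfolding stretch_def
proof (rule continuous_on_vec_lambda)
  show "continuous_on S (\<lambda>x. if i = k then 1 + t * x $ i else x $ i)" for i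
    by (cases "i = k") (auto intro!: continuous_intros)
qed

lemma meas_stretch[measurable]: "stretch t \<in> borel_measurable borel"
  by (intro borel_measurable_continuous_onI cont_stretch)

lemma meas_wedge[measurable]: "wedge v \<in> borel_measurable borel"
proof -
  have 1: "{\<eta>::real^'n. \<forall>i. i \<noteq> k \<longrightarrow> \<bar>\<eta> $ i\<bar> \<le> 1} \<in> sets borel"
  proof -
    have "{\<eta>::real^'n. \<forall>i. i \<noteq> k \<longrightarrow> \<bar>\<eta> $ i\<bar> \<le> 1} = (\<Inter>i\<in>UNIV - {k}. {\<eta>. \<bar>\<eta> $ i\<bar> \<le> 1})" by auto
    moreover have "closed \<dots>"
      by (intro closed_INT ballI closed_Collect_le continuous_intros)
    ultimately show ?thesis by auto
  qed
  show ?thesis unfolding wedge_def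
    by (rule measurable_If) (use 1 in \<open>auto simp: pred_def\<close>)
qed

lemma stretch_0_k: "stretch 0 \<eta> $ k = 1" and stretch_k: "stretch t \<eta> $ k = 1 + t * \<eta> $ k"
  and stretch_other: "i \<noteq> k \<Longrightarrow> stretch t \<eta> $ i = \<eta> $ i"
  by (simp_all add: stretch_def)

text \<open>The Jacobian of \<open>stretch t\<close> is \<open>t\<close>; it cancels the denominator
  of the difference quotients below.\<close>

lemma stretch_integral:
  fixes g :: "real^'n \<Rightarrow> real"
  assumes "t > 0" and g[measurable]: "g \<in> borel_measurable borel"
  shows "t * (LINT \<eta>|lborel. g (stretch t \<eta>)) = (LINT \<xi>|lborel. g \<xi>)"
proof -
  let ?c = "\<lambda>i. if i = k then t else 1"
  let ?S = "\<lambda>x::real^'n. \<chi> i. ?c i * x $ i"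
  have S: "distr lborel borel ?S = density lborel (\<lambda>_. ennreal (inverse (\<Prod>i\<in>UNIV. \<bar>?c i\<bar>)))"
    by (rule distr_lborel_coordinate_scaling) (use assms in auto)
  have P: "(\<Prod>i\<in>UNIV. \<bar>?c i\<bar>) = t"
    using assms(1) by (simp add: if_distrib prod.delta cong: if_cong)
  have Sm: "?S \<in> borel_measurable borel"
    by (intro borel_measurable_continuous_onI continuous_intros)
  have st: "stretch t \<eta> = axis k 1 + ?S \<eta>" for \<eta> by (auto simp: stretch_def vec_eq_iff axis_def)
  have [measurable]: "(\<lambda>x. g (axis k 1 + x)) \<in> borel_measurable borel" by measurable
  have "(LINT \<eta>|lborel. g (stretch t \<eta>)) = (LINT x|distr lborel borel ?S. g (axis k 1 + x))"
    unfolding st using Sm by (subst integral_distr) auto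
  also have "\<dots> = inverse t * (LINT x|lborel. g (axis k 1 + x))"
    unfolding S P using assms(1) by (subst integral_density) auto
  also have "(LINT x|lborel. g (axis k 1 + x)) = (LINT x|distr lborel borel ((+) (axis k 1)). g x)"
    by (subst integral_distr) auto
  finally show ?thesis using assms(1) by (simp add: lborel_distr_plus)
qed

lemma bounded_double: obtains R where "R > 0" "\<And>x. (1/2) *\<^sub>R x \<in> Z \<Longrightarrow> norm x \<le> R"
proof -
  obtain R where R: "R > 0" "\<And>x. x \<in> Z \<Longrightarrow> norm x \<le> R"
    using compact_imp_bounded[OF convex_body_measure(1)[OF body]] bounded_pos by metis
  show ?thesis
    by (rule that[of "2 * R"]) (use R in \<open>auto dest!: R(2)\<close>)
qed

lemma Z_zero: "0 \<in> Z"
  unfolding Z_eq by simp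

lemma scale_Z: "x \<in> Z \<Longrightarrow> 0 \<le> r \<Longrightarrow> r \<le> 1 \<Longrightarrow> r *\<^sub>R x \<in> Z"
  unfolding Z_eq by (auto simp: abs_mult intro: mult_le_one)

lemma closed_tilt: "closed (tilt t v)"
proof -
  have cZ: "closed Z" using convex_body_measure(1)[OF body] by (rule compact_imp_closed)
  have "tilt t v = ((\<lambda>x. (1/2) *\<^sub>R x) -` Z) \<inter> (\<Inter>b\<in>B. {x. \<bar>b \<bullet> x\<bar> \<le> 1}) \<inter> {x. \<bar>(a + t *\<^sub>R v) \<bullet> x\<bar> \<le> 1}"
    by (auto simp: tilt_def)
  moreover have "closed \<dots>"
    by (intro closed_Int closed_INT ballI closed_Collect_le continuous_closed_vimage[OF cZ] continuous_intros)
  ultimately show ?thesis by simp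
qed

lemma compact_tilt: "compact (tilt t v)"
proof -
  obtain R where "R > 0" "\<And>x. (1/2) *\<^sub>R x \<in> Z \<Longrightarrow> norm x \<le> R" using bounded_double by blast
  then have "bounded (tilt t v)" by (auto simp: bounded_iff tilt_def)
  with closed_tilt show ?thesis by (simp add: compact_eq_bounded_closed)
qed

lemma convex_abs_le: "convex {x::real^'n. \<bar>c \<bullet> x\<bar> \<le> 1}"
proof -
  have "{x. \<bar>c \<bullet> x\<bar> \<le> 1} = {x. c \<bullet> x \<le> 1} \<inter> {x. c \<bullet> x \<ge> -1}" by auto
  then show ?thesis by (simp only: convex_Int convex_halfspace_le convex_halfspace_ge)
qed

lemma convex_tilt: "convex (tilt t v)"
proof -
  have "tilt t v = ((*\<^sub>R) (1/2) -` Z) \<inter> (\<Inter>b\<in>B. {x. \<bar>b \<bullet> x\<bar> \<le> 1}) \<inter> {x. \<bar>(a + t *\<^sub>R v) \<bullet> x\<bar> \<le> 1}"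
    by (auto simp: tilt_def)
  moreover have "convex \<dots>"
    using convex_body_measure(2)[OF body]
    by (intro convex_Int convex_INT convex_abs_le convex_linear_vimage) (auto intro: linear_scaleR)
  ultimately show ?thesis by simp
qed

lemma sym_tilt: "- x \<in> tilt t v \<longleftrightarrow> x \<in> tilt t v"
  using sym[of "(1/2) *\<^sub>R x"] by (simp add: tilt_def)

text \<open>On the doubled body \<open>2 Z\<close>, which contains all bodies concerned,
  \<open>t * (v \<bullet> x)\<close> is at most \<open>e\<close> in absolute value. So
  \<open>tilt t v\<close> lies between the multiples \<open>1 - e\<close> and \<open>1 + e\<close>
  of \<open>Z\<close>, which yields the nonempty interior and the Hausdorff estimate.\<close>

lemma tilt_sandwich:
  assumes R: "\<And>x. (1/2) *\<^sub>R x \<in> Z \<Longrightarrow> norm x \<le> R" and t: "0 \<le> t" "t * (norm v * R) \<le> 1/2"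
  defines "e \<equiv> t * (norm v * R)"
  shows "x \<in> Z \<Longrightarrow> (1 - e) *\<^sub>R x \<in> tilt t v" "x \<in> tilt t v \<Longrightarrow> inverse (1 + e) *\<^sub>R x \<in> Z"
proof -
  have R0: "R \<ge> 0" using R[of 0] Z_zero by simp
  have e: "0 \<le> e" "e \<le> 1/2" using t R0 by (auto simp: e_def)
  have vx: "\<bar>t * (v \<bullet> x)\<bar> \<le> e" if "(1/2) *\<^sub>R x \<in> Z" for x
  proof -
    have "\<bar>v \<bullet> x\<bar> \<le> norm v * norm x" by (rule Cauchy_Schwarz_ineq2)
    also have "\<dots> \<le> norm v * R" using R[OF that] by (intro mult_left_mono) auto
    finally show ?thesis using t(1) by (simp add: e_def abs_mult mult_left_mono)
  qed
  show "(1 - e) *\<^sub>R x \<in> tilt t v" if x: "x \<in> Z"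
    unfolding tilt_def
  proof (intro CollectI conjI ballI)
    have "((1 - e) / 2) *\<^sub>R x \<in> Z" by (rule scale_Z[OF x]) (use e in auto)
    then show "(1/2) *\<^sub>R ((1 - e) *\<^sub>R x) \<in> Z" by simp
    show "\<bar>b \<bullet> (1 - e) *\<^sub>R x\<bar> \<le> 1" if "b \<in> B" for b
      using scale_Z[OF x, of "1 - e"] e that unfolding Z_eq by auto
    have x2: "(1/2) *\<^sub>R x \<in> Z" by (rule scale_Z[OF x]) auto
    have "\<bar>(a + t *\<^sub>R v) \<bullet> (1 - e) *\<^sub>R x\<bar> = (1 - e) * \<bar>a \<bullet> x + t * (v \<bullet> x)\<bar>"
      using e by (simp add: abs_mult inner_add_left)
    also have "\<dots> \<le> (1 - e) * (1 + e)"
      using e vx[OF x2] x by (intro mult_left_mono) (auto simp: Z_eq)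
    also have "\<dots> \<le> 1" by (simp add: algebra_simps)
    finally show "\<bar>(a + t *\<^sub>R v) \<bullet> (1 - e) *\<^sub>R x\<bar> \<le> 1" .
  qed
  show "inverse (1 + e) *\<^sub>R x \<in> Z" if x: "x \<in> tilt t v"
    unfolding Z_eq
  proof (intro CollectI conjI ballI)
    have x2: "(1/2) *\<^sub>R x \<in> Z" using x by (simp add: tilt_def)
    have "\<bar>a \<bullet> x\<bar> \<le> 1 + e"
      using x vx[OF x2] by (auto simp: tilt_def inner_add_left)
    then show "\<bar>a \<bullet> inverse (1 + e) *\<^sub>R x\<bar> \<le> 1" using e by (simp add: abs_mult field_simps)
    show "\<bar>b \<bullet> inverse (1 + e) *\<^sub>R x\<bar> \<le> 1" if "b \<in> B" for b
    proof -
      have "\<bar>b \<bullet> x\<bar> \<le> 1 + e" using x that e by (force simp: tilt_def)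
      then show ?thesis using e by (simp add: abs_mult field_simps)
    qed
  qed
qed

lemma tilt_interior:
  assumes R: "\<And>x. (1/2) *\<^sub>R x \<in> Z \<Longrightarrow> norm x \<le> R" and t: "0 \<le> t" "t * (norm v * R) \<le> 1/2"
  shows "interior (tilt t v) \<noteq> {}"
proof -
  let ?e = "t * (norm v * R)"
  have "(*\<^sub>R) (1 - ?e) ` Z \<subseteq> tilt t v" using tilt_sandwich(1)[OF R t] by auto
  then have "interior ((*\<^sub>R) (1 - ?e) ` Z) \<subseteq> interior (tilt t v)" by (rule interior_mono)
  moreover have "interior ((*\<^sub>R) (1 - ?e) ` Z) = (*\<^sub>R) (1 - ?e) ` interior Z"
    by (rule interior_injective_linear_image) (use t in \<open>auto simp: linear_scaleR inj_on_def\<close>)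
  ultimately show ?thesis using body by (auto simp: convex_body_def)
qed

lemma tilt_hausdorff:
  assumes R: "\<And>x. (1/2) *\<^sub>R x \<in> Z \<Longrightarrow> norm x \<le> R" and t: "0 \<le> t" "t * (norm v * R) \<le> 1/2"
  shows "hausdorff_dist (tilt t v) Z \<le> t * (norm v * R) * R"
proof (rule hausdorff_dist_le)
  let ?e = "t * (norm v * R)"
  have R0: "R \<ge> 0" using R[of 0] Z_zero by simp
  have e: "0 \<le> ?e" using t R0 by simp
  show "Z \<noteq> {}" using Z_zero by auto
  show "tilt t v \<noteq> {}" using tilt_sandwich(1)[OF R t Z_zero] by auto
  fix x
  show "\<exists>y\<in>Z. dist x y \<le> ?e * R" if x: "x \<in> tilt t v"
  proof
    show y: "inverse (1 + ?e) *\<^sub>R x \<in> Z" by (rule tilt_sandwich(2)[OF R t x])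
    have "(1/2) *\<^sub>R (inverse (1 + ?e) *\<^sub>R x) \<in> Z" by (rule scale_Z[OF y]) auto
    then have n: "norm (inverse (1 + ?e) *\<^sub>R x) \<le> R" by (rule R)
    have "x - inverse (1 + ?e) *\<^sub>R x = ?e *\<^sub>R (inverse (1 + ?e) *\<^sub>R x)"
    proof -
      have "(1 - inverse (1 + ?e)) = ?e * inverse (1 + ?e)" using e by (simp add: field_simps)
      then show ?thesis by (metis scaleR_left_diff_distrib scaleR_one scaleR_scaleR)
    qed
    then have "dist x (inverse (1 + ?e) *\<^sub>R x) = ?e * norm (inverse (1 + ?e) *\<^sub>R x)"
      unfolding dist_norm using e by (metis abs_of_nonneg norm_scaleR)
    also have "\<dots> \<le> ?e * R" using n e by (rule mult_left_mono)
    finally show "dist x (inverse (1 + ?e) *\<^sub>R x) \<le> ?e * R" .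
  qed
  show "\<exists>y\<in>tilt t v. dist x y \<le> ?e * R" if x: "x \<in> Z"
  proof
    show "(1 - ?e) *\<^sub>R x \<in> tilt t v" by (rule tilt_sandwich(1)[OF R t x])
    have "(1/2) *\<^sub>R x \<in> Z" by (rule scale_Z[OF x]) auto
    then have n: "norm x \<le> R" by (rule R)
    have "x - (1 - ?e) *\<^sub>R x = ?e *\<^sub>R x" by (simp add: scaleR_left_diff_distrib)
    then have "dist x ((1 - ?e) *\<^sub>R x) = ?e * norm x"
      unfolding dist_norm using e by (metis abs_of_nonneg norm_scaleR)
    also have "\<dots> \<le> ?e * R" using n e by (rule mult_left_mono)
    finally show "dist x ((1 - ?e) *\<^sub>R x) \<le> ?e * R" .
  qed
qed

lemma tilt_body:
  assumes R: "\<And>x. (1/2) *\<^sub>R x \<in> Z \<Longrightarrow> norm x \<le> R" and t: "0 \<le> t" "t * (norm v * R) \<le> 1/2"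
  shows "convex_body (tilt t v)"
  using compact_tilt convex_tilt tilt_interior[OF R t] by (simp add: convex_body_def)

end

section \<open>Difference quotients of integrals over tilted bodies\<close>

lemma AE_lborel_hyperplane:
  fixes n :: "'a::euclidean_space"
  assumes "n \<noteq> 0"
  shows "AE x in lborel. n \<bullet> x \<noteq> c"
proof -
  have "negligible {x. n \<bullet> x = c}" using assms by (simp add: negligible_hyperplane)
  moreover have "{x. n \<bullet> x = c} \<in> sets borel" by (intro borel_closed closed_hyperplane)
  ultimately have "{x. n \<bullet> x = c} \<in> null_sets lborel"
    by (simp add: negligible_iff_null_sets null_sets_completion_iff)
  then show ?thesis by (rule AE_I') auto
qed

lemma AE_lborel_component:
  fixes i :: "'n::finite"
  shows "AE x in lborel. (x::real^'n) $ i \<noteq> c"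
  using AE_lborel_hyperplane[of "axis i 1 :: real^'n" c] by (simp add: inner_axis' axis_eq_0_iff)

context facet_variation
begin

lemma Z_iff: "x \<in> Z \<longleftrightarrow> \<bar>a \<bullet> x\<bar> \<le> 1 \<and> (\<forall>b\<in>B. \<bar>b \<bullet> x\<bar> \<le> 1)"
  using Z_eq by blast

text \<open>Points where some inequality holds with equality in the limit lie on finitely many
  hyperplanes; elsewhere the indicators are eventually constant.\<close>

lemma AE_generic:
  "AE \<eta> in lborel. (\<forall>i. \<bar>\<eta> $ i\<bar> \<noteq> 1) \<and> \<eta> $ k + v \<bullet> L (stretch 0 \<eta>) \<noteq> 0 \<and> \<eta> $ k \<noteq> 0"
proof -
  have 1: "AE \<eta> in lborel. \<forall>i\<in>UNIV. \<bar>(\<eta>::real^'n) $ i\<bar> \<noteq> 1"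
  proof (subst AE_finite_all, simp, intro ballI)
    fix i
    have "AE \<eta> in lborel. (\<eta>::real^'n) $ i \<noteq> 1 \<and> \<eta> $ i \<noteq> -1"
      using AE_lborel_component by auto
    then show "AE \<eta> in lborel. \<bar>(\<eta>::real^'n) $ i\<bar> \<noteq> 1" by eventually_elim auto
  qed
  define p where "p = L (axis k 1)"
  define n where "n = axis k 1 + adjoint L v - (v \<bullet> p) *\<^sub>R axis k 1"
  have st: "stretch 0 \<eta> = \<eta> + (1 - \<eta> $ k) *\<^sub>R axis k 1" for \<eta>
    by (auto simp: stretch_def vec_eq_iff axis_def)
  have Lst: "L (stretch 0 \<eta>) = L \<eta> + (1 - \<eta> $ k) *\<^sub>R p" for \<eta>
    unfolding st p_def by (simp add: linear_add[OF linL] linear_scale[OF linL])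
  have ax: "\<eta> \<bullet> axis k 1 = \<eta> $ k" for \<eta> :: "real^'n" by (simp add: inner_axis)
  have eq: "\<eta> $ k + v \<bullet> L (stretch 0 \<eta>) = n \<bullet> \<eta> + v \<bullet> p" for \<eta>
    unfolding Lst n_def
    by (simp add: inner_add_left inner_add_right inner_diff_left inner_axis' adjoint_works[OF linL] inner_commute[of _ \<eta>])
      (simp add: inner_commute adjoint_works[OF linL] ax algebra_simps)
  \<comment> \<open>Whatever \<open>v\<close> is, \<open>n\<close> is not 0: its coordinate
    \<open>k\<close> is 1, because \<open>stretch 0 \<eta>\<close> does not depend on
    \<open>\<eta> $ k\<close>.\<close>
  have "n \<bullet> axis k 1 = 1"
    by (simp add: n_def inner_add_left inner_diff_left inner_commute[of "adjoint L v"] adjoint_works[OF linL] p_def[symmetric] inner_axis_axis)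
      (simp add: inner_commute)
  then have "n \<noteq> 0" by auto
  then have 2: "AE \<eta> in lborel. \<eta> $ k + v \<bullet> L (stretch 0 \<eta>) \<noteq> 0"
    unfolding eq using AE_lborel_hyperplane[of n "- (v \<bullet> p)"] by (auto elim!: eventually_mono)
  show ?thesis using 1 2 AE_lborel_component[of k 0] by eventually_elim auto
qed

lemma tilt_mem:
  assumes "\<xi> = stretch t \<eta>"
  shows "L \<xi> \<in> Z \<longleftrightarrow> (\<forall>b\<in>B. \<bar>b \<bullet> L \<xi>\<bar> \<le> 1) \<and> \<bar>1 + t * \<eta> $ k\<bar> \<le> 1"
    "L \<xi> \<in> tilt t v \<longleftrightarrow> (1/2) *\<^sub>R L \<xi> \<in> Z \<and> (\<forall>b\<in>B. \<bar>b \<bullet> L \<xi>\<bar> \<le> 1) \<and> \<bar>1 + t * (\<eta> $ k + v \<bullet> L \<xi>)\<bar> \<le> 1"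
  using assms by (auto simp: Z_iff tilt_def inner_add_left aL stretch_k algebra_simps)

text \<open>If the tangential coordinates leave the cube, one constraint in \<open>B\<close>
  excludes the point from both bodies. If they lie inside, all constraints in \<open>B\<close> are
  strict in the limit, and only the constraint of \<open>a\<close> and its tilted version
  decide.\<close>

lemma tilt_pointwise_limit:
  assumes \<phi>: "continuous_on UNIV \<phi>" and t: "t \<longlonglongrightarrow> 0" "\<And>m. t m > 0"
    and gen: "\<forall>i. \<bar>\<eta> $ i\<bar> \<noteq> 1" "\<eta> $ k + v \<bullet> L (stretch 0 \<eta>) \<noteq> 0" "\<eta> $ k \<noteq> 0"
  shows "(\<lambda>m. (indicat_real (tilt (t m) v) (L (stretch (t m) \<eta>)) - indicat_real Z (L (stretch (t m) \<eta>))) * \<phi> (L (stretch (t m) \<eta>)))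
    \<longlonglongrightarrow> wedge v \<eta> * \<phi> (L (stretch 0 \<eta>))"
proof -
  define x where "x = (\<lambda>m. L (stretch (t m) \<eta>))"
  define x0 where "x0 = L (stretch 0 \<eta>)"
  have s: "(\<lambda>m. stretch (t m) \<eta>) \<longlonglongrightarrow> stretch 0 \<eta>"
  proof (rule vec_tendstoI)
    show "(\<lambda>m. stretch (t m) \<eta> $ i) \<longlonglongrightarrow> stretch 0 \<eta> $ i" for i
      unfolding stretch_def by (cases "i = k") (auto intro!: tendsto_eq_intros t)
  qed
  have x: "x \<longlonglongrightarrow> x0"
    unfolding x_def x0_def by (rule continuous_on_tendsto_compose[OF contL[of UNIV] s]) auto
  have \<phi>x: "(\<lambda>m. \<phi> (x m)) \<longlonglongrightarrow> \<phi> x0"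
    by (rule continuous_on_tendsto_compose[OF \<phi> x]) auto
  have bx: "(\<lambda>m. \<bar>b \<bullet> x m\<bar>) \<longlonglongrightarrow> \<bar>b \<bullet> x0\<bar>" for b
    by (intro tendsto_intros x)
  have ind: "\<forall>\<^sub>F m in sequentially. indicat_real (tilt (t m) v) (x m) - indicat_real Z (x m) = wedge v \<eta>"
  proof (cases "\<forall>i. i \<noteq> k \<longrightarrow> \<bar>\<eta> $ i\<bar> \<le> 1")
    case False
    then obtain i where i: "i \<noteq> k" "\<bar>\<eta> $ i\<bar> > 1" by force
    have "x0 \<notin> Z"
      using face_out[of "stretch 0 \<eta>" i] i stretch_0_k stretch_other[OF i(1)] by (auto simp: x0_def)
    then obtain b where b: "b \<in> B" "\<bar>b \<bullet> x0\<bar> > 1"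
      unfolding Z_iff x0_def by (auto simp: aL stretch_0_k)
    have "\<forall>\<^sub>F m in sequentially. \<bar>b \<bullet> x m\<bar> > 1" by (rule order_tendstoD(1)[OF bx b(2)])
    then show ?thesis
    proof eventually_elim
      case (elim m)
      then have "x m \<notin> Z" "x m \<notin> tilt (t m) v" using b(1) by (force simp: Z_iff, force simp: tilt_def)
      then show ?case using False by (simp add: wedge_def)
    qed
  next
    case True
    then have lt: "\<bar>\<eta> $ i\<bar> < 1" if "i \<noteq> k" for i using gen(1) that by (metis order_le_less)
    have b0: "\<bar>b \<bullet> x0\<bar> < 1" if "b \<in> B" for b
      unfolding x0_def by (rule face_in[OF stretch_0_k _ that]) (simp add: stretch_other lt)
    have evB: "\<forall>\<^sub>F m in sequentially. \<forall>b\<in>B. \<bar>b \<bullet> x m\<bar> < 1"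
      by (subst eventually_ball_finite_distrib[OF finB]) (use b0 order_tendstoD(2)[OF bx] in blast)
    have l1: "(\<lambda>m. 1 + t m * \<eta> $ k) \<longlonglongrightarrow> 1 + 0 * \<eta> $ k" by (intro tendsto_intros t)
    have l2: "(\<lambda>m. \<eta> $ k + v \<bullet> x m) \<longlonglongrightarrow> \<eta> $ k + v \<bullet> x0" by (intro tendsto_intros x)
    have l3: "(\<lambda>m. 1 + t m * (\<eta> $ k + v \<bullet> x m)) \<longlonglongrightarrow> 1 + 0 * (\<eta> $ k + v \<bullet> x0)" by (intro tendsto_intros t x)
    have e1: "\<forall>\<^sub>F m in sequentially. 1 + t m * \<eta> $ k > -1" "\<forall>\<^sub>F m in sequentially. 1 + t m * \<eta> $ k < 2"
      by (rule order_tendstoD(1)[OF l1], simp) (rule order_tendstoD(2)[OF l1], simp)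
    have e3: "\<forall>\<^sub>F m in sequentially. 1 + t m * (\<eta> $ k + v \<bullet> x m) > -1"
      by (rule order_tendstoD(1)[OF l3]) simp
    have e2: "\<forall>\<^sub>F m in sequentially. (\<eta> $ k + v \<bullet> x m \<le> 0) = (\<eta> $ k + v \<bullet> x0 \<le> 0)"
    proof (cases "\<eta> $ k + v \<bullet> x0 < 0")
      case True
      then show ?thesis using order_tendstoD(2)[OF l2, of 0] by (auto elim!: eventually_mono)
    next
      case False
      then have "\<eta> $ k + v \<bullet> x0 > 0" using gen(2) by (simp add: x0_def)
      then show ?thesis using order_tendstoD(1)[OF l2, of 0] by (auto elim!: eventually_mono)
    qed
    from evB e1 e2 e3 show ?thesis
    proof eventually_elim
      case (elim m)
      note mem = tilt_mem[of "stretch (t m) \<eta>" "t m" \<eta>, OF HOL.refl, folded x_def]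
      have xm: "L (stretch (t m) \<eta>) = x m" by (simp add: x_def)
      have "a \<bullet> x m = 1 + t m * \<eta> $ k" by (simp add: x_def aL stretch_k)
      then have half: "(1/2) *\<^sub>R x m \<in> Z"
        using elim by (auto simp: Z_iff)
      have Bx: "\<forall>b\<in>B. \<bar>b \<bullet> x m\<bar> \<le> 1" using elim(1) by (auto intro: less_imp_le)
      have "x m \<in> Z \<longleftrightarrow> t m * \<eta> $ k \<le> 0"
        using mem(1) Bx elim(2) unfolding xm by (simp add: abs_le_iff)
      then have "x m \<in> Z \<longleftrightarrow> \<eta> $ k \<le> 0"
        using t(2)[of m] by (simp add: mult_le_0_iff)
      moreover have "x m \<in> tilt (t m) v \<longleftrightarrow> t m * (\<eta> $ k + v \<bullet> x m) \<le> 0"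
        using mem(2)[of v] Bx elim(5) half unfolding xm by (simp add: abs_le_iff)
      then have "x m \<in> tilt (t m) v \<longleftrightarrow> \<eta> $ k + v \<bullet> x m \<le> 0"
        using t(2)[of m] by (simp add: mult_le_0_iff)
      ultimately show ?case
        using True elim by (simp add: wedge_def indicator_def x0_def)
    qed
  qed
  have "(\<lambda>m. wedge v \<eta> * \<phi> (x m)) \<longlonglongrightarrow> wedge v \<eta> * \<phi> x0"
    by (intro tendsto_intros \<phi>x)
  then show ?thesis
    unfolding x_def[symmetric] x0_def[symmetric]
    by (rule Lim_transform_eventually) (use ind in \<open>auto elim!: eventually_mono simp: x_def\<close>)
qed

text \<open>In the half-space of the facet the two bodies differ only in a layer of thickness of
  order \<open>t\<close>, so the stretched normal coordinate stays bounded. This supplies the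
  dominating function for the limit.\<close>

lemma tilt_difference_bound:
  assumes R: "\<And>x. (1/2) *\<^sub>R x \<in> Z \<Longrightarrow> norm x \<le> R" and t: "0 < t" "t * (norm v * R) \<le> 1/2"
    and \<xi>: "\<xi> = stretch t \<eta>" and pos: "a \<bullet> L \<xi> > 0" and ne: "(L \<xi> \<in> tilt t v) \<noteq> (L \<xi> \<in> Z)"
  shows "norm (L \<xi>) \<le> R" "\<bar>\<eta> $ k\<bar> \<le> norm v * R"
proof -
  let ?x = "L \<xi>"
  have half: "(1/2) *\<^sub>R ?x \<in> Z" using ne scale_Z[of ?x "1/2"] by (auto simp: tilt_def)
  then show n: "norm ?x \<le> R" by (rule R)
  have "\<bar>v \<bullet> ?x\<bar> \<le> norm v * norm ?x" by (rule Cauchy_Schwarz_ineq2)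
  also have "\<dots> \<le> norm v * R" using n by (rule mult_left_mono) simp
  finally have vx: "\<bar>v \<bullet> ?x\<bar> \<le> norm v * R" .
  then have "\<bar>t * (v \<bullet> ?x)\<bar> \<le> 1/2"
  proof -
    have "\<bar>t * (v \<bullet> ?x)\<bar> = t * \<bar>v \<bullet> ?x\<bar>" using t(1) by (simp add: abs_mult)
    also have "\<dots> \<le> t * (norm v * R)" using vx t(1) by (intro mult_left_mono) auto
    finally show ?thesis using t(2) by linarith
  qed
  moreover have p: "1 + t * \<eta> $ k > 0" using pos by (simp add: aL \<xi> stretch_k)
  ultimately have lower: "1 + t * (\<eta> $ k + v \<bullet> ?x) > -1" by (simp add: algebra_simps)
  have Bx: "\<forall>b\<in>B. \<bar>b \<bullet> ?x\<bar> \<le> 1" using ne by (auto simp: Z_iff tilt_def)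
  have "?x \<in> Z \<longleftrightarrow> t * \<eta> $ k \<le> 0"
    unfolding tilt_mem(1)[OF \<xi>] using Bx p by auto
  then have z: "?x \<in> Z \<longleftrightarrow> \<eta> $ k \<le> 0" using t(1) by (simp add: mult_le_0_iff)
  have "?x \<in> tilt t v \<longleftrightarrow> t * (\<eta> $ k + v \<bullet> ?x) \<le> 0"
    unfolding tilt_mem(2)[OF \<xi>] using Bx half lower by auto
  then have "?x \<in> tilt t v \<longleftrightarrow> \<eta> $ k + v \<bullet> ?x \<le> 0" using t(1) by (simp add: mult_le_0_iff)
  with z ne vx show "\<bar>\<eta> $ k\<bar> \<le> norm v * R" by linarith
qed

text \<open>The factor 2 accounts for the opposite facet, as \<open>\<phi>\<close> and both bodies
  are symmetric; \<open>1 / C\<close> comes from the coordinates \<open>L\<close>, and the Jacobian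
  of \<open>stretch t\<close> has cancelled \<open>t\<close>.\<close>

lemma tilt_integral_eq:
  assumes \<phi>: "continuous_on UNIV \<phi>" "\<And>x. \<phi> (- x) = \<phi> x"
    and R: "\<And>x. (1/2) *\<^sub>R x \<in> Z \<Longrightarrow> norm x \<le> R" and t: "0 < t" "t * (norm v * R) \<le> 1/2"
    and C: "C > 0" "\<And>g::real^'n \<Rightarrow> real. g \<in> borel_measurable borel \<Longrightarrow> (LINT x|lborel. g (L x)) = C * (LINT x|lborel. g x)"
  shows "((LINT x:tilt t v|lborel. \<phi> x) - (LINT x:Z|lborel. \<phi> x)) / t = (2 / C) *
    (LINT \<eta>|lborel. indicat_real {x. a \<bullet> x > 0} (L (stretch t \<eta>)) *
       ((indicat_real (tilt t v) (L (stretch t \<eta>)) - indicat_real Z (L (stretch t \<eta>))) * \<phi> (L (stretch t \<eta>))))"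
proof -
  have [measurable]: "\<phi> \<in> borel_measurable borel" using \<phi>(1) by (rule borel_measurable_continuous_onI)
  have [measurable]: "Z \<in> sets borel" "tilt t v \<in> sets borel"
    using convex_body_measure(3)[OF body] closed_tilt by auto
  have intf: "set_integrable lborel Z \<phi>" "set_integrable lborel (tilt t v) \<phi>"
    using \<phi>(1) convex_body_measure(1)[OF body] compact_tilt by (auto intro: set_integrable_continuous_compact)
  define f where "f = (\<lambda>x. (indicat_real (tilt t v) x - indicat_real Z x) * \<phi> x)"
  have fm[measurable]: "f \<in> borel_measurable borel" unfolding f_def by measurable
  have f_eq: "f = (\<lambda>x. indicat_real (tilt t v) x *\<^sub>R \<phi> x - indicat_real Z x *\<^sub>R \<phi> x)"
    by (simp add: f_def fun_eq_iff algebra_simps)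
  have fint: "integrable lborel f"
    unfolding f_eq using intf by (intro Bochner_Integration.integrable_diff) (simp_all add: set_integrable_def)
  have "(LINT x:tilt t v|lborel. \<phi> x) - (LINT x:Z|lborel. \<phi> x) = (LINT x|lborel. f x)"
    unfolding f_eq set_lebesgue_integral_def using intf
    by (intro Bochner_Integration.integral_diff[symmetric]) (simp_all add: set_integrable_def)
  also have "\<dots> = (LINT x|lborel. indicat_real {x. a \<bullet> x > 0} x * f x + indicat_real {x. a \<bullet> x < 0} x * f x)"
  proof (rule Bochner_Integration.integral_cong[OF HOL.refl])
    fix x
    \<comment> \<open>The two open half-spaces omit this hyperplane, on which the bodies agree:
      there the tilted constraint \<open>\<bar>t * (v \<bullet> x)\<bar> \<le> 1\<close> holds on
      all of \<open>2 Z\<close>.\<close>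
    have "f x = 0" if ax: "a \<bullet> x = 0"
    proof -
      have "\<bar>t * (v \<bullet> x)\<bar> \<le> 1" if "(1/2) *\<^sub>R x \<in> Z"
      proof -
        have "\<bar>v \<bullet> x\<bar> \<le> norm v * R"
          using Cauchy_Schwarz_ineq2[of v x] R[OF that] mult_left_mono[of "norm x" R "norm v"] by force
        then have "t * \<bar>v \<bullet> x\<bar> \<le> t * (norm v * R)" using t(1) by (intro mult_left_mono) auto
        then have "t * \<bar>v \<bullet> x\<bar> \<le> 1" using t(2) by linarith
        then show ?thesis using t(1) by (simp add: abs_mult)
      qed
      then have "x \<in> tilt t v \<longleftrightarrow> x \<in> Z"
        using ax scale_Z[of x "1/2"] by (auto simp: tilt_def inner_add_left Z_iff[of x])
      then show ?thesis by (simp add: f_def indicator_def)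
    qed
    then show "f x = indicat_real {x. a \<bullet> x > 0} x * f x + indicat_real {x. a \<bullet> x < 0} x * f x"
      by (auto simp: indicator_def)
  qed
  also have "\<dots> = (LINT x|lborel. indicat_real {x. a \<bullet> x > 0} x * f x) + (LINT x|lborel. indicat_real {x. a \<bullet> x < 0} x * f x)"
    by (intro Bochner_Integration.integral_add integrable_real_mult_indicator[of _ lborel f, unfolded mult.commute[of _ "indicat_real _ _"]] fint) auto
  also have "(LINT x|lborel. indicat_real {x. a \<bullet> x < 0} x * f x) = (LINT x|lborel. indicat_real {x. a \<bullet> x > 0} x * f x)"
  proof -
    have "(LINT x|lborel. indicat_real {x. a \<bullet> x < 0} (0 - x) * f (0 - x)) = (LINT x|lborel. indicat_real {x. a \<bullet> x < 0} x * f x)"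
      by (rule lborel_integral_reflect) measurable
    moreover have "indicat_real {x. a \<bullet> x < 0} (0 - x) * f (0 - x) = indicat_real {x. a \<bullet> x > 0} x * f x" for x
      using sym[of x] sym_tilt[of x t v] by (simp add: f_def indicator_def \<phi>(2))
    ultimately show ?thesis by simp
  qed
  also have "(LINT x|lborel. indicat_real {x. a \<bullet> x > 0} x * f x) = (1 / C) * (LINT \<xi>|lborel. indicat_real {x. a \<bullet> x > 0} (L \<xi>) * f (L \<xi>))"
    using C(1) by (subst C(2)[of "\<lambda>x. indicat_real {x. a \<bullet> x > 0} x * f x"]) auto
  also have "(LINT \<xi>|lborel. indicat_real {x. a \<bullet> x > 0} (L \<xi>) * f (L \<xi>))
     = t * (LINT \<eta>|lborel. indicat_real {x. a \<bullet> x > 0} (L (stretch t \<eta>)) * f (L (stretch t \<eta>)))"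
    by (rule stretch_integral[OF t(1), symmetric]) measurable
  finally show ?thesis using t(1) by (simp add: f_def field_simps)
qed

lemma tilt_integral_limit:
  assumes \<phi>: "continuous_on UNIV \<phi>" "\<And>x. \<phi> (- x) = \<phi> x"
    and R: "R > 0" "\<And>x. (1/2) *\<^sub>R x \<in> Z \<Longrightarrow> norm x \<le> R"
    and t: "t \<longlonglongrightarrow> 0" "\<And>m. t m > 0" "\<And>m. t m * (norm v * R) \<le> 1/2"
    and C: "C > 0" "\<And>g::real^'n \<Rightarrow> real. g \<in> borel_measurable borel \<Longrightarrow> (LINT x|lborel. g (L x)) = C * (LINT x|lborel. g x)"
  shows "(\<lambda>m. ((LINT x:tilt (t m) v|lborel. \<phi> x) - (LINT x:Z|lborel. \<phi> x)) / t m)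
     \<longlonglongrightarrow> (2 / C) * (LINT \<eta>|lborel. wedge v \<eta> * \<phi> (L (stretch 0 \<eta>)))"
proof -
  have [measurable]: "\<phi> \<in> borel_measurable borel" using \<phi>(1) by (rule borel_measurable_continuous_onI)
  have [measurable]: "Z \<in> sets borel" "tilt s v \<in> sets borel" for s
    using convex_body_measure(3)[OF body] closed_tilt by auto
  define g where "g = (\<lambda>m \<eta>. indicat_real {x. a \<bullet> x > 0} (L (stretch (t m) \<eta>)) *
       ((indicat_real (tilt (t m) v) (L (stretch (t m) \<eta>)) - indicat_real Z (L (stretch (t m) \<eta>))) * \<phi> (L (stretch (t m) \<eta>))))"
  have gm[measurable]: "g m \<in> borel_measurable borel" for m unfolding g_def by measurable
  have "compact (cball (0::real^'n) R)" by simp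
  then have "bounded (\<phi> ` cball 0 R)"
    by (intro compact_imp_bounded compact_continuous_image continuous_on_subset[OF \<phi>(1)]) auto
  then obtain P where P: "P > 0" "\<And>x. norm x \<le> R \<Longrightarrow> \<bar>\<phi> x\<bar> \<le> P"
    unfolding bounded_pos by auto
  obtain c0 where c0: "c0 > 0" "\<And>x. c0 * norm x \<le> norm (L x)"
    using linear_inj_bounded_below_pos[OF linL injL] by blast
  \<comment> \<open>The box of side \<open>2 c\<close> contains the supports of all
    \<open>g m\<close>: \<open>norm v * R\<close> bounds the normal coordinate,
    \<open>R / c0\<close> the tangential ones.\<close>
  define c where "c = max (R / c0) (norm v * R)"
  define box where "box = cbox ((\<chi> i. - c) :: real^'n) (\<chi> i. c)"
  have bound: "\<bar>g m \<eta>\<bar> \<le> P * indicat_real box \<eta>" for m \<eta>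
  proof (cases "g m \<eta> = 0")
    case True then show ?thesis using P(1) by simp
  next
    case False
    define \<xi> where "\<xi> = stretch (t m) \<eta>"
    have pos: "a \<bullet> L \<xi> > 0" and ne: "(L \<xi> \<in> tilt (t m) v) \<noteq> (L \<xi> \<in> Z)"
      using False by (auto simp: g_def \<xi>_def indicator_def split: if_splits)
    note bd = tilt_difference_bound[OF R(2) t(2,3) \<xi>_def pos ne]
    have "\<bar>\<eta> $ i\<bar> \<le> c" for i
    proof (cases "i = k")
      case True then show ?thesis using bd(2) by (simp add: c_def)
    next
      case False
      have "\<bar>\<eta> $ i\<bar> = \<bar>\<xi> $ i\<bar>" using False by (simp add: \<xi>_def stretch_other)
      also have "\<dots> \<le> norm \<xi>" by (rule component_le_norm_cart)
      also have "\<dots> \<le> R / c0" using c0(2)[of \<xi>] bd(1) c0(1) by (simp add: field_simps)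
      finally show ?thesis by (simp add: c_def)
    qed
    then have "\<eta> \<in> box" by (auto simp: box_def mem_box_cart abs_le_iff minus_le_iff)
    moreover have "\<bar>g m \<eta>\<bar> \<le> \<bar>\<phi> (L \<xi>)\<bar>"
      by (auto simp: g_def \<xi>_def indicator_def)
    ultimately show ?thesis using P(2)[OF bd(1)] by simp
  qed
  have "(\<lambda>m. LINT \<eta>|lborel. g m \<eta>) \<longlonglongrightarrow> (LINT \<eta>|lborel. wedge v \<eta> * \<phi> (L (stretch 0 \<eta>)))"
  proof (rule integral_dominated_convergence[where w = "\<lambda>\<eta>. P * indicat_real box \<eta>"])
    show "integrable lborel (\<lambda>\<eta>. P * indicat_real box \<eta>)"
      unfolding box_def by (intro integrable_mult_right integrable_real_indicator) (auto simp: emeasure_lborel_cbox_eq)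
    show "AE \<eta> in lborel. norm (g m \<eta>) \<le> P * indicat_real box \<eta>" for m
      using bound by simp
    show "AE \<eta> in lborel. (\<lambda>m. g m \<eta>) \<longlonglongrightarrow> wedge v \<eta> * \<phi> (L (stretch 0 \<eta>))"
      using AE_generic[of v]
    proof eventually_elim
      case (elim \<eta>)
      have l: "(\<lambda>m. (indicat_real (tilt (t m) v) (L (stretch (t m) \<eta>)) - indicat_real Z (L (stretch (t m) \<eta>))) * \<phi> (L (stretch (t m) \<eta>)))
         \<longlonglongrightarrow> wedge v \<eta> * \<phi> (L (stretch 0 \<eta>))"
        by (rule tilt_pointwise_limit[OF \<phi>(1) t(1,2)]) (use elim in auto)
      have "(\<lambda>m. 1 + t m * \<eta> $ k) \<longlonglongrightarrow> 1 + 0 * \<eta> $ k" by (intro tendsto_intros t)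
      then have "\<forall>\<^sub>F m in sequentially. 1 + t m * \<eta> $ k > 0" by (rule order_tendstoD) simp
      then have "\<forall>\<^sub>F m in sequentially. (indicat_real (tilt (t m) v) (L (stretch (t m) \<eta>)) - indicat_real Z (L (stretch (t m) \<eta>))) * \<phi> (L (stretch (t m) \<eta>)) = g m \<eta>"
        by eventually_elim (simp add: g_def aL stretch_k)
      then show ?case by (rule Lim_transform_eventually[OF l])
    qed
  qed measurable
  then have "(\<lambda>m. (2 / C) * (LINT \<eta>|lborel. g m \<eta>)) \<longlonglongrightarrow> (2 / C) * (LINT \<eta>|lborel. wedge v \<eta> * \<phi> (L (stretch 0 \<eta>)))"
    by (rule tendsto_mult_left)
  moreover have "((LINT x:tilt (t m) v|lborel. \<phi> x) - (LINT x:Z|lborel. \<phi> x)) / t m = (2 / C) * (LINT \<eta>|lborel. g m \<eta>)" for m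
    unfolding g_def by (rule tilt_integral_eq[OF \<phi> R(2) t(2,3) C])
  ultimately show ?thesis by simp
qed

end

section \<open>First variation of the determinant inequality\<close>

lemma tendsto_product_at_one:
  fixes f :: "'i \<Rightarrow> nat \<Rightarrow> real"
  assumes "finite I" "t \<longlonglongrightarrow> 0" "\<And>m. t m > 0" "\<And>i. i \<in> I \<Longrightarrow> (\<lambda>m. (f i m - 1) / t m) \<longlonglongrightarrow> b i"
  shows "(\<lambda>m. ((\<Prod>i\<in>I. f i m) - 1) / t m) \<longlonglongrightarrow> (\<Sum>i\<in>I. b i)"
  using assms(1,4)
proof (induction I)
  case empty then show ?case by simp
next
  case (insert i I)
  have fi: "(\<lambda>m. (f i m - 1) / t m) \<longlonglongrightarrow> b i" and
    IH: "(\<lambda>m. ((\<Prod>i\<in>I. f i m) - 1) / t m) \<longlonglongrightarrow> (\<Sum>i\<in>I. b i)" using insert by auto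
  have "(\<lambda>m. 1 + t m * ((f i m - 1) / t m)) \<longlonglongrightarrow> 1 + 0 * b i" by (intro tendsto_intros fi assms)
  then have f1: "f i \<longlonglongrightarrow> 1" using assms(3) by (simp add: less_imp_neq[symmetric] order_less_imp_not_eq2)
  have "(\<lambda>m. f i m * (((\<Prod>i\<in>I. f i m) - 1) / t m) + (f i m - 1) / t m) \<longlonglongrightarrow> 1 * (\<Sum>i\<in>I. b i) + b i"
    by (intro tendsto_intros f1 IH fi)
  moreover have "f i m * (((\<Prod>i\<in>I. f i m) - 1) / t m) + (f i m - 1) / t m = ((\<Prod>i\<in>insert i I. f i m) - 1) / t m" for m
    using insert.hyps by (simp add: diff_divide_distrib algebra_simps)
  ultimately show ?case using insert.hyps by (simp add: add.commute)
qed

text \<open>The derivative of the determinant at the identity is the trace. A permutation other than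
  the identity moves two indices at least, so its product has one off-diagonal factor of order
  \<open>t\<close> and another one that tends to 0.\<close>

lemma tendsto_det_at_one:
  fixes M :: "nat \<Rightarrow> real^'n::finite^'n"
  assumes t: "t \<longlonglongrightarrow> 0" "\<And>m. t m > 0"
    and M: "\<And>i j. (\<lambda>m. (M m $ i $ j - (if i = j then 1 else 0)) / t m) \<longlonglongrightarrow> b i j"
  shows "(\<lambda>m. (det (M m) - 1) / t m) \<longlonglongrightarrow> (\<Sum>i\<in>UNIV. b i i)"
proof -
  let ?P = "{p. p permutes (UNIV::'n set)}"
  have finP: "finite ?P" by (rule finite_permutations) simp
  have idP: "id \<in> ?P" by (simp add: permutes_id)
  have Mlim: "(\<lambda>m. M m $ i $ j) \<longlonglongrightarrow> (if i = j then 1 else 0)" for i j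
  proof -
    have "(\<lambda>m. (if i = j then 1 else 0) + t m * ((M m $ i $ j - (if i = j then 1 else 0)) / t m)) \<longlonglongrightarrow> (if i = j then 1 else 0) + 0 * b i j"
      by (intro tendsto_intros t M)
    moreover have "(if i = j then 1 else 0) + t m * ((M m $ i $ j - (if i = j then 1 else 0)) / t m) = M m $ i $ j" for m
      using t(2)[of m] by simp
    ultimately show ?thesis by simp
  qed
  have offdiag: "(\<lambda>m. (of_int (sign p) * (\<Prod>i\<in>UNIV. M m $ i $ p i)) / t m) \<longlonglongrightarrow> 0" if p: "p \<in> ?P - {id}" for p
  proof -
    obtain i where i: "p i \<noteq> i" using p by (auto simp: fun_eq_iff)
    have inj: "inj p" using p permutes_inj by auto
    have i2: "p (p i) \<noteq> p i" using i injD[OF inj] by auto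
    have l: "(\<lambda>m. of_int (sign p) * ((M m $ i $ p i - (if i = p i then 1 else 0)) / t m) * (\<Prod>j\<in>UNIV - {i}. M m $ j $ p j))
        \<longlonglongrightarrow> of_int (sign p) * b i (p i) * (\<Prod>j\<in>UNIV - {i}. (if j = p j then 1 else 0))"
      by (intro tendsto_intros M Mlim)
    have z: "(\<Prod>j\<in>UNIV - {i}. (if j = p j then 1 else 0)) = (0::real)"
      by (rule prod_zero) (use i i2 in \<open>auto intro!: bexI[of _ "p i"]\<close>)
    have e: "of_int (sign p) * ((M m $ i $ p i - (if i = p i then 1 else 0)) / t m) * (\<Prod>j\<in>UNIV - {i}. M m $ j $ p j)
       = (of_int (sign p) * (\<Prod>i\<in>UNIV. M m $ i $ p i)) / t m" for m
      using i by (simp add: prod.remove[of UNIV i])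
    show ?thesis using l unfolding e z by simp
  qed
  have diag: "(\<lambda>m. ((\<Prod>i\<in>UNIV. M m $ i $ i) - 1) / t m) \<longlonglongrightarrow> (\<Sum>i\<in>UNIV. b i i)"
  proof (rule tendsto_product_at_one[OF _ t])
    show "(\<lambda>m. (M m $ i $ i - 1) / t m) \<longlonglongrightarrow> b i i" for i using M[of i i] by simp
  qed simp
  have "(det (M m) - 1) / t m = ((\<Prod>i\<in>UNIV. M m $ i $ i) - 1) / t m + (\<Sum>p\<in>?P - {id}. (of_int (sign p) * (\<Prod>i\<in>UNIV. M m $ i $ p i)) / t m)" for m
    unfolding det_def sum.remove[OF finP idP]
    by (simp add: sign_id add_divide_distrib diff_divide_distrib sum_divide_distrib)
  moreover have "(\<lambda>m. ((\<Prod>i\<in>UNIV. M m $ i $ i) - 1) / t m + (\<Sum>p\<in>?P - {id}. (of_int (sign p) * (\<Prod>i\<in>UNIV. M m $ i $ p i)) / t m))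
     \<longlonglongrightarrow> (\<Sum>i\<in>UNIV. b i i) + (\<Sum>p\<in>?P - {id}. 0)"
    by (intro tendsto_add diag tendsto_sum offdiag)
  ultimately show ?thesis by simp
qed

lemma integrable_bounded_support:
  fixes f :: "'a::euclidean_space \<Rightarrow> real"
  assumes "f \<in> borel_measurable borel" "compact S" "\<And>x. \<bar>f x\<bar> \<le> P * indicat_real S x"
  shows "integrable lborel f"
proof (rule Bochner_Integration.integrable_bound)
  show "integrable lborel (\<lambda>x. P * indicat_real S x)"
    using emeasure_compact_finite[OF assms(2)] borel_compact[OF assms(2)]
    by (intro integrable_mult_right integrable_real_indicator) (auto simp: top.not_eq_extremum)
  show "AE x in lborel. norm (f x) \<le> norm (P * indicat_real S x)"
    using assms(3) by (intro AE_I2) (metis abs_ge_self order_trans real_norm_def)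
qed (use assms in simp)

lemma lborel_integral_pos:
  fixes f :: "'a::euclidean_space \<Rightarrow> real"
  assumes f: "integrable lborel f" "\<And>x. f x \<ge> 0" and U: "open U" "U \<noteq> {}" "\<And>x. x \<in> U \<Longrightarrow> f x > 0"
  shows "(LINT x|lborel. f x) > 0"
proof (rule ccontr)
  assume "\<not> (LINT x|lborel. f x) > 0"
  moreover have "(LINT x|lborel. f x) \<ge> 0" using f(2) by simp
  ultimately have "(LINT x|lborel. f x) = 0" by simp
  then have "AE x in lborel. f x = 0" using f by (subst (asm) integral_nonneg_eq_0_iff_AE) auto
  then have "AE x in lborel. x \<notin> U" by (rule eventually_mono) (metis U(3) less_irrefl)
  then have "U \<in> null_sets lborel" using U(1) by (subst (asm) AE_iff_null_sets[symmetric]) auto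
  then have "negligible U" by (simp add: negligible_iff_null_sets null_sets_completionI)
  then show False using U open_not_negligible by blast
qed

context facet_variation
begin

lemma cont_wedge_bound:
  obtains c where "\<And>\<eta>. wedge v \<eta> \<noteq> 0 \<Longrightarrow> \<eta> \<in> cbox (\<chi> i. - c) (\<chi> i. c)"
proof -
  obtain c1 where c1: "c1 > 0" "\<And>x. norm (L x) \<le> c1 * norm x"
    using linear_bounded_pos[OF linL] by blast
  define c where "c = max 1 (norm v * (c1 * real CARD('n)))"
  have "\<eta> \<in> cbox (\<chi> i. - c) (\<chi> i. c)" if w: "wedge v \<eta> \<noteq> 0" for \<eta>
  proof -
    have le: "\<bar>\<eta> $ i\<bar> \<le> 1" if "i \<noteq> k" for i using w that by (auto simp: wedge_def split: if_splits)
    have "\<bar>\<eta> $ k\<bar> \<le> \<bar>v \<bullet> L (stretch 0 \<eta>)\<bar>" using w by (auto simp: wedge_def split: if_splits)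
    also have "\<dots> \<le> norm v * norm (L (stretch 0 \<eta>))" by (rule Cauchy_Schwarz_ineq2)
    also have "\<dots> \<le> norm v * (c1 * norm (stretch 0 \<eta>))" using c1 by (intro mult_left_mono) auto
    also have "norm (stretch 0 \<eta>) \<le> (\<Sum>i\<in>UNIV. \<bar>stretch 0 \<eta> $ i\<bar>)" by (rule norm_le_l1_cart)
    also have "\<dots> \<le> (\<Sum>i\<in>(UNIV::'n set). 1)"
      by (rule sum_mono) (use le in \<open>auto simp: stretch_def\<close>)
    finally have "\<bar>\<eta> $ k\<bar> \<le> norm v * (c1 * real CARD('n))" using c1(1) by (simp add: mult_left_mono)
    then have "\<bar>\<eta> $ i\<bar> \<le> c" for i using le[of i] by (cases "i = k") (auto simp: c_def)
    then show ?thesis by (auto simp: mem_box_cart abs_le_iff minus_le_iff)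
  qed
  then show ?thesis using that by blast
qed

lemma wedge_integrable:
  assumes "continuous_on UNIV g"
  shows "integrable lborel (\<lambda>\<eta>. wedge v \<eta> * g \<eta>)"
proof -
  obtain c where c: "\<And>\<eta>. wedge v \<eta> \<noteq> 0 \<Longrightarrow> \<eta> \<in> cbox (\<chi> i. - c) (\<chi> i. c)" using cont_wedge_bound by blast
  let ?S = "cbox (\<chi> i. - c) (\<chi> i. c) :: (real^'n) set"
  have "bounded (g ` ?S)"
    by (intro compact_imp_bounded compact_continuous_image continuous_on_subset[OF assms]) auto
  then obtain P where P: "P > 0" "\<And>x. x \<in> ?S \<Longrightarrow> \<bar>g x\<bar> \<le> P" unfolding bounded_pos by auto
  show ?thesis
  proof (rule integrable_bounded_support[where S = ?S and P = P])
    show "(\<lambda>\<eta>. wedge v \<eta> * g \<eta>) \<in> borel_measurable borel"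
      using borel_measurable_continuous_onI[OF assms] by measurable
    fix \<eta>
    show "\<bar>wedge v \<eta> * g \<eta>\<bar> \<le> P * indicat_real ?S \<eta>"
    proof (cases "wedge v \<eta> = 0")
      case True then show ?thesis using P(1) by simp
    next
      case False
      have "\<bar>wedge v \<eta>\<bar> \<le> 1" by (auto simp: wedge_def)
      then have "\<bar>wedge v \<eta> * g \<eta>\<bar> \<le> 1 * \<bar>g \<eta>\<bar>" unfolding abs_mult by (intro mult_right_mono) auto
      then show ?thesis using P(2)[OF c[OF False]] c[OF False] by simp
    qed
  qed simp
qed

lemma cont_L_stretch: "continuous_on S (\<lambda>\<eta>. L (stretch 0 \<eta>))"
  by (rule continuous_on_compose2[OF contL[of UNIV] cont_stretch]) auto

text \<open>The inequality of local maximality along the tilts \<open>K m\<close> is expanded to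
  first order. Up to the common factor \<open>2 / C\<close> the second moments and volume have
  derivatives \<open>W (\<lambda>x. x $ i * x $ j)\<close> and \<open>W (\<lambda>_. 1)\<close>. The
  trace gives \<open>|x|^2 - n\<close> on the left and the squared volume gives 2 on the right,
  together the weight \<open>|x|^2 - (n + 2)\<close>.\<close>

lemma wedge_nonpos:
  assumes iso: "isotropic Z"
    and lm: "local_maximizer_isotropic_constant {K. convex_body K \<and> centrally_symmetric K} Z"
  shows "(LINT \<eta>|lborel. wedge v \<eta> * ((norm (L (stretch 0 \<eta>)))\<^sup>2 - (real CARD('n) + 2))) \<le> 0"
proof -
  obtain \<delta> where \<delta>: "\<delta> > 0"
    "\<And>K. convex_body K \<Longrightarrow> (\<And>x. - x \<in> K \<longleftrightarrow> x \<in> K) \<Longrightarrow> hausdorff_dist K Z < \<delta> \<Longrightarrow>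
      det (\<chi> i j. (LINT x:K|lborel. x $ i * x $ j) / measure lborel K) * (measure lborel Z)\<^sup>2 \<le> (measure lborel K)\<^sup>2"
    using isotropic_local_maximizer_det[OF iso lm] by blast
  obtain R where R: "R > 0" "\<And>x. (1/2) *\<^sub>R x \<in> Z \<Longrightarrow> norm x \<le> R" using bounded_double by blast
  obtain C where C: "C > 0" "\<And>g::real^'n \<Rightarrow> real. g \<in> borel_measurable borel \<Longrightarrow> (LINT x|lborel. g (L x)) = C * (LINT x|lborel. g x)"
    using lborel_integral_linear[OF linL injL] by blast
  \<comment> \<open>\<open>s * R \<le> \<delta> / 2\<close> keeps the bodies in the neighbourhood
    where \<open>Z\<close> is maximal, and \<open>s \<le> 1/2\<close> meets the smallness condition
    of the tilt estimates; \<open>t m\<close> is scaled so that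
    \<open>t m * q \<le> s\<close>.\<close>
  define s where "s = min (1/2) (\<delta> / (2 * R))"
  define q where "q = norm v * R"
  have q0: "q \<ge> 0" using R(1) by (simp add: q_def)
  have s0: "s > 0" "s \<le> 1/2" "s * R \<le> \<delta> / 2" using \<delta>(1) R(1) by (auto simp: s_def min_def field_simps)
  define t where "t = (\<lambda>m. (s / (q + 1)) * inverse (real (Suc m)))"
  have t1: "t m > 0" for m using s0 q0 by (simp add: t_def)
  have t2: "t m * q \<le> s" for m
  proof -
    have "t m * q \<le> (s / (q + 1)) * 1 * q"
      unfolding t_def using s0 q0 by (intro mult_right_mono mult_left_mono) (auto simp: field_simps)
    also have "\<dots> \<le> s" using s0 q0 by (simp add: field_simps)
    finally show ?thesis .
  qed
  have t3: "t m * (norm v * R) \<le> 1/2" for m using t2[of m] s0 by (simp add: q_def)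
  have t0: "t \<longlonglongrightarrow> 0"
    unfolding t_def using tendsto_mult_right_zero[OF LIMSEQ_inverse_real_of_nat, of "s / (q + 1)"] by simp
  define K where "K = (\<lambda>m. tilt (t m) v)"
  have cbK: "convex_body (K m)" for m
    unfolding K_def by (rule tilt_body[OF R(2) less_imp_le[OF t1] t3])
  have "hausdorff_dist (K m) Z < \<delta>" for m
  proof -
    have "hausdorff_dist (K m) Z \<le> t m * (norm v * R) * R"
      unfolding K_def by (rule tilt_hausdorff[OF R(2) less_imp_le[OF t1] t3])
    also have "\<dots> \<le> s * R" using t2[of m] R(1) by (intro mult_right_mono) (auto simp: q_def)
    also have "\<dots> < \<delta>" using s0 \<delta>(1) by linarith
    finally show ?thesis .
  qed
  then have det: "det (\<chi> i j. (LINT x:K m|lborel. x $ i * x $ j) / measure lborel (K m)) * (measure lborel Z)\<^sup>2 \<le> (measure lborel (K m))\<^sup>2" for m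
    by (intro \<delta>(2) cbK) (simp_all add: K_def sym_tilt)
  define V where "V = measure lborel Z"
  define VK where "VK = (\<lambda>m. measure lborel (K m))"
  have V: "V > 0" using convex_body_measure(5)[OF body] by (simp add: V_def)
  have VKpos: "VK m > 0" for m using convex_body_measure(5)[OF cbK] by (simp add: VK_def)
  define W where "W = (\<lambda>\<phi>. LINT \<eta>|lborel. wedge v \<eta> * \<phi> (L (stretch 0 \<eta>)))"
  have lim: "(\<lambda>m. ((LINT x:K m|lborel. \<phi> x) - (LINT x:Z|lborel. \<phi> x)) / t m) \<longlonglongrightarrow> (2 / C) * W \<phi>"
    if "continuous_on UNIV \<phi>" "\<And>x. \<phi> (- x) = \<phi> x" for \<phi>
    unfolding K_def W_def by (rule tilt_integral_limit[OF that R t0 t1 t3 C])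
  have one: "(LINT x:S|lborel. 1::real) = measure lborel S" if "convex_body S" for S :: "(real^'n) set"
    using convex_body_measure[OF that] by (simp add: set_lebesgue_integral_def)
  have lV: "(\<lambda>m. (VK m - V) / t m) \<longlonglongrightarrow> (2 / C) * W (\<lambda>_. 1)"
    using lim[of "\<lambda>_. 1"] one[OF body] one[OF cbK] by (simp add: V_def VK_def)
  have cov: "(LINT x:Z|lborel. x $ i * x $ j) = V * (if i = j then 1 else 0)" for i j
  proof -
    have "covariance_matrix Z $ i $ j = (mat 1 :: real^'n^'n) $ i $ j"
      using iso by (simp add: isotropic_def)
    then show ?thesis
      unfolding covariance_matrix_symmetric[OF body sym] using V by (auto simp: mat_def V_def)
  qed
  have lM: "(\<lambda>m. ((LINT x:K m|lborel. x $ i * x $ j) - V * (if i = j then 1 else 0)) / t m) \<longlonglongrightarrow> (2 / C) * W (\<lambda>x. x $ i * x $ j)" for i j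
    using lim[of "\<lambda>x. x $ i * x $ j"] by (simp add: cov continuous_intros)
  have "(\<lambda>m. V + t m * ((VK m - V) / t m)) \<longlonglongrightarrow> V + 0 * ((2 / C) * W (\<lambda>_. 1))"
    by (intro tendsto_intros t0 lV)
  moreover have "V + t m * ((VK m - V) / t m) = VK m" for m using t1[of m] by simp
  ultimately have VKV: "VK \<longlonglongrightarrow> V" by simp
  define A where "A = (\<lambda>m. \<chi> i j. (LINT x:K m|lborel. x $ i * x $ j) / VK m)"
  \<comment> \<open>The quotient rule for second moments divided by volume, at the identity matrix
    and volume \<open>V\<close>.\<close>
  define b where "b = (\<lambda>i j. ((2 / C) * W (\<lambda>x. x $ i * x $ j) - (if i = j then 1 else 0) * ((2 / C) * W (\<lambda>_. 1))) / V)"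
  have lA: "(\<lambda>m. (A m $ i $ j - (if i = j then 1 else 0)) / t m) \<longlonglongrightarrow> b i j" for i j
  proof -
    have "(\<lambda>m. (((LINT x:K m|lborel. x $ i * x $ j) - V * (if i = j then 1 else 0)) / t m
       - (if i = j then 1 else 0) * ((VK m - V) / t m)) / VK m) \<longlonglongrightarrow> b i j"
      unfolding b_def using V by (intro tendsto_intros lM lV VKV) simp
    moreover have "(((LINT x:K m|lborel. x $ i * x $ j) - V * (if i = j then 1 else 0)) / t m
       - (if i = j then 1 else 0) * ((VK m - V) / t m)) / VK m = (A m $ i $ j - (if i = j then 1 else 0)) / t m" for m
      using t1[of m] VKpos[of m] by (simp add: A_def field_simps)
    ultimately show ?thesis by simp
  qed
  have ldet: "(\<lambda>m. (det (A m) - 1) / t m) \<longlonglongrightarrow> (\<Sum>i\<in>UNIV. b i i)"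
    by (rule tendsto_det_at_one[OF t0 t1 lA])
  have lr: "(\<lambda>m. ((VK m - V) / t m) * (VK m + V) / V\<^sup>2) \<longlonglongrightarrow> ((2 / C) * W (\<lambda>_. 1)) * (V + V) / V\<^sup>2"
    using V by (intro tendsto_intros lV VKV) simp
  have le: "(det (A m) - 1) / t m \<le> ((VK m - V) / t m) * (VK m + V) / V\<^sup>2" for m
  proof -
    have "det (A m) * V\<^sup>2 \<le> (VK m)\<^sup>2" using det[of m] by (simp add: A_def VK_def V_def)
    then have "det (A m) \<le> (VK m)\<^sup>2 / V\<^sup>2" using V by (simp add: pos_le_divide_eq)
    then have "det (A m) - 1 \<le> (VK m - V) * (VK m + V) / V\<^sup>2"
      using V by (simp add: field_simps power2_eq_square)
    then have "(det (A m) - 1) / t m \<le> ((VK m - V) * (VK m + V) / V\<^sup>2) / t m"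
      using t1[of m] by (intro divide_right_mono) auto
    then show ?thesis by (simp add: mult_ac)
  qed
  have "(\<Sum>i\<in>UNIV. b i i) \<le> ((2 / C) * W (\<lambda>_. 1)) * (V + V) / V\<^sup>2"
    by (rule LIMSEQ_le[OF ldet lr]) (use le in blast)
  also have "\<dots> = (2 / C) * (2 * W (\<lambda>_. 1)) / V" using V by (simp add: power2_eq_square)
  also have "(\<Sum>i\<in>UNIV. b i i) = (2 / C) * ((\<Sum>i\<in>UNIV. W (\<lambda>x. x $ i * x $ i)) - real CARD('n) * W (\<lambda>_. 1)) / V"
    by (simp add: b_def sum_divide_distrib[symmetric] sum_subtractf sum_distrib_left right_diff_distrib)
  finally have "(\<Sum>i\<in>UNIV. W (\<lambda>x. x $ i * x $ i)) - real CARD('n) * W (\<lambda>_. 1) \<le> 2 * W (\<lambda>_. 1)"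
    using C(1) V by (simp add: divide_right_mono mult_le_cancel_left divide_le_cancel)
  then have main: "(\<Sum>i\<in>UNIV. W (\<lambda>x. x $ i * x $ i)) - (real CARD('n) + 2) * W (\<lambda>_. 1) \<le> 0"
    by (simp add: algebra_simps)
  have eq: "wedge v \<eta> * ((norm (L (stretch 0 \<eta>)))\<^sup>2 - (real CARD('n) + 2)) =
     (\<Sum>i\<in>UNIV. wedge v \<eta> * (L (stretch 0 \<eta>) $ i * L (stretch 0 \<eta>) $ i)) - (real CARD('n) + 2) * (wedge v \<eta> * 1)" for \<eta>
    by (simp add: power2_norm_eq_inner inner_vec_def right_diff_distrib sum_distrib_left)
  have i1: "integrable lborel (\<lambda>\<eta>. wedge v \<eta> * (L (stretch 0 \<eta>) $ i * L (stretch 0 \<eta>) $ i))" for i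
    by (rule wedge_integrable) (intro continuous_intros cont_L_stretch)
  have i2: "integrable lborel (\<lambda>\<eta>. wedge v \<eta> * 1)" by (rule wedge_integrable) (intro continuous_intros)
  have "(LINT \<eta>|lborel. wedge v \<eta> * ((norm (L (stretch 0 \<eta>)))\<^sup>2 - (real CARD('n) + 2))) =
     (\<Sum>i\<in>UNIV. W (\<lambda>x. x $ i * x $ i)) - (real CARD('n) + 2) * W (\<lambda>_. 1)"
    unfolding eq W_def using i1 i2
    by (simp add: Bochner_Integration.integral_diff Bochner_Integration.integral_sum Bochner_Integration.integrable_sum)
  with main show ?thesis by simp
qed

end

section \<open>Symmetries and moments of the box\<close>

definition flip :: "'n::finite \<Rightarrow> real^'n \<Rightarrow> real^'n" where
  "flip i \<eta> = (\<chi> j. if j = i then - \<eta> $ j else \<eta> $ j)"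

lemma orthogonal_flip: "orthogonal_transformation (flip i)"
proof -
  have "linear (flip i)" by (intro linearI) (auto simp: flip_def vec_eq_iff)
  moreover have "flip i v \<bullet> flip i w = v \<bullet> w" for v w
    by (auto simp: flip_def inner_vec_def intro!: sum.cong)
  ultimately show ?thesis by (simp add: orthogonal_transformation_def)
qed

lemma orthogonal_coordinate_swap: "orthogonal_transformation (\<lambda>\<eta>::real^'n::finite. \<chi> l. \<eta> $ Transposition.transpose i j l)"
proof -
  have "linear (\<lambda>\<eta>::real^'n. \<chi> l. \<eta> $ Transposition.transpose i j l)"
    by (intro linearI) (auto simp: vec_eq_iff)
  moreover have "(\<chi> l. v $ Transposition.transpose i j l) \<bullet> (\<chi> l. w $ Transposition.transpose i j l) = v \<bullet> w" for v w :: "real^'n"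
    unfolding inner_vec_def vec_lambda_beta
    by (rule sum.reindex_bij_betw) simp
  ultimately show ?thesis by (simp add: orthogonal_transformation_def)
qed

lemma integral_flip_odd:
  fixes g :: "real^'n::finite \<Rightarrow> real"
  assumes "g \<in> borel_measurable borel" "\<And>\<eta>. g (flip i \<eta>) = - g \<eta>"
  shows "(LINT \<eta>|lborel. g \<eta>) = 0"
  using lborel_integral_orthogonal[OF orthogonal_flip[of i] assms(1)] assms(2) by simp

text \<open>This is \<open>wedge (- a)\<close>: replacing \<open>a\<close> by
  \<open>(1 - t) a\<close> moves the facet outward parallel to itself, and the gain is a box over
  the facet with normal coordinate in \<open>(0, 1]\<close>.\<close>

definition slab :: "'n::finite \<Rightarrow> real^'n \<Rightarrow> real" where
  "slab k \<eta> = (if (\<forall>i. i \<noteq> k \<longrightarrow> \<bar>\<eta> $ i\<bar> \<le> 1) \<and> 0 < \<eta> $ k \<and> \<eta> $ k \<le> 1 then 1 else 0)"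

lemma slab_measurable[measurable]:
  fixes k :: "'n::finite"
  shows "slab k \<in> borel_measurable borel"
proof -
  have "{\<eta>::real^'n. \<forall>i. i \<noteq> k \<longrightarrow> \<bar>\<eta> $ i\<bar> \<le> 1} = (\<Inter>i\<in>UNIV - {k}. {\<eta>. \<bar>\<eta> $ i\<bar> \<le> 1})" by auto
  moreover have "closed \<dots>"
    by (intro closed_INT ballI closed_Collect_le continuous_intros)
  ultimately have "{\<eta>::real^'n. \<forall>i. i \<noteq> k \<longrightarrow> \<bar>\<eta> $ i\<bar> \<le> 1} \<in> sets borel" by auto
  then have [measurable]: "Measurable.pred borel (\<lambda>\<eta>::real^'n. \<forall>i. i \<noteq> k \<longrightarrow> \<bar>\<eta> $ i\<bar> \<le> 1)"
    by (simp add: pred_def)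
  show ?thesis unfolding slab_def by measurable
qed

lemma slab_integrable:
  fixes g :: "real^'n::finite \<Rightarrow> real"
  assumes "continuous_on UNIV g"
  shows "integrable lborel (\<lambda>\<eta>. slab k \<eta> * g \<eta>)"
proof -
  let ?S = "cbox (\<chi> i. - 1) (\<chi> i. 1) :: (real^'n) set"
  have "bounded (g ` ?S)"
    by (intro compact_imp_bounded compact_continuous_image continuous_on_subset[OF assms]) auto
  then obtain P where P: "P > 0" "\<And>x. x \<in> ?S \<Longrightarrow> \<bar>g x\<bar> \<le> P" unfolding bounded_pos by auto
  show ?thesis
  proof (rule integrable_bounded_support[where S = ?S and P = P])
    show "(\<lambda>\<eta>. slab k \<eta> * g \<eta>) \<in> borel_measurable borel"
      using borel_measurable_continuous_onI[OF assms] by measurable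
    fix \<eta>
    show "\<bar>slab k \<eta> * g \<eta>\<bar> \<le> P * indicat_real ?S \<eta>"
    proof (cases "slab k \<eta> = 0")
      case True then show ?thesis using P(1) by simp
    next
      case False
      then have s: "slab k \<eta> = 1" unfolding slab_def by presburger
      have "\<bar>\<eta> $ i\<bar> \<le> 1" for i using False by (cases "i = k") (auto simp: slab_def split: if_splits)
      then have "\<eta> \<in> ?S" by (auto simp: mem_box_cart abs_le_iff minus_le_iff)
      then show ?thesis using P(2) s by simp
    qed
  qed simp
qed

lemma open_slab_nonempty:
  "open {\<eta>::real^'n::finite. \<forall>i\<in>UNIV. 0 < \<eta> $ i \<and> \<eta> $ i < 1}" "{\<eta>::real^'n::finite. \<forall>i\<in>UNIV. 0 < \<eta> $ i \<and> \<eta> $ i < 1} \<noteq> {}"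
proof -
  have "{\<eta>::real^'n. \<forall>i\<in>UNIV. 0 < \<eta> $ i \<and> \<eta> $ i < 1} = (\<Inter>i\<in>UNIV. {\<eta>. 0 < \<eta> $ i} \<inter> {\<eta>. \<eta> $ i < 1})" by auto
  moreover have "open \<dots>" by (intro open_INT ballI open_Int open_Collect_less continuous_intros) auto
  ultimately show "open {\<eta>::real^'n. \<forall>i\<in>UNIV. 0 < \<eta> $ i \<and> \<eta> $ i < 1}" by simp
  have "(\<chi> i. 1/2) \<in> {\<eta>::real^'n. \<forall>i\<in>UNIV. 0 < \<eta> $ i \<and> \<eta> $ i < 1}" by simp
  then show "{\<eta>::real^'n::finite. \<forall>i\<in>UNIV. 0 < \<eta> $ i \<and> \<eta> $ i < 1} \<noteq> {}" by blast
qed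

lemma slab_eq_1: "\<eta> \<in> {\<eta>::real^'n::finite. \<forall>i\<in>UNIV. 0 < \<eta> $ i \<and> \<eta> $ i < 1} \<Longrightarrow> slab k \<eta> = 1"
  unfolding slab_def by (rule if_P) (auto simp: abs_of_pos less_imp_le)

lemma slab_volume_pos: "(LINT \<eta>|lborel. slab k \<eta>) > 0"
proof (rule lborel_integral_pos[OF _ _ open_slab_nonempty])
  show "integrable lborel (slab k)" using slab_integrable[of "\<lambda>_. 1" k] by simp
  show "slab k \<eta> > 0" if "\<eta> \<in> {\<eta>. \<forall>i\<in>UNIV. 0 < \<eta> $ i \<and> \<eta> $ i < 1}" for \<eta>
    using slab_eq_1[OF that] by simp
qed (simp add: slab_def)

text \<open>Swapping two tangential coordinates preserves the slab, so one \<kappa> serves all of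
  them. It is the mean of a square that is at most 1 and smaller than 1 on an open set.\<close>

lemma slab_moments:
  fixes k :: "'n::finite"
  obtains \<kappa> where "\<kappa> < 1" "\<And>i. i \<noteq> k \<Longrightarrow> (LINT \<eta>|lborel. slab k \<eta> * (\<eta> $ i)\<^sup>2) = \<kappa> * (LINT \<eta>|lborel. slab k \<eta>)"
proof (cases "\<exists>j. j \<noteq> k")
  \<comment> \<open>In dimension one there are no tangential coordinates, and any number below 1
    will do.\<close>
  case False then show ?thesis by (intro that[of 0]) auto
next
  case True
  then obtain j where j: "j \<noteq> k" by blast
  let ?m = "LINT \<eta>|lborel. slab k \<eta>"
  define \<kappa> where "\<kappa> = (LINT \<eta>|lborel. slab k \<eta> * (\<eta> $ j)\<^sup>2) / ?m"
  have m: "?m > 0" by (rule slab_volume_pos)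
  have i1: "integrable lborel (slab k)" using slab_integrable[of "\<lambda>_. 1" k] by simp
  have i2: "integrable lborel (\<lambda>\<eta>. slab k \<eta> * (\<eta> $ j)\<^sup>2)"
    by (rule slab_integrable) (intro continuous_intros)
  have "(LINT \<eta>|lborel. slab k \<eta> - slab k \<eta> * (\<eta> $ j)\<^sup>2) > 0"
  proof (rule lborel_integral_pos[OF _ _ open_slab_nonempty])
    show "integrable lborel (\<lambda>\<eta>. slab k \<eta> - slab k \<eta> * (\<eta> $ j)\<^sup>2)" using i1 i2 by simp
    show "0 \<le> slab k \<eta> - slab k \<eta> * (\<eta> $ j)\<^sup>2" for \<eta>
      using j by (auto simp: slab_def abs_square_le_1)
    show "slab k \<eta> - slab k \<eta> * (\<eta> $ j)\<^sup>2 > 0" if "\<eta> \<in> {\<eta>. \<forall>i\<in>UNIV. 0 < \<eta> $ i \<and> \<eta> $ i < 1}" for \<eta>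
    proof -
      have "slab k \<eta> = 1" using that by (rule slab_eq_1)
      moreover have "0 < \<eta> $ j" "\<eta> $ j < 1" using that by auto
      then have "(\<eta> $ j)\<^sup>2 < 1" by (simp add: abs_square_less_1)
      ultimately show ?thesis by simp
    qed
  qed
  then have "(LINT \<eta>|lborel. slab k \<eta> * (\<eta> $ j)\<^sup>2) < ?m" using i1 i2 by simp
  then have "\<kappa> < 1" using m by (simp add: \<kappa>_def)
  moreover have "(LINT \<eta>|lborel. slab k \<eta> * (\<eta> $ i)\<^sup>2) = \<kappa> * ?m" if "i \<noteq> k" for i
  proof -
    let ?T = "\<lambda>\<eta>::real^'n. \<chi> l. \<eta> $ Transposition.transpose i j l"
    have "(LINT \<eta>|lborel. slab k (?T \<eta>) * (?T \<eta> $ j)\<^sup>2) = (LINT \<eta>|lborel. slab k \<eta> * (\<eta> $ j)\<^sup>2)"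
      by (rule lborel_integral_orthogonal[OF orthogonal_coordinate_swap, where g = "\<lambda>\<eta>. slab k \<eta> * (\<eta> $ j)\<^sup>2"]) measurable
    moreover have "slab k (?T \<eta>) = slab k \<eta>" for \<eta>
    proof -
      have *: "\<forall>l. l \<noteq> k \<longrightarrow> \<bar>?T \<eta> $ l\<bar> \<le> 1" if "\<forall>l. l \<noteq> k \<longrightarrow> \<bar>\<eta> $ l\<bar> \<le> 1" for \<eta>
        using that \<open>i \<noteq> k\<close> j by (auto simp: Transposition.transpose_def)
      have "?T (?T \<eta>) = \<eta>" by (simp add: vec_eq_iff)
      then have "(\<forall>l. l \<noteq> k \<longrightarrow> \<bar>?T \<eta> $ l\<bar> \<le> 1) \<longleftrightarrow> (\<forall>l. l \<noteq> k \<longrightarrow> \<bar>\<eta> $ l\<bar> \<le> 1)"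
        using *[of \<eta>] *[of "?T \<eta>"] by metis
      moreover have "?T \<eta> $ k = \<eta> $ k" using \<open>i \<noteq> k\<close> j by (simp add: Transposition.transpose_def)
      ultimately show ?thesis by (simp add: slab_def)
    qed
    moreover have "?T \<eta> $ j = \<eta> $ i" for \<eta> by simp
    ultimately show ?thesis using m by (simp add: \<kappa>_def)
  qed
  ultimately show ?thesis by (rule that)
qed

section \<open>Conditions on the center of a facet\<close>

context facet_variation
begin

lemma L_stretch: "L (stretch 0 \<eta>) = L (axis k 1) + (\<Sum>i\<in>UNIV - {k}. \<eta> $ i *\<^sub>R L (axis i 1))"
proof -
  have "stretch 0 \<eta> = axis k 1 + (\<Sum>i\<in>UNIV - {k}. \<eta> $ i *\<^sub>R axis i 1)"
    by (auto simp: vec_eq_iff stretch_def axis_def if_distrib cong: if_cong)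
  then show ?thesis by (simp add: linear_add[OF linL] linear_sum[OF linL] linear_scale[OF linL])
qed

lemma norm_L_stretch:
  "(norm (L (stretch 0 \<eta>)))\<^sup>2 = (norm (L (axis k 1)))\<^sup>2
     + 2 * (\<Sum>i\<in>UNIV - {k}. (L (axis k 1) \<bullet> L (axis i 1)) * \<eta> $ i)
     + (\<Sum>i\<in>UNIV - {k}. \<Sum>j\<in>UNIV - {k}. (L (axis i 1) \<bullet> L (axis j 1)) * (\<eta> $ i * \<eta> $ j))"
proof -
  let ?s = "\<Sum>i\<in>UNIV - {k}. \<eta> $ i *\<^sub>R L (axis i 1)"
  have "(norm (L (stretch 0 \<eta>)))\<^sup>2 = (norm (L (axis k 1)))\<^sup>2 + 2 * (L (axis k 1) \<bullet> ?s) + ?s \<bullet> ?s"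
    unfolding L_stretch power2_norm_eq_inner by (simp add: inner_add_left inner_add_right inner_commute)
  moreover have "L (axis k 1) \<bullet> ?s = (\<Sum>i\<in>UNIV - {k}. (L (axis k 1) \<bullet> L (axis i 1)) * \<eta> $ i)"
    by (simp add: inner_sum_right mult.commute)
  moreover have "?s \<bullet> ?s = (\<Sum>i\<in>UNIV - {k}. \<Sum>j\<in>UNIV - {k}. (L (axis i 1) \<bullet> L (axis j 1)) * (\<eta> $ i * \<eta> $ j))"
    by (simp add: inner_sum_right inner_sum_left sum_distrib_left mult_ac inner_commute)
  ultimately show ?thesis by simp
qed

lemma stretch_flip: "stretch 0 (flip k \<eta>) = stretch 0 \<eta>"
  by (simp add: stretch_def flip_def vec_eq_iff)

text \<open>Reversing the normal coordinate exchanges gains of the tilt by \<open>v\<close> with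
  losses of the tilt by \<open>- v\<close>; only the null set where an inequality is an equality is
  excepted.\<close>

lemma wedge_odd:
  assumes g: "g \<in> borel_measurable borel" "\<And>\<eta>. g (flip k \<eta>) = g \<eta>"
  shows "(LINT \<eta>|lborel. wedge (- v) \<eta> * g \<eta>) = - (LINT \<eta>|lborel. wedge v \<eta> * g \<eta>)"
proof -
  have "(LINT \<eta>|lborel. wedge (- v) \<eta> * g \<eta>) = (LINT \<eta>|lborel. wedge (- v) (flip k \<eta>) * g (flip k \<eta>))"
    by (rule lborel_integral_orthogonal[OF orthogonal_flip, symmetric]) (use g in measurable)
  also have "\<dots> = (LINT \<eta>|lborel. - (wedge v \<eta> * g \<eta>))"
  proof (rule integral_cong_AE)
    have [measurable]: "flip k \<in> borel_measurable borel"
      using orthogonal_flip[of k] by (intro borel_measurable_continuous_onI linear_continuous_on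
          linear_conv_bounded_linear[THEN iffD1] orthogonal_transformation_linear)
    show "(\<lambda>\<eta>. wedge (- v) (flip k \<eta>) * g (flip k \<eta>)) \<in> borel_measurable lborel"
      using g by measurable
    show "(\<lambda>\<eta>. - (wedge v \<eta> * g \<eta>)) \<in> borel_measurable lborel" using g by measurable
    show "AE \<eta> in lborel. wedge (- v) (flip k \<eta>) * g (flip k \<eta>) = - (wedge v \<eta> * g \<eta>)"
      using AE_generic[of v]
    proof eventually_elim
      case (elim \<eta>)
      have "wedge (- v) (flip k \<eta>) = - wedge v \<eta>"
        using elim unfolding wedge_def stretch_flip by (auto simp: flip_def)
      then show ?case by (simp add: g(2))
    qed
  qed
  finally show ?thesis by simp
qed

text \<open>Tilts by \<open>v\<close> and \<open>- v\<close> are both admissible and have opposite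
  first-order effects, so the inequality is an equality.\<close>

lemma wedge_zero:
  assumes iso: "isotropic Z"
    and lm: "local_maximizer_isotropic_constant {K. convex_body K \<and> centrally_symmetric K} Z"
  shows "(LINT \<eta>|lborel. wedge v \<eta> * ((norm (L (stretch 0 \<eta>)))\<^sup>2 - (real CARD('n) + 2))) = 0"
proof -
  have "(LINT \<eta>|lborel. wedge (- v) \<eta> * ((norm (L (stretch 0 \<eta>)))\<^sup>2 - (real CARD('n) + 2)))
     = - (LINT \<eta>|lborel. wedge v \<eta> * ((norm (L (stretch 0 \<eta>)))\<^sup>2 - (real CARD('n) + 2)))"
    by (rule wedge_odd) (simp_all add: stretch_flip)
  with wedge_nonpos[OF iso lm, of v] wedge_nonpos[OF iso lm, of "- v"] show ?thesis by linarith
qed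

text \<open>The parallel displacement \<open>v = - a\<close> is used: \<open>|x|^2 - (n + 2)\<close>
  has mean 0 over the facet. In the expansion of \<open>|x|^2\<close>, linear and mixed terms
  disappear under coordinate flips, and each squared coordinate contributes \<kappa>.\<close>

lemma facet_center_norm:
  assumes iso: "isotropic Z"
    and lm: "local_maximizer_isotropic_constant {K. convex_body K \<and> centrally_symmetric K} Z"
    and \<kappa>: "\<And>i. i \<noteq> k \<Longrightarrow> (LINT \<eta>|lborel. slab k \<eta> * (\<eta> $ i)\<^sup>2) = \<kappa> * (LINT \<eta>|lborel. slab k \<eta>)"
  shows "(norm (L (axis k 1)))\<^sup>2 + \<kappa> * (\<Sum>i\<in>UNIV - {k}. (norm (L (axis i 1)))\<^sup>2) = real CARD('n) + 2"
proof -
  let ?p = "L (axis k 1)" and ?u = "\<lambda>i. L (axis i 1)" and ?I = "UNIV - {k}"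
  define m where "m = (LINT \<eta>|lborel. slab k \<eta>)"
  have m: "m > 0" unfolding m_def by (rule slab_volume_pos)
  have w: "wedge (- a) = slab k"
  proof
    fix \<eta>
    have "(- a) \<bullet> L (stretch 0 \<eta>) = -1" by (simp add: aL stretch_0_k)
    then show "wedge (- a) \<eta> = slab k \<eta>" by (auto simp: wedge_def slab_def)
  qed
  have s_flip: "slab k (flip i \<eta>) = slab k \<eta>" if "i \<noteq> k" for i \<eta>
  proof -
    have e: "(\<forall>j. j \<noteq> k \<longrightarrow> \<bar>flip i \<eta> $ j\<bar> \<le> 1) \<longleftrightarrow> (\<forall>j. j \<noteq> k \<longrightarrow> \<bar>\<eta> $ j\<bar> \<le> 1)" by (auto simp: flip_def)
    have "flip i \<eta> $ k = \<eta> $ k" using that by (simp add: flip_def)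
    then show ?thesis by (simp only: slab_def e)
  qed
  have i0: "integrable lborel (slab k)" using slab_integrable[of "\<lambda>_. 1" k] by simp
  have i1: "integrable lborel (\<lambda>\<eta>. slab k \<eta> * \<eta> $ i)" for i
    by (rule slab_integrable) (intro continuous_intros)
  have i2: "integrable lborel (\<lambda>\<eta>. slab k \<eta> * (\<eta> $ i * \<eta> $ j))" for i j
    by (rule slab_integrable) (intro continuous_intros)
  have z1: "(LINT \<eta>|lborel. slab k \<eta> * \<eta> $ i) = 0" if "i \<noteq> k" for i
    by (rule integral_flip_odd[of _ i]) (measurable, simp add: s_flip[OF that], simp add: flip_def)
  have z2: "(LINT \<eta>|lborel. slab k \<eta> * (\<eta> $ i * \<eta> $ j)) = (if j = i then \<kappa> * m else 0)" if "i \<noteq> k" for i j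
  proof (cases "i = j")
    case True
    then show ?thesis using \<kappa>[OF that] by (simp add: m_def power2_eq_square)
  next
    case False
    have "(LINT \<eta>|lborel. slab k \<eta> * (\<eta> $ i * \<eta> $ j)) = 0"
      by (rule integral_flip_odd[of _ i]) (measurable, use False in \<open>simp add: s_flip[OF that], simp add: flip_def\<close>)
    then show ?thesis using False by simp
  qed
  define c where "c = (norm ?p)\<^sup>2 - (real CARD('n) + 2)"
  have eq: "slab k \<eta> * ((norm (L (stretch 0 \<eta>)))\<^sup>2 - (real CARD('n) + 2)) =
     c * slab k \<eta> + 2 * (\<Sum>i\<in>?I. (?p \<bullet> ?u i) * (slab k \<eta> * \<eta> $ i))
      + (\<Sum>i\<in>?I. \<Sum>j\<in>?I. (?u i \<bullet> ?u j) * (slab k \<eta> * (\<eta> $ i * \<eta> $ j)))" for \<eta>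
    unfolding norm_L_stretch c_def by (simp add: algebra_simps sum_distrib_left)
  have "0 = (LINT \<eta>|lborel. slab k \<eta> * ((norm (L (stretch 0 \<eta>)))\<^sup>2 - (real CARD('n) + 2)))"
    using wedge_zero[OF iso lm, of "- a"] by (simp add: w)
  also have "\<dots> = c * m + 2 * (\<Sum>i\<in>?I. (?p \<bullet> ?u i) * (LINT \<eta>|lborel. slab k \<eta> * \<eta> $ i))
      + (\<Sum>i\<in>?I. \<Sum>j\<in>?I. (?u i \<bullet> ?u j) * (LINT \<eta>|lborel. slab k \<eta> * (\<eta> $ i * \<eta> $ j)))"
    unfolding eq m_def using i0 i1 i2
    by (simp add: Bochner_Integration.integral_add Bochner_Integration.integral_sum Bochner_Integration.integrable_sum)
  also have "\<dots> = c * m + (\<Sum>i\<in>?I. (norm (?u i))\<^sup>2 * (\<kappa> * m))"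
    by (simp add: z1 z2 power2_norm_eq_inner if_distrib[of "\<lambda>x. _ * x"] cong: if_cong)
  also have "\<dots> = m * (c + \<kappa> * (\<Sum>i\<in>?I. (norm (?u i))\<^sup>2))"
    by (simp add: sum_distrib_left algebra_simps)
  finally show ?thesis using m by (simp add: c_def)
qed

text \<open>A tilt that acts through the coordinate \<open>\<eta> $ j\<close> alone has a wedge that
  is odd under \<open>\<eta> \<mapsto> - \<eta>\<close> and unchanged by flips of the other
  tangential coordinates. In the expansion of \<open>|x|^2\<close> only the linear term of
  \<open>\<eta> $ j\<close> survives, whose coefficient is twice the inner product in
  question.\<close>

lemma facet_center_orthogonal:
  assumes iso: "isotropic Z"
    and lm: "local_maximizer_isotropic_constant {K. convex_body K \<and> centrally_symmetric K} Z"
    and j: "j \<noteq> k"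
  shows "L (axis k 1) \<bullet> L (axis j 1) = 0"
proof -
  let ?p = "L (axis k 1)" and ?u = "\<lambda>i. L (axis i 1)" and ?I = "UNIV - {k}"
  obtain M where M: "linear M" "\<And>x. M (L x) = x"
    using linear_injective_left_inverse[OF linL injL] by (auto simp: fun_eq_iff)
  \<comment> \<open>The vector whose product with \<open>L (stretch 0 \<eta>)\<close> is the
    coordinate \<open>\<eta> $ j\<close>.\<close>
  define v where "v = adjoint M (axis j 1)"
  have v: "v \<bullet> L (stretch 0 \<eta>) = \<eta> $ j" for \<eta>
    using adjoint_works[OF M(1), of "L (stretch 0 \<eta>)" "axis j 1"] j
    by (simp add: v_def M(2) inner_commute[of "adjoint M _"] inner_axis stretch_other)
  have w: "wedge v \<eta> = (if \<forall>i. i \<noteq> k \<longrightarrow> \<bar>\<eta> $ i\<bar> \<le> 1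
     then (if \<eta> $ k + \<eta> $ j \<le> 0 then 1 else 0) - (if \<eta> $ k \<le> 0 then 1 else 0) else 0)" for \<eta>
    by (simp only: wedge_def v)
  have w_flip: "wedge v (flip i \<eta>) = wedge v \<eta>" if "i \<noteq> k" "i \<noteq> j" for i \<eta>
  proof -
    have "(\<forall>l. l \<noteq> k \<longrightarrow> \<bar>flip i \<eta> $ l\<bar> \<le> 1) \<longleftrightarrow> (\<forall>l. l \<noteq> k \<longrightarrow> \<bar>\<eta> $ l\<bar> \<le> 1)" by (auto simp: flip_def)
    moreover have "flip i \<eta> $ k = \<eta> $ k" "flip i \<eta> $ j = \<eta> $ j" using that by (simp_all add: flip_def)
    ultimately show ?thesis by (simp only: w)
  qed
  have even: "(LINT \<eta>|lborel. wedge v \<eta> * h \<eta>) = 0" if h: "h \<in> borel_measurable borel" "\<And>\<eta>. h (- \<eta>) = h \<eta>" for h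
  proof -
    have "(LINT \<eta>|lborel. wedge v \<eta> * h \<eta>) = (LINT \<eta>|lborel. wedge v (0 - \<eta>) * h (0 - \<eta>))"
      by (rule lborel_integral_reflect[symmetric]) (use h in measurable)
    also have "\<dots> = (LINT \<eta>|lborel. - (wedge v \<eta> * h \<eta>))"
    proof (rule integral_cong_AE)
      show "(\<lambda>\<eta>. wedge v (0 - \<eta>) * h (0 - \<eta>)) \<in> borel_measurable lborel"
        using h by measurable
      show "(\<lambda>\<eta>. - (wedge v \<eta> * h \<eta>)) \<in> borel_measurable lborel" using h by measurable
      show "AE \<eta> in lborel. wedge v (0 - \<eta>) * h (0 - \<eta>) = - (wedge v \<eta> * h \<eta>)"
        using AE_generic[of v]
      proof eventually_elim
        case (elim \<eta>)
        have "wedge v (- \<eta>) = - wedge v \<eta>"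
          using elim unfolding w v by auto
        then show ?case by (simp add: h(2))
      qed
    qed
    finally show ?thesis by simp
  qed
  have i0: "integrable lborel (\<lambda>\<eta>. wedge v \<eta> * h \<eta>)" if "continuous_on UNIV h" for h
    by (rule wedge_integrable[OF that])
  define h where "h = (\<lambda>\<eta>. ((norm ?p)\<^sup>2 - (real CARD('n) + 2)) + (\<Sum>i\<in>?I. \<Sum>j\<in>?I. (?u i \<bullet> ?u j) * (\<eta> $ i * \<eta> $ j)))"
  have hc: "continuous_on UNIV h" unfolding h_def by (intro continuous_intros)
  have eq: "wedge v \<eta> * ((norm (L (stretch 0 \<eta>)))\<^sup>2 - (real CARD('n) + 2)) =
     wedge v \<eta> * h \<eta> + 2 * (\<Sum>i\<in>?I. (?p \<bullet> ?u i) * (wedge v \<eta> * \<eta> $ i))" for \<eta>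
    unfolding norm_L_stretch h_def by (simp add: algebra_simps sum_distrib_left)
  have i1: "integrable lborel (\<lambda>\<eta>. wedge v \<eta> * \<eta> $ i)" for i
    by (rule wedge_integrable) (intro continuous_intros)
  have z: "(LINT \<eta>|lborel. wedge v \<eta> * \<eta> $ i) = 0" if "i \<noteq> k" "i \<noteq> j" for i
    by (rule integral_flip_odd[of _ i]) (measurable, simp add: w_flip[OF that], simp add: flip_def)
  have "0 = (LINT \<eta>|lborel. wedge v \<eta> * ((norm (L (stretch 0 \<eta>)))\<^sup>2 - (real CARD('n) + 2)))"
    using wedge_zero[OF iso lm, of v] by simp
  also have "\<dots> = (LINT \<eta>|lborel. wedge v \<eta> * h \<eta>) + 2 * (\<Sum>i\<in>?I. (?p \<bullet> ?u i) * (LINT \<eta>|lborel. wedge v \<eta> * \<eta> $ i))"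
    unfolding eq using i0[OF hc] i1
    by (simp add: Bochner_Integration.integral_add Bochner_Integration.integral_sum Bochner_Integration.integrable_sum)
  also have "(LINT \<eta>|lborel. wedge v \<eta> * h \<eta>) = 0"
    by (rule even) (use hc in \<open>auto intro: borel_measurable_continuous_onI simp: h_def\<close>)
  also have "(\<Sum>i\<in>?I. (?p \<bullet> ?u i) * (LINT \<eta>|lborel. wedge v \<eta> * \<eta> $ i)) = (\<Sum>i\<in>?I. if i = j then (?p \<bullet> ?u j) * (LINT \<eta>|lborel. wedge v \<eta> * \<eta> $ j) else 0)"
    by (rule sum.cong) (auto simp: z)
  also have "\<dots> = (?p \<bullet> ?u j) * (LINT \<eta>|lborel. wedge v \<eta> * \<eta> $ j)"
    using j by simp
  finally have prod: "(?p \<bullet> ?u j) * (LINT \<eta>|lborel. wedge v \<eta> * \<eta> $ j) = 0" by simp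
  \<comment> \<open>The wedge is -1 only where \<open>\<eta> $ j\<close> is positive and 1 only
    where it is negative. So the integrand is nonnegative, and it is positive on the open set
    \<open>?U\<close>.\<close>
  have "(LINT \<eta>|lborel. - (wedge v \<eta> * \<eta> $ j)) > 0"
  proof (rule lborel_integral_pos)
    let ?U = "(\<Inter>i\<in>UNIV. {\<eta>::real^'n. \<bar>\<eta> $ i\<bar> < 1}) \<inter> {\<eta>. 0 < \<eta> $ k + \<eta> $ j} \<inter> {\<eta>. \<eta> $ k < 0}"
    show "integrable lborel (\<lambda>\<eta>. - (wedge v \<eta> * \<eta> $ j))" using i1 by simp
    show "0 \<le> - (wedge v \<eta> * \<eta> $ j)" for \<eta> unfolding w by (auto simp: not_le mult_le_0_iff)
    show "open ?U" by (intro open_INT ballI open_Int open_Collect_less continuous_intros) auto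
    have "(\<chi> i. if i = k then - 1/4 else 1/2) \<in> ?U" using j by auto
    then show "?U \<noteq> {}" by blast
    show "0 < - (wedge v \<eta> * \<eta> $ j)" if "\<eta> \<in> ?U" for \<eta>
    proof -
      have b: "\<forall>i. \<bar>\<eta> $ i\<bar> < 1" using that by auto
      then have "\<forall>i. i \<noteq> k \<longrightarrow> \<bar>\<eta> $ i\<bar> \<le> 1" by (simp add: less_imp_le)
      moreover have "0 < \<eta> $ k + \<eta> $ j" "\<eta> $ k < 0" using that by auto
      ultimately have "wedge v \<eta> = -1" "\<eta> $ j > 0" unfolding w by simp_all
      then show ?thesis by simp
    qed
  qed
  then have "(LINT \<eta>|lborel. wedge v \<eta> * \<eta> $ j) \<noteq> 0" by auto
  with prod show ?thesis by simp
qed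

end

text \<open>Transfers the conditions to any facet with \<open>n - 1\<close> independent generators.
  Its center is \<open>zon_max I z a\<close>, and center and generators form the basis that defines
  the coordinates \<open>L\<close>.\<close>

lemma zon_facet_center:
  fixes z :: "nat \<Rightarrow> real^'n::finite"
  assumes I: "finite I" and int: "interior (zon I z) \<noteq> {}"
    and iso: "isotropic (zon I z)"
    and lm: "local_maximizer_isotropic_constant {K. convex_body K \<and> centrally_symmetric K} (zon I z)"
  obtains \<kappa> where "\<kappa> < 1"
    "\<And>a j. lin_indep {i \<in> I. a \<bullet> z i = 0} z \<Longrightarrow> Suc (card {i \<in> I. a \<bullet> z i = 0}) = CARD('n) \<Longrightarrow>
       j \<in> I \<Longrightarrow> a \<bullet> z j = 0 \<Longrightarrow> zon_max I z a \<bullet> z j = 0"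
    "\<And>a. lin_indep {i \<in> I. a \<bullet> z i = 0} z \<Longrightarrow> Suc (card {i \<in> I. a \<bullet> z i = 0}) = CARD('n) \<Longrightarrow>
       (norm (zon_max I z a))\<^sup>2 + \<kappa> * (\<Sum>i | i \<in> I \<and> a \<bullet> z i = 0. (norm (z i))\<^sup>2) = real CARD('n) + 2"
proof -
  \<comment> \<open>One normal coordinate is fixed for all facets, so that \<kappa> does not depend
    on \<open>a\<close>.\<close>
  obtain k :: 'n where True by simp
  obtain \<kappa> where \<kappa>: "\<kappa> < 1" "\<And>i. i \<noteq> k \<Longrightarrow> (LINT \<eta>|lborel. slab k \<eta> * (\<eta> $ i)\<^sup>2) = \<kappa> * (LINT \<eta>|lborel. slab k \<eta>)"
    using slab_moments[of k] by metis
  have "\<exists>A. finite A \<and> zon I z = {x. \<forall>b\<in>A. b \<bullet> x \<le> 1}"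
    by (rule zon_facets[OF I int]) blast
  then obtain A where A: "finite A" "zon I z = {x. \<forall>b\<in>A. b \<bullet> x \<le> 1}"
    by blast
  have main: "(\<forall>j\<in>J. zon_max I z a \<bullet> z j = 0) \<and> (norm (zon_max I z a))\<^sup>2 + \<kappa> * (\<Sum>i\<in>J. (norm (z i))\<^sup>2) = real CARD('n) + 2"
    if J_def: "J = {i \<in> I. a \<bullet> z i = 0}" and li: "lin_indep J z" and cJ: "Suc (card J) = CARD('n)" for a J
  proof -
    have finJ: "finite J" using I by (simp add: J_def)
    define p where "p = zon_max I z a"
    define s where "s = zon_support I z a"
    have "\<exists>i\<in>I. a \<bullet> z i \<noteq> 0"
    proof (rule ccontr)
      assume "\<not> ?thesis"
      then have "J = I" by (auto simp: J_def)
      then have "card (z ` I) < CARD('n)" using cJ finJ card_image_le[of J z] by simp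
      moreover have "dim (span (z ` I)) = CARD('n)" using zon_interior_span[OF int] by simp
      ultimately show False using dim_le_card'[of "z ` I"] I by simp
    qed
    then obtain i0 where i0: "i0 \<in> I" "a \<bullet> z i0 \<noteq> 0" by blast
    have s: "s > 0" unfolding s_def zon_support_def by (rule sum_pos2[OF I i0(1)]) (use i0(2) in auto)
    define a' where "a' = a /\<^sub>R s"
    have a's: "a' \<bullet> x = (a \<bullet> x) / s" for x by (simp add: a'_def divide_inverse mult.commute)
    have a'p: "a' \<bullet> p = 1" unfolding a's p_def zon_max_support s_def[symmetric] using s by simp
    have "card (UNIV - {k}) = card J" using cJ by simp
    then obtain g where g: "bij_betw g (UNIV - {k}) J" using finJ by (metis finite_Diff finite_class.finite_UNIV finite_same_card_bij)
    define L where "L = (\<lambda>\<xi>::real^'n. \<xi> $ k *\<^sub>R p + (\<Sum>i\<in>UNIV - {k}. \<xi> $ i *\<^sub>R z (g i)))"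
    have linL: "linear L"
      unfolding L_def by (intro linearI) (simp_all add: scaleR_add_left sum.distrib scaleR_add_right scaleR_sum_right)
    have gJ: "g i \<in> J" if "i \<noteq> k" for i using bij_betwE[OF g] that by simp
    have a'g: "a' \<bullet> z (g i) = 0" if "i \<noteq> k" for i using gJ[OF that] by (simp add: a's J_def)
    have aL: "a' \<bullet> L \<eta> = \<eta> $ k" for \<eta>
    proof -
      have "a' \<bullet> (\<Sum>i\<in>UNIV - {k}. \<eta> $ i *\<^sub>R z (g i)) = 0"
        unfolding inner_sum_right by (rule sum.neutral) (simp add: a'g)
      then show ?thesis by (simp add: L_def inner_add_right a'p)
    qed
    have lig: "\<forall>i. i \<noteq> k \<longrightarrow> \<xi> i = r (g i)" if "(\<Sum>i\<in>UNIV - {k}. \<xi> i *\<^sub>R z (g i)) = (\<Sum>j\<in>J. r j *\<^sub>R z j)" for \<xi> :: "'n \<Rightarrow> real" and r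
    proof -
      let ?h = "inv_into (UNIV - {k}) g"
      have "(\<Sum>j\<in>J. (\<xi> (?h j) - r j) *\<^sub>R z j) = (\<Sum>j\<in>J. \<xi> (?h j) *\<^sub>R z j) - (\<Sum>j\<in>J. r j *\<^sub>R z j)"
        by (simp add: scaleR_diff_left sum_subtractf)
      also have "(\<Sum>j\<in>J. \<xi> (?h j) *\<^sub>R z j) = (\<Sum>i\<in>UNIV - {k}. \<xi> (?h (g i)) *\<^sub>R z (g i))"
        by (rule sum.reindex_bij_betw[OF g, symmetric])
      also have "\<dots> = (\<Sum>i\<in>UNIV - {k}. \<xi> i *\<^sub>R z (g i))"
        by (rule sum.cong) (use bij_betw_inv_into_left[OF g] in auto)
      finally have "(\<Sum>j\<in>J. (\<xi> (?h j) - r j) *\<^sub>R z j) = 0" using that by simp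
      then have "\<forall>j\<in>J. \<xi> (?h j) - r j = 0"
        using li[unfolded lin_indep_def, THEN spec, of "\<lambda>j. \<xi> (?h j) - r j"] by blast
      then show ?thesis using gJ bij_betw_inv_into_left[OF g] by force
    qed
    have injL: "inj L"
      unfolding linear_injective_0[OF linL]
    proof (intro allI impI)
      fix \<xi> assume 0: "L \<xi> = 0"
      then have k0: "\<xi> $ k = 0" using aL[of \<xi>] by simp
      then have "(\<Sum>i\<in>UNIV - {k}. \<xi> $ i *\<^sub>R z (g i)) = (\<Sum>j\<in>J. 0 *\<^sub>R z j)" using 0 by (simp add: L_def)
      from lig[of "\<lambda>i. \<xi> $ i" "\<lambda>_. 0", OF this] show "\<xi> = 0" using k0 by (metis vec_eq_iff zero_index)
    qed
    have surjL: "surj L" using linear_injective_imp_surjective[OF linL injL] by simp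
    \<comment> \<open>Together with \<open>\<bar>a' \<bullet> x\<bar> \<le> 1\<close> the
      constraints in \<open>B\<close> describe the zonotope, and without \<open>a'\<close> and
      \<open>- a'\<close> they are all slack in the relative interior of the facet.\<close>
    define B where "B = A - {a', - a'}"
    have le1: "b \<bullet> x \<le> 1" "- 1 \<le> b \<bullet> x" if "b \<in> A" "x \<in> zon I z" for b x
    proof -
      show "b \<bullet> x \<le> 1" using that A(2) by auto
      have "- x \<in> zon I z" using that zon_uminus by blast
      then have "b \<bullet> (- x) \<le> 1" using that(1) A(2) by blast
      then show "- 1 \<le> b \<bullet> x" by simp
    qed
    have a1: "a' \<bullet> x \<le> 1" if "x \<in> zon I z" for x
      using zon_le_support[OF that, of a] s by (simp add: a's s_def)
    have Z_iff: "x \<in> zon I z \<longleftrightarrow> \<bar>a' \<bullet> x\<bar> \<le> 1 \<and> (\<forall>b\<in>B. \<bar>b \<bullet> x\<bar> \<le> 1)" for x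
    proof
      assume x: "x \<in> zon I z"
      have "- x \<in> zon I z" using x zon_uminus by blast
      from a1[OF x] a1[OF this] have "\<bar>a' \<bullet> x\<bar> \<le> 1" by simp
      then show "\<bar>a' \<bullet> x\<bar> \<le> 1 \<and> (\<forall>b\<in>B. \<bar>b \<bullet> x\<bar> \<le> 1)" using le1 x by (auto simp: B_def abs_le_iff minus_le_iff)
    next
      assume R: "\<bar>a' \<bullet> x\<bar> \<le> 1 \<and> (\<forall>b\<in>B. \<bar>b \<bullet> x\<bar> \<le> 1)"
      have "b \<bullet> x \<le> 1" if "b \<in> A" for b
      proof (cases "b \<in> B")
        case True then show ?thesis using R by (simp add: abs_le_iff)
      next
        case False
        then have "b = a' \<or> b = - a'" using that by (auto simp: B_def)
        then show ?thesis using R by (auto simp: abs_le_iff)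
      qed
      then show "x \<in> zon I z" using A(2) by blast
    qed
    have face: "L \<eta> \<in> zon I z \<longleftrightarrow> (\<forall>i. i \<noteq> k \<longrightarrow> \<bar>\<eta> $ i\<bar> \<le> 1)" if k1: "\<eta> $ k = 1" for \<eta>
    proof -
      have "a \<bullet> L \<eta> = s" using aL[of \<eta>] k1 s by (simp add: a's)
      then have "L \<eta> \<in> zon I z \<longleftrightarrow> L \<eta> \<in> (\<lambda>x. p + x) ` zon J z"
        using zon_face[OF I, of z a] unfolding s_def p_def J_def by blast
      also have "\<dots> \<longleftrightarrow> (\<Sum>i\<in>UNIV - {k}. \<eta> $ i *\<^sub>R z (g i)) \<in> zon J z"
        using k1 by (auto simp: L_def image_iff)
      also have "\<dots> \<longleftrightarrow> (\<forall>i. i \<noteq> k \<longrightarrow> \<bar>\<eta> $ i\<bar> \<le> 1)"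
      proof
        assume "(\<Sum>i\<in>UNIV - {k}. \<eta> $ i *\<^sub>R z (g i)) \<in> zon J z"
        then obtain r where r: "\<And>j. j \<in> J \<Longrightarrow> \<bar>r j\<bar> \<le> 1" "(\<Sum>i\<in>UNIV - {k}. \<eta> $ i *\<^sub>R z (g i)) = (\<Sum>j\<in>J. r j *\<^sub>R z j)"
          using zonE by blast
        show "\<forall>i. i \<noteq> k \<longrightarrow> \<bar>\<eta> $ i\<bar> \<le> 1" using lig[of "\<lambda>i. \<eta> $ i" r, OF r(2)] r(1) gJ by simp
      next
        assume le: "\<forall>i. i \<noteq> k \<longrightarrow> \<bar>\<eta> $ i\<bar> \<le> 1"
        let ?h = "inv_into (UNIV - {k}) g"
        have "(\<Sum>i\<in>UNIV - {k}. \<eta> $ i *\<^sub>R z (g i)) = (\<Sum>i\<in>UNIV - {k}. \<eta> $ (?h (g i)) *\<^sub>R z (g i))"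
          by (rule sum.cong) (use bij_betw_inv_into_left[OF g] in auto)
        also have "\<dots> = (\<Sum>j\<in>J. \<eta> $ (?h j) *\<^sub>R z j)" by (rule sum.reindex_bij_betw[OF g])
        also have "\<dots> \<in> zon J z"
        proof (rule zonI)
          fix j assume "j \<in> J"
          then have "?h j \<in> UNIV - {k}" using g by (metis bij_betw_def inv_into_into)
          then show "\<bar>\<eta> $ (?h j)\<bar> \<le> 1" using le by simp
        qed
        finally show "(\<Sum>i\<in>UNIV - {k}. \<eta> $ i *\<^sub>R z (g i)) \<in> zon J z" .
      qed
      finally show ?thesis .
    qed
    have Laxis: "L (axis k 1) = p" "i \<noteq> k \<Longrightarrow> L (axis i 1) = z (g i)" for i
      by (auto simp: L_def axis_def if_distrib[of "\<lambda>c. c *\<^sub>R _"] cong: if_cong)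
    interpret facet_variation "zon I z" a' B L k
    proof unfold_locales
      show "convex_body (zon I z)" by (rule convex_body_zon[OF I int])
      show "- x \<in> zon I z \<longleftrightarrow> x \<in> zon I z" for x by (rule zon_uminus)
      show "finite B" using A(1) by (simp add: B_def)
      show "zon I z = {x. \<bar>a' \<bullet> x\<bar> \<le> 1 \<and> (\<forall>b\<in>B. \<bar>b \<bullet> x\<bar> \<le> 1)}" using Z_iff by blast
      show "L (x + y) = L x + L y" for x y by (rule linear_add[OF linL])
      show "L (c *\<^sub>R x) = c *\<^sub>R L x" for c x by (rule linear_scale[OF linL])
      show "inj L" by (rule injL)
      show "a' \<bullet> L \<eta> = \<eta> $ k" for \<eta> by (rule aL)
      show "\<bar>\<eta> $ i\<bar> \<le> 1" if "\<eta> $ k = 1" "L \<eta> \<in> zon I z" "i \<noteq> k" for \<eta> i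
        using face[OF that(1)] that by blast
      show "\<bar>b \<bullet> L \<eta>\<bar> < 1" if k1: "\<eta> $ k = 1" and lt: "\<And>i. i \<noteq> k \<Longrightarrow> \<bar>\<eta> $ i\<bar> < 1" and b: "b \<in> B" for \<eta> b
      proof (rule ccontr)
        assume "\<not> \<bar>b \<bullet> L \<eta>\<bar> < 1"
        then obtain c where c: "c = b \<or> c = - b" "c \<bullet> L \<eta> \<ge> 1" by (metis abs_if inner_minus_left not_less)
        have c1: "c \<bullet> x \<le> 1" if "x \<in> zon I z" for x
          using c(1) le1[of b x] b that by (auto simp: B_def)
        \<comment> \<open>A constraint attaining its bound at a relative interior point must be
          constant along every generator, since one can move both ways from that point. Being
          constant on the facet and normalised to 1 there, it is \<open>a'\<close>, which
          contradicts the choice of \<open>B\<close>.\<close>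
        have cu: "c \<bullet> L (axis i 1) = 0" if i: "i \<noteq> k" for i
        proof -
          define e where "e = 1 - \<bar>\<eta> $ i\<bar>"
          have e: "e > 0" using lt[OF i] by (simp add: e_def)
          have m: "L (\<eta> + t *\<^sub>R axis i 1) \<in> zon I z" if t: "\<bar>t\<bar> \<le> e" for t
          proof -
            have "(\<eta> + t *\<^sub>R axis i 1) $ k = 1" using k1 i by (simp add: axis_def)
            moreover have "\<forall>l. l \<noteq> k \<longrightarrow> \<bar>(\<eta> + t *\<^sub>R axis i 1) $ l\<bar> \<le> 1"
              using lt t by (auto simp: axis_def e_def less_imp_le)
            ultimately show ?thesis using face by blast
          qed
          have "c \<bullet> L \<eta> + t * (c \<bullet> L (axis i 1)) \<le> 1" if "\<bar>t\<bar> \<le> e" for t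
            using c1[OF m[OF that]] by (simp add: linear_add[OF linL] linear_scale[OF linL] inner_add_right)
          from this[of e] this[of "- e"] have "e * (c \<bullet> L (axis i 1)) \<le> 0" "e * (c \<bullet> L (axis i 1)) \<ge> 0" using e c(2) by auto
          then show ?thesis using e by (simp add: mult_le_0_iff zero_le_mult_iff)
        qed
        have cL: "c \<bullet> L \<xi> = (c \<bullet> p) * (a' \<bullet> L \<xi>)" for \<xi>
        proof -
          have "c \<bullet> (\<Sum>i\<in>UNIV - {k}. \<xi> $ i *\<^sub>R z (g i)) = 0"
            unfolding inner_sum_right by (rule sum.neutral) (use cu Laxis(2) in simp)
          then show ?thesis unfolding aL by (simp add: L_def inner_add_right mult.commute)
        qed
        then have "c \<bullet> x = ((c \<bullet> p) *\<^sub>R a') \<bullet> x" for x using surjL by (metis inner_scaleR_left surjD)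
        then have ca: "c = (c \<bullet> p) *\<^sub>R a'" by (metis vector_eq_rdot)
        have "c \<bullet> p \<ge> 1" using cL[of \<eta>] c(2) aL[of \<eta>] k1 by simp
        moreover have "c \<bullet> p \<le> 1" by (rule c1) (simp add: p_def zon_max_in)
        ultimately have "c \<bullet> p = 1" by simp
        with ca have "c = a'" by simp
        then show False using b c(1) by (auto simp: B_def)
      qed
    qed
    have "zon_max I z a \<bullet> z j = 0" if "j \<in> J" for j
    proof -
      obtain i where i: "i \<noteq> k" "g i = j" using g \<open>j \<in> J\<close> by (auto simp: bij_betw_def)
      show ?thesis using facet_center_orthogonal[OF iso lm i(1)] i by (simp add: Laxis p_def)
    qed
    moreover have "(\<Sum>i\<in>UNIV - {k}. (norm (L (axis i 1)))\<^sup>2) = (\<Sum>i\<in>UNIV - {k}. (norm (z (g i)))\<^sup>2)"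
      by (rule sum.cong) (auto simp: Laxis)
    then have "(\<Sum>i\<in>UNIV - {k}. (norm (L (axis i 1)))\<^sup>2) = (\<Sum>i\<in>J. (norm (z i))\<^sup>2)"
      using sum.reindex_bij_betw[OF g, of "\<lambda>i. (norm (z i))\<^sup>2"] by simp
    then have "(norm p)\<^sup>2 + \<kappa> * (\<Sum>i\<in>J. (norm (z i))\<^sup>2) = real CARD('n) + 2"
      using facet_center_norm[OF iso lm \<kappa>(2)] by (simp add: Laxis)
    ultimately show ?thesis by (simp add: p_def)
  qed
  show ?thesis
  proof (rule that[of \<kappa>, OF \<kappa>(1)])
    show "zon_max I z a \<bullet> z j = 0" if "lin_indep {i \<in> I. a \<bullet> z i = 0} z" "Suc (card {i \<in> I. a \<bullet> z i = 0}) = CARD('n)" "j \<in> I" "a \<bullet> z j = 0" for a j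
      using main[OF HOL.refl that(1,2)] that(3,4) by simp
    show "(norm (zon_max I z a))\<^sup>2 + \<kappa> * (\<Sum>i | i \<in> I \<and> a \<bullet> z i = 0. (norm (z i))\<^sup>2) = real CARD('n) + 2"
      if "lin_indep {i \<in> I. a \<bullet> z i = 0} z" "Suc (card {i \<in> I. a \<bullet> z i = 0}) = CARD('n)" for a
      using main[OF HOL.refl that] by simp
  qed
qed

section \<open>Belts\<close>

lemma two_dim_orthogonal:
  fixes U :: "'a::euclidean_space set"
  assumes U: "subspace U" "dim U = 2" and w: "w \<in> U" "w \<noteq> 0" and u: "u \<in> U" "u \<bullet> w = 0" and v: "v \<in> U" "v \<bullet> w = 0" "v \<noteq> 0"
  obtains \<nu> where "u = \<nu> *\<^sub>R v"
proof -
  have ne: "w \<noteq> v" using v(2) w(2) by auto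
  have "independent {w, v}"
    by (rule pairwise_orthogonal_independent)
       (use v w in \<open>auto simp: pairwise_def orthogonal_def inner_commute\<close>)
  then have "U \<subseteq> span {w, v}"
    using card_ge_dim_independent[of "{w, v}" U] w v U(2) ne by simp
  then have "u \<in> span {w, v}" using u by blast
  then obtain \<alpha> \<beta> where "u - \<alpha> *\<^sub>R w = \<beta> *\<^sub>R v" by (auto simp: span_insert span_singleton)
  then have eq: "u = \<alpha> *\<^sub>R w + \<beta> *\<^sub>R v" by (simp add: algebra_simps)
  then have "\<alpha> * (w \<bullet> w) = 0" using u(2) v(2) by (simp add: inner_add_left)
  then have "\<alpha> = 0" using w(2) by simp
  then show ?thesis using eq that[of \<beta>] by simp
qed

text \<open>In the application \<open>p j\<close> and \<open>b j\<close> are the centers of consecutive facets around a belt and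
  their non-common generators.\<close>

lemma belt_sequence_reflection:
  fixes p b :: "nat \<Rightarrow> 'a::euclidean_space" and N i :: nat
  assumes U: "subspace U" "dim U = 2" and pU: "\<And>j. p j \<in> U"
    and step: "\<And>j. p (Suc j) = p j + b j + b (Suc j)"
    and orth: "\<And>j. p j \<bullet> b j = 0"
    and len: "\<And>j. (norm (p j))\<^sup>2 + \<kappa> * (norm (b j))\<^sup>2 = C" and \<kappa>: "\<kappa> < 1"
    and nz: "\<And>j. p j \<noteq> 0" "\<And>j. b j + b (Suc j) \<noteq> 0"
  defines "w \<equiv> b N + b (Suc N)"
  defines "R \<equiv> (\<lambda>x. x - (2 * (x \<bullet> w) / (w \<bullet> w)) *\<^sub>R w)"
  shows "i \<le> N \<Longrightarrow> R (b (Suc N + i)) = - b (N - i)"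
proof -
  \<comment> \<open>\<open>p j + b j = p (Suc j) - b (Suc j)\<close> is the center of the ridge
    common to two consecutive facets. Pythagoras on both sides gives one relation between the
    lengths, \<open>len\<close> another; they are independent because
    \<open>\<kappa> < 1\<close>.\<close>
  have lens: "p (Suc j) \<bullet> p (Suc j) = p j \<bullet> p j \<and> b (Suc j) \<bullet> b (Suc j) = b j \<bullet> b j" for j
  proof -
    have "p (Suc j) - b (Suc j) = p j + b j" using step[of j] by simp
    then have "(p (Suc j) - b (Suc j)) \<bullet> (p (Suc j) - b (Suc j)) = (p j + b j) \<bullet> (p j + b j)" by simp
    moreover have "(p j + b j) \<bullet> (p j + b j) = p j \<bullet> p j + b j \<bullet> b j"
      using orth[of j] inner_commute[of "b j" "p j"] by (simp add: inner_add_left inner_add_right)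
    moreover have "(p (Suc j) - b (Suc j)) \<bullet> (p (Suc j) - b (Suc j)) = p (Suc j) \<bullet> p (Suc j) + b (Suc j) \<bullet> b (Suc j)"
      using orth[of "Suc j"] inner_commute[of "b (Suc j)" "p (Suc j)"] by (simp add: inner_diff_left inner_diff_right)
    ultimately have 1: "p (Suc j) \<bullet> p (Suc j) + b (Suc j) \<bullet> b (Suc j) = p j \<bullet> p j + b j \<bullet> b j" by simp
    have 2: "p (Suc j) \<bullet> p (Suc j) + \<kappa> * (b (Suc j) \<bullet> b (Suc j)) = p j \<bullet> p j + \<kappa> * (b j \<bullet> b j)"
      using len[of j] len[of "Suc j"] by (simp add: power2_norm_eq_inner)
    from 1 2 have "(1 - \<kappa>) * (b (Suc j) \<bullet> b (Suc j) - b j \<bullet> b j) = 0" by (simp add: algebra_simps)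
    then have "b (Suc j) \<bullet> b (Suc j) = b j \<bullet> b j" using \<kappa> by simp
    with 1 show ?thesis by simp
  qed
  define h where "h = p 0 \<bullet> p 0"
  define \<beta> where "\<beta> = b 0 \<bullet> b 0"
  have pp: "p j \<bullet> p j = h" and bb: "b j \<bullet> b j = \<beta>" for j
    by (induction j) (auto simp: h_def \<beta>_def lens)
  have h: "h > 0" using nz(1)[of 0] by (simp add: h_def)
  have sU: "span U = U" using U(1) by simp
  have "\<forall>j. \<exists>ye. fst ye \<in> U \<and> (\<forall>x\<in>U. snd ye \<bullet> x = 0) \<and> b j = fst ye + snd ye"
  proof
    fix j
    obtain y e where "y \<in> span U" "\<And>x. x \<in> span U \<Longrightarrow> orthogonal e x" "b j = y + e"
      using orthogonal_subspace_decomp_exists[of U "b j"] by metis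
    then show "\<exists>ye. fst ye \<in> U \<and> (\<forall>x\<in>U. snd ye \<bullet> x = 0) \<and> b j = fst ye + snd ye"
      unfolding sU orthogonal_def by (intro exI[of _ "(y, e)"]) simp
  qed
  from choice[OF this] obtain f where f: "\<forall>j. fst (f j) \<in> U \<and> (\<forall>x\<in>U. snd (f j) \<bullet> x = 0) \<and> b j = fst (f j) + snd (f j)" ..
  define y e where "y = (\<lambda>j. fst (f j))" and "e = (\<lambda>j. snd (f j))"
  have ye: "\<And>j. y j \<in> U" "\<And>j x. x \<in> U \<Longrightarrow> e j \<bullet> x = 0" "\<And>j. b j = y j + e j"
    using f by (simp_all add: y_def e_def)
  have ux: "x \<bullet> b j = x \<bullet> y j" if "x \<in> U" for x j
    using ye(2)[OF that, of j] by (simp add: ye(3) inner_add_right inner_commute[of x "e j"])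
  have yU: "p j + y j \<in> U" "p j - y j \<in> U" for j using pU ye(1) U(1) by (auto intro: subspace_add subspace_diff)
  \<comment> \<open>Both sides are the component in \<open>U\<close> of the ridge center: their
    difference lies in \<open>U\<close> and is orthogonal to it.\<close>
  have r: "p j + y j = p (Suc j) - y (Suc j)" for j
  proof -
    define d where "d = p j + y j - (p (Suc j) - y (Suc j))"
    have dU: "d \<in> U" unfolding d_def using yU U(1) by (auto intro: subspace_diff)
    have "d = - (e j + e (Suc j))" using step[of j] by (simp add: d_def ye(3))
    then have "d \<bullet> d = - (e j \<bullet> d + e (Suc j) \<bullet> d)" by (metis inner_add_left inner_minus_left)
    then have "d \<bullet> d = 0" by (simp add: ye(2)[OF dU])
    then show ?thesis by (simp add: d_def)
  qed
  have py: "p j \<bullet> y j = 0" for j using orth[of j] ux[OF pU, of j j] by simp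
  have rr: "(p j + y j) \<bullet> (p j + y j) = h + y j \<bullet> y j" for j
    by (simp add: inner_add_left inner_add_right py pp inner_commute[of "y j" "p j"])
  have rr': "(p j - y j) \<bullet> (p j - y j) = h + y j \<bullet> y j" for j
    by (simp add: inner_diff_left inner_diff_right py pp inner_commute[of "y j" "p j"])
  have yy: "y j \<bullet> y j = y 0 \<bullet> y 0" for j
  proof (induction j)
    case (Suc j)
    have "h + y (Suc j) \<bullet> y (Suc j) = h + y j \<bullet> y j"
      using rr[of j] rr'[of "Suc j"] r[of j] by simp
    with Suc show ?case by simp
  qed simp
  \<comment> \<open>In the plane \<open>U\<close> both \<open>p j + p (Suc j)\<close> and
    \<open>p j + y j\<close> are orthogonal to \<open>p (Suc j) - p j\<close>, hence proportional.
    The ratio follows from pairing with \<open>p j + y j\<close>, whose product with either facet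
    center is \<open>h\<close>; it is the same for all \<open>j\<close>.\<close>
  define \<nu> where "\<nu> = 2 * h / (h + y 0 \<bullet> y 0)"
  have hy: "h + y 0 \<bullet> y 0 > 0" using h by (simp add: add_pos_nonneg)
  have sum: "p j + p (Suc j) = \<nu> *\<^sub>R (p j + y j)" for j
  proof -
    let ?w = "p (Suc j) - p j"
    have wU: "?w \<in> U" using pU U(1) by (auto intro: subspace_diff)
    have w0: "?w \<noteq> 0" using nz(2)[of j] step[of j] by (simp add: algebra_simps)
    have s: "p j + p (Suc j) \<in> U" using pU U(1) by (auto intro: subspace_add)
    have sw: "(p j + p (Suc j)) \<bullet> ?w = 0" by (simp add: inner_add_left inner_diff_right pp inner_commute[of "p (Suc j)" "p j"])
    have rp: "(p j + y j) \<bullet> p j = h" by (simp add: inner_add_left pp py inner_commute[of "y j" "p j"])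
    have rp': "(p j + y j) \<bullet> p (Suc j) = h"
      unfolding r by (simp add: inner_diff_left pp py inner_commute[of "y (Suc j)" "p (Suc j)"])
    have rw: "(p j + y j) \<bullet> ?w = 0" by (simp add: inner_diff_right rp rp')
    have r0: "p j + y j \<noteq> 0" using rp h by auto
    obtain n where n: "p j + p (Suc j) = n *\<^sub>R (p j + y j)"
      using two_dim_orthogonal[OF U wU w0 s sw yU(1) rw r0] .
    have "(p j + p (Suc j)) \<bullet> (p j + y j) = 2 * h"
      using rp rp' inner_commute[of "p j" "p j + y j"] inner_commute[of "p (Suc j)" "p j + y j"]
      by (simp only: inner_add_left[of "p j" "p (Suc j)"])
    then have "n * (h + y 0 \<bullet> y 0) = 2 * h" unfolding n by (simp add: rr yy[of j])
    then have "n = \<nu>" using hy by (simp add: \<nu>_def field_simps)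
    with n show ?thesis by simp
  qed
  \<comment> \<open>Adding the relations for \<open>j\<close> and \<open>Suc j\<close> cancels the
    \<open>y\<close> terms. The resulting second-order recurrence with constant coefficient reads
    the same in both directions.\<close>
  define \<mu> where "\<mu> = 2 * \<nu> - 2"
  have rec: "p j + p (Suc (Suc j)) = \<mu> *\<^sub>R p (Suc j)" for j
  proof -
    have "p j + p (Suc j) = \<nu> *\<^sub>R (p (Suc j) - y (Suc j))" using sum[of j] r[of j] by simp
    moreover have "p (Suc j) + p (Suc (Suc j)) = \<nu> *\<^sub>R (p (Suc j) + y (Suc j))" by (rule sum)
    ultimately have "(p j + p (Suc j)) + (p (Suc j) + p (Suc (Suc j))) = \<nu> *\<^sub>R (p (Suc j) - y (Suc j)) + \<nu> *\<^sub>R (p (Suc j) + y (Suc j))"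
      by simp
    also have "\<dots> = (2 * \<nu>) *\<^sub>R p (Suc j)"
    proof -
      have "(2 * \<nu>) *\<^sub>R p (Suc j) = \<nu> *\<^sub>R p (Suc j) + \<nu> *\<^sub>R p (Suc j)" by (metis mult_2 scaleR_add_left)
      then show ?thesis by (simp add: scaleR_diff_right scaleR_add_right)
    qed
    finally have "p j + p (Suc (Suc j)) = (2 * \<nu>) *\<^sub>R p (Suc j) - (p (Suc j) + p (Suc j))"
      by (metis add.assoc add.commute add_diff_cancel_right')
    then show ?thesis by (simp only: \<mu>_def scaleR_diff_left scaleR_2)
  qed
  have ww: "w \<bullet> w > 0" using nz(2)[of N] by (simp add: w_def)
  have linR: "linear R"
    unfolding R_def by (intro linearI)
      (simp_all add: inner_add_left distrib_left add_divide_distrib scaleR_add_left scaleR_diff_right)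
  have wp: "w = p (Suc N) - p N" using step[of N] by (simp add: w_def algebra_simps)
  have "2 * (p (Suc N) \<bullet> w) = w \<bullet> w"
    unfolding wp by (simp add: inner_diff_left inner_diff_right pp inner_commute[of "p (Suc N)" "p N"])
  then have R1: "R (p (Suc N)) = p N" using ww by (simp add: R_def wp)
  have "2 * (p N \<bullet> w) = - (w \<bullet> w)"
    unfolding wp by (simp add: inner_diff_left inner_diff_right pp inner_commute[of "p (Suc N)" "p N"])
  then have R0: "R (p N) = p (Suc N)" using ww by (simp add: R_def wp)
  \<comment> \<open>\<open>R\<close> exchanges \<open>p N\<close> and \<open>p (Suc N)\<close>, and
    the recurrence continues this pair to the right exactly as to the left. The induction uses the
    two preceding cases; for the first step the second of them is \<open>R0\<close>.\<close>
  have Rp: "i \<le> N \<Longrightarrow> R (p (Suc N + i)) = p (N - i)" for i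
  proof (induction i rule: less_induct)
    case (less i)
    show ?case
    proof (cases i)
      case 0 then show ?thesis using R1 by simp
    next
      case (Suc i')
      have a: "p (Suc N + i) = \<mu> *\<^sub>R p (Suc N + i') - p (N + i')"
        using rec[of "N + i'"] Suc by (simp add: algebra_simps)
      have "N - i' = Suc (N - i)" using Suc less.prems by simp
      then have c: "p (N - i) = \<mu> *\<^sub>R p (N - i') - p (Suc (N - i'))"
        using rec[of "N - i"] by (simp add: algebra_simps)
      have IH: "R (p (Suc N + i')) = p (N - i')" using less.IH[of i'] Suc less.prems by simp
      have "R (p (N + i')) = p (Suc (N - i'))"
      proof (cases i')
        case 0 then show ?thesis using R0 by simp
      next
        case (Suc i'')
        have "R (p (Suc N + i'')) = p (N - i'')" using less.IH[of i''] Suc \<open>i = Suc i'\<close> less.prems by simp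
        moreover have "N - i'' = Suc (N - i')" using Suc \<open>i = Suc i'\<close> less.prems by simp
        ultimately show ?thesis using Suc by simp
      qed
      then show ?thesis unfolding a c using IH by (simp add: linear_diff[OF linR] linear_scale[OF linR])
    qed
  qed
  show "i \<le> N \<Longrightarrow> R (b (Suc N + i)) = - b (N - i)"
  proof (induction i)
    case 0
    have "2 * (b (Suc N) \<bullet> w) = w \<bullet> w"
      by (simp add: w_def inner_add_left inner_add_right bb inner_commute[of "b (Suc N)" "b N"])
    then show ?case using ww by (simp add: R_def) (simp add: w_def)
  next
    case (Suc i)
    have a: "b (Suc N + Suc i) = p (Suc N + Suc i) - p (Suc N + i) - b (Suc N + i)"
      using step[of "Suc N + i"] by simp
    have "N - i = Suc (N - Suc i)" using Suc.prems by simp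
    then have c: "- b (N - Suc i) = p (N - Suc i) - p (N - i) + b (N - i)"
      using step[of "N - Suc i"] by (simp add: algebra_simps)
    have "R (b (Suc N + Suc i)) = p (N - Suc i) - p (N - i) - (- b (N - i))"
      unfolding a using Suc Rp[of "Suc i"] Rp[of i] by (simp add: linear_diff[OF linR])
    then show ?case unfolding c by simp
  qed
qed

section \<open>Enumerating the facets of a belt\<close>

lemma lin_indep_card_hyperplane:
  fixes z :: "nat \<Rightarrow> 'a::euclidean_space"
  assumes "finite J" "lin_indep J z" "\<And>j. j \<in> J \<Longrightarrow> a \<bullet> z j = 0" "a \<noteq> 0"
  shows "card J < DIM('a)"
proof -
  note ii = lin_indep_inj_independent[OF assms(1,2)]
  have "card (z ` J) \<le> dim {x. a \<bullet> x = 0}"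
    by (rule independent_card_le_dim[OF _ ii(2)]) (use assms(3) in auto)
  also have "\<dots> < DIM('a)" using assms(4) by (simp add: dim_hyperplane)
  finally show ?thesis by (simp add: card_image[OF ii(1)])
qed

lemma finite_enumerate_increasing:
  fixes f :: "'b \<Rightarrow> 'c::linorder"
  assumes "finite S" "inj_on f S"
  obtains s where "bij_betw s {..<card S} S" "\<And>i j. i < j \<Longrightarrow> j < card S \<Longrightarrow> f (s i) < f (s j)"
proof -
  define xs where "xs = sorted_list_of_set (f ` S)"
  have len: "length xs = card S" and set: "set xs = f ` S" and dist: "distinct xs" and sorted: "sorted_wrt (<) xs"
    using assms by (simp_all add: xs_def card_image strict_sorted_iff)
  define s where "s = (\<lambda>j. inv_into S f (xs ! j))"
  have b1: "bij_betw (\<lambda>j. xs ! j) {..<card S} (f ` S)"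
    using bij_betw_nth[OF dist] len set by auto
  have b2: "bij_betw (inv_into S f) (f ` S) S"
    by (rule bij_betw_inv_into) (simp add: assms(2) inj_on_imp_bij_betw)
  have "bij_betw s {..<card S} S"
    using bij_betw_trans[OF b1 b2] by (simp add: s_def comp_def)
  moreover have "f (s i) < f (s j)" if "i < j" "j < card S" for i j
  proof -
    have "xs ! i \<in> f ` S" "xs ! j \<in> f ` S" using that len set by (metis nth_mem order_less_trans)+
    moreover have "xs ! i < xs ! j" using sorted that len by (simp add: sorted_wrt_nth_less)
    ultimately show ?thesis by (simp add: s_def f_inv_into_f)
  qed
  ultimately show ?thesis by (rule that)
qed

text \<open>\<open>E\<close> determines a belt of parallelepiped facets, with normals in the plane spanned by \<open>q1\<close>
  and \<open>q2\<close>. Sorting the remaining generators by slope in this plane enumerates the facets.\<close>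

lemma belt_reflection:
  fixes z :: "nat \<Rightarrow> real^'n::finite"
  assumes I: "finite I" and int: "interior (zon I z) \<noteq> {}"
    and iso: "isotropic (zon I z)"
    and lm: "local_maximizer_isotropic_constant {K. convex_body K \<and> centrally_symmetric K} (zon I z)"
    and E: "E \<subseteq> I" "card E + 2 = CARD('n)"
    and cub: "\<And>a. a \<noteq> 0 \<Longrightarrow> (\<And>e. e \<in> E \<Longrightarrow> a \<bullet> z e = 0) \<Longrightarrow> lin_indep {i \<in> I. a \<bullet> z i = 0} z"
    and big: "CARD('n) < card I"
    and q: "\<And>e. e \<in> E \<Longrightarrow> q1 \<bullet> z e = 0" "\<And>e. e \<in> E \<Longrightarrow> q2 \<bullet> z e = 0"
      "\<And>a. (\<And>e. e \<in> E \<Longrightarrow> a \<bullet> z e = 0) \<Longrightarrow> \<exists>\<alpha> \<beta>. a = \<alpha> *\<^sub>R q1 + \<beta> *\<^sub>R q2"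
      "\<And>\<alpha> \<beta>. \<alpha> *\<^sub>R q1 + \<beta> *\<^sub>R q2 = 0 \<Longrightarrow> \<alpha> = 0 \<and> \<beta> = 0"
    and pos: "\<And>l. l \<in> I - E \<Longrightarrow> q1 \<bullet> z l > 0"
  shows "\<exists>w s0 s1 s2. norm w = 1 \<and> (\<forall>e\<in>E. w \<bullet> z e = 0) \<and> {s0, s1, s2} \<subseteq> I - E \<and> s0 \<noteq> s1 \<and> s0 \<noteq> s2 \<and> s1 \<noteq> s2 \<and>
    w \<in> span {z s0 + z s1} \<and>
    (\<forall>i\<in>I. \<exists>i'\<in>I. \<exists>\<epsilon>. \<bar>\<epsilon>\<bar> = 1 \<and> z i - (2 * (z i \<bullet> w)) *\<^sub>R w = \<epsilon> *\<^sub>R z i') \<and>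
    z s0 - (2 * (z s0 \<bullet> w)) *\<^sub>R w = - z s1 \<and> z s1 - (2 * (z s1 \<bullet> w)) *\<^sub>R w = - z s0 \<and>
    (\<forall>v. (\<forall>e\<in>E. v \<bullet> z e = 0) \<longrightarrow> v \<bullet> w = 0 \<longrightarrow> v \<bullet> z s2 = 0 \<longrightarrow> v = 0)"
proof -
  define O' where "O' = I - E"
  define k where "k = card O'"
  have finE: "finite E" and finO: "finite O'" using I E finite_subset by (auto simp: O'_def)
  have k3: "k \<ge> 3" using card_Diff_subset[OF finE E(1)] E(2) big by (simp add: k_def O'_def)
  define x where "x = (\<lambda>l. q1 \<bullet> z l)"
  define y where "y = (\<lambda>l. q2 \<bullet> z l)"
  have xpos: "x l > 0" if "l \<in> O'" for l using pos that by (simp add: x_def O'_def)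
  \<comment> \<open>Up to a factor the only functional in the plane of \<open>q1\<close> and
    \<open>q2\<close> that vanishes at \<open>z l\<close>, namely the normal of the belt facet
    generated by \<open>E\<close> and \<open>l\<close>.\<close>
  define nrm where "nrm = (\<lambda>l. x l *\<^sub>R q2 - y l *\<^sub>R q1)"
  have nrm_E: "nrm l \<bullet> z e = 0" if "e \<in> E" for l e using q(1,2)[OF that] by (simp add: nrm_def inner_diff_left)
  have nrm_z: "nrm l \<bullet> z m = x l * y m - y l * x m" for l m by (simp add: nrm_def inner_diff_left x_def y_def)
  have nrm0: "nrm l \<noteq> 0" if "l \<in> O'" for l
  proof
    assume "nrm l = 0"
    then have "(- y l) *\<^sub>R q1 + x l *\<^sub>R q2 = 0" by (simp add: nrm_def)
    from q(4)[OF this] show False using xpos[OF that] by simp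
  qed
  \<comment> \<open>Otherwise \<open>E\<close>, \<open>l\<close> and \<open>m\<close> would be
    \<open>n\<close> independent generators in one hyperplane. So all slopes are distinct, and each
    belt facet has exactly one generator besides \<open>E\<close>.\<close>
  have cross: "x l * y m - y l * x m \<noteq> 0" if "l \<in> O'" "m \<in> O'" "l \<noteq> m" for l m
  proof
    assume 0: "x l * y m - y l * x m = 0"
    let ?J = "{i \<in> I. nrm l \<bullet> z i = 0}"
    have "lin_indep ?J z" by (rule cub[OF nrm0[OF that(1)] nrm_E])
    then have "card ?J < DIM(real^'n)"
      by (rule lin_indep_card_hyperplane[rotated]) (use I nrm0[OF that(1)] in simp_all)
    then have "card ?J < CARD('n)" by simp
    moreover have "insert l (insert m E) \<subseteq> ?J"
    proof -
      have "l \<in> I" "m \<in> I" using that by (simp_all add: O'_def)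
      moreover have "nrm l \<bullet> z l = 0" "nrm l \<bullet> z m = 0" using 0 by (simp_all add: nrm_z)
      ultimately show ?thesis using E(1) nrm_E by blast
    qed
    then have "card (insert l (insert m E)) \<le> card ?J" by (rule card_mono[rotated]) (use I in simp)
    moreover have "l \<notin> insert m E" "m \<notin> E" using that by (simp_all add: O'_def)
    then have "card (insert l (insert m E)) = CARD('n)" using finE E(2) by simp
    ultimately show False by linarith
  qed
  have inj: "inj_on (\<lambda>l. y l / x l) O'"
  proof (rule inj_onI, rule ccontr)
    fix l m assume lm': "l \<in> O'" "m \<in> O'" "y l / x l = y m / x m" "l \<noteq> m"
    have "x l \<noteq> 0" "x m \<noteq> 0" using xpos[OF lm'(1)] xpos[OF lm'(2)] by auto
    then have "y l * x m = y m * x l" using lm'(3) by (simp add: frac_eq_eq)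
    then show False using cross[OF lm'(1,2,4)] by (simp add: mult.commute)
  qed
  have "\<exists>s. bij_betw s {..<k} O' \<and> (\<forall>i j. i < j \<longrightarrow> j < k \<longrightarrow> y (s i) / x (s i) < y (s j) / x (s j))"
    unfolding k_def by (rule finite_enumerate_increasing[OF finO inj]) blast
  then obtain s where s: "bij_betw s {..<k} O'" "\<And>i j. i < j \<Longrightarrow> j < k \<Longrightarrow> y (s i) / x (s i) < y (s j) / x (s j)"
    by blast
  have sO: "s j \<in> O'" if "j < k" for j using bij_betwE[OF s(1)] that by simp
  have s_inj: "s i = s j \<longleftrightarrow> i = j" if "i < k" "j < k" for i j
    using s(1) that by (auto simp: bij_betw_def inj_on_def)
  have sign1: "x (s i) * y (s j) - y (s i) * x (s j) > 0" if "i < j" "j < k" for i j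
  proof -
    have p: "x (s i) > 0" "x (s j) > 0" using xpos sO that by auto
    then have "y (s i) / x (s i) * (x (s i) * x (s j)) < y (s j) / x (s j) * (x (s i) * x (s j))"
      using s(2)[OF that] by (intro mult_strict_right_mono) auto
    then show ?thesis using p by (simp add: mult.commute)
  qed
  have sgn_n: "sgn (nrm (s j) \<bullet> z (s l)) = (if l < j then -1 else if l = j then 0 else 1)" if "j < k" "l < k" for j l
  proof (cases l j rule: linorder_cases)
    case less
    then have "nrm (s j) \<bullet> z (s l) < 0" using sign1[of l j] that by (simp add: nrm_z mult.commute)
    then show ?thesis using less by simp
  next
    case equal
    then show ?thesis by (simp add: nrm_z)
  next
    case greater
    then have "nrm (s j) \<bullet> z (s l) > 0" using sign1[of j l] that by (simp add: nrm_z)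
    then show ?thesis using greater by simp
  qed
  have Jn: "{i \<in> I. nrm (s j) \<bullet> z i = 0} = insert (s j) E" if j: "j < k" for j
  proof -
    have "nrm (s j) \<bullet> z i \<noteq> 0" if i: "i \<in> I" "i \<notin> E" "i \<noteq> s j" for i
      using cross[OF sO[OF j], of i] i by (simp add: nrm_z O'_def)
    then show ?thesis using E(1) nrm_E sO[OF j] by (auto simp: O'_def nrm_z)
  qed
  have "\<exists>\<kappa><1. \<forall>a. lin_indep {i \<in> I. a \<bullet> z i = 0} z \<longrightarrow> Suc (card {i \<in> I. a \<bullet> z i = 0}) = CARD('n) \<longrightarrow>
      (\<forall>j\<in>I. a \<bullet> z j = 0 \<longrightarrow> zon_max I z a \<bullet> z j = 0) \<and>
      (norm (zon_max I z a))\<^sup>2 + \<kappa> * (\<Sum>i | i \<in> I \<and> a \<bullet> z i = 0. (norm (z i))\<^sup>2) = real CARD('n) + 2"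
    by (rule zon_facet_center[OF I int iso lm]) blast
  then obtain \<kappa> where \<kappa>: "\<kappa> < 1" and \<kappa>': "\<forall>a. lin_indep {i \<in> I. a \<bullet> z i = 0} z \<longrightarrow> Suc (card {i \<in> I. a \<bullet> z i = 0}) = CARD('n) \<longrightarrow>
      (\<forall>j\<in>I. a \<bullet> z j = 0 \<longrightarrow> zon_max I z a \<bullet> z j = 0) \<and>
      (norm (zon_max I z a))\<^sup>2 + \<kappa> * (\<Sum>i | i \<in> I \<and> a \<bullet> z i = 0. (norm (z i))\<^sup>2) = real CARD('n) + 2"
    by blast
  \<comment> \<open>The sign is opposite to that of \<open>nrm (s j) \<bullet> z (s l)\<close>, so
    \<open>P j\<close> is the center of the facet with normal \<open>- nrm (s j)\<close>. With this
    choice, passing from \<open>j\<close> to \<open>Suc j\<close> adds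
    \<open>z (s j) + z (s (Suc j))\<close>.\<close>
  define c where "c = (\<lambda>(j::nat) (l::nat). if l < j then 1 else if l = j then 0 else (-1::real))"
  define P where "P = (\<lambda>j. \<Sum>l<k. c j l *\<^sub>R z (s l))"
  have Pmax: "P j = - zon_max I z (nrm (s j))" if j: "j < k" for j
  proof -
    have "zon_max I z (nrm (s j)) = (\<Sum>i\<in>O'. sgn (nrm (s j) \<bullet> z i) *\<^sub>R z i)"
      unfolding zon_max_def by (rule sum.mono_neutral_right) (use I nrm_E in \<open>auto simp: O'_def\<close>)
    also have "\<dots> = (\<Sum>l<k. sgn (nrm (s j) \<bullet> z (s l)) *\<^sub>R z (s l))"
      by (rule sum.reindex_bij_betw[OF s(1), symmetric])
    also have "\<dots> = (\<Sum>l<k. - (c j l *\<^sub>R z (s l)))"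
      by (rule sum.cong) (auto simp: sgn_n[OF j] c_def)
    finally show ?thesis by (simp add: P_def sum_negf)
  qed
  have liJ: "lin_indep {i \<in> I. nrm (s j) \<bullet> z i = 0} z" if "j < k" for j
    by (rule cub[OF nrm0[OF sO[OF that]] nrm_E])
  have cardJ: "Suc (card {i \<in> I. nrm (s j) \<bullet> z i = 0}) = CARD('n)" if "j < k" for j
    using Jn[OF that] sO[OF that] finE E(2) by (simp add: O'_def)
  have P_orth: "P j \<bullet> z i = 0" if j: "j < k" and i: "i \<in> insert (s j) E" for i j
  proof -
    have "i \<in> {i \<in> I. nrm (s j) \<bullet> z i = 0}" using i Jn[OF j] by simp
    then have "zon_max I z (nrm (s j)) \<bullet> z i = 0" using \<kappa>' liJ[OF j] cardJ[OF j] by blast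
    then show ?thesis by (simp add: Pmax[OF j])
  qed
  \<comment> \<open>The generators in \<open>E\<close> belong to every facet of the belt, so their
    share of the length condition moves into the constant.\<close>
  define C where "C = real CARD('n) + 2 - \<kappa> * (\<Sum>e\<in>E. (norm (z e))\<^sup>2)"
  have P_len: "(norm (P j))\<^sup>2 + \<kappa> * (norm (z (s j)))\<^sup>2 = C" if j: "j < k" for j
  proof -
    have "(\<Sum>i | i \<in> I \<and> nrm (s j) \<bullet> z i = 0. (norm (z i))\<^sup>2) = (norm (z (s j)))\<^sup>2 + (\<Sum>e\<in>E. (norm (z e))\<^sup>2)"
      unfolding Jn[OF j] using finE sO[OF j] by (simp add: O'_def)
    moreover have "(norm (zon_max I z (nrm (s j))))\<^sup>2 + \<kappa> * (\<Sum>i | i \<in> I \<and> nrm (s j) \<bullet> z i = 0. (norm (z i))\<^sup>2) = real CARD('n) + 2"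
      using \<kappa>' liJ[OF j] cardJ[OF j] by blast
    ultimately show ?thesis by (simp add: Pmax[OF j] C_def distrib_left)
  qed
  have P0: "P j \<noteq> 0" if j: "j < k" for j
  proof
    assume "P j = 0"
    then have "zon_support I z (nrm (s j)) = 0"
      using zon_max_support[of "nrm (s j)" I z] Pmax[OF j] by simp
    then have all0: "\<forall>i\<in>I. nrm (s j) \<bullet> z i = 0"
      unfolding zon_support_def using I by (simp add: sum_nonneg_eq_0_iff)
    obtain l where l: "l < k" "l \<noteq> j" 
    proof (cases "j = 0")
      case True then show ?thesis using k3 that[of 1] by simp
    next
      case False then show ?thesis using k3 that[of 0] by simp
    qed
    have "nrm (s j) \<bullet> z (s l) = 0" using all0 sO[OF l(1)] by (simp add: O'_def)
    then show False using sgn_n[OF j l(1)] l(2) by (simp split: if_splits)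
  qed
  have P_step: "P (Suc j) = P j + z (s j) + z (s (Suc j))" if "Suc j < k" for j
  proof -
    have "P (Suc j) = (\<Sum>l<k. c j l *\<^sub>R z (s l) + (if l = j then z (s l) else 0) + (if l = Suc j then z (s l) else 0))"
      unfolding P_def by (rule sum.cong) (auto simp: c_def)
    also have "\<dots> = P j + z (s j) + z (s (Suc j))"
      using that by (simp add: sum.distrib P_def)
    finally show ?thesis .
  qed
  \<comment> \<open>After half a turn the belt arrives at the facet opposite to the first one, and
    \<open>z (s 0)\<close> reappears with the other sign.\<close>
  have P_wrap: "- P 0 = P (k - 1) + z (s (k - 1)) - z (s 0)"
  proof -
    have "- P 0 = (\<Sum>l<k. c (k - 1) l *\<^sub>R z (s l) + (if l = k - 1 then z (s l) else 0) - (if l = 0 then z (s l) else 0))"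
      unfolding P_def sum_negf[symmetric] by (rule sum.cong) (use k3 in \<open>auto simp: c_def\<close>)
    also have "\<dots> = P (k - 1) + z (s (k - 1)) - z (s 0)"
      using k3 by (simp add: sum.distrib sum_subtractf P_def)
    finally show ?thesis .
  qed
  \<comment> \<open>The sequence is continued around the belt indefinitely, changing sign after
    every \<open>k\<close> facets.\<close>
  define sg where "sg = (\<lambda>d::nat. if even d then 1 else (-1::real))"
  have sgS: "sg (Suc d) = - sg d" and sg1: "\<bar>sg d\<bar> = 1" and sg0: "sg d \<noteq> 0" for d by (auto simp: sg_def)
  define p where "p = (\<lambda>j. sg (j div k) *\<^sub>R P (j mod k))"
  define b where "b = (\<lambda>j. sg (j div k) *\<^sub>R z (s (j mod k)))"
  have modk: "j mod k < k" for j using k3 by simp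
  define U where "U = {v. \<forall>e\<in>E. v \<bullet> z e = 0}"
  have subU: "subspace U" by (auto simp: U_def subspace_def inner_add_left)
  have U_span: "U = span {q1, q2}"
  proof
    show "U \<subseteq> span {q1, q2}"
    proof
      fix v assume "v \<in> U"
      then obtain \<alpha> \<beta> where "v = \<alpha> *\<^sub>R q1 + \<beta> *\<^sub>R q2" using q(3)[of v] by (auto simp: U_def)
      then show "v \<in> span {q1, q2}" by (auto intro: span_add span_mul span_base)
    qed
    show "span {q1, q2} \<subseteq> U" by (rule span_minimal[OF _ subU]) (use q(1,2) in \<open>auto simp: U_def\<close>)
  qed
  have q12: "q1 \<noteq> q2" using q(4)[of 1 "-1"] by auto
  have "independent {q1, q2}"
  proof (rule independent_if_scalars_zero)
    fix f v assume f: "(\<Sum>v\<in>{q1, q2}. f v *\<^sub>R v) = 0" "v \<in> {q1, q2}"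
    then have "f q1 *\<^sub>R q1 + f q2 *\<^sub>R q2 = 0" using q12 by simp
    then show "f v = 0" using q(4)[of "f q1" "f q2"] f(2) by auto
  qed simp
  then have dimU: "dim U = 2" unfolding U_span using q12 by (simp add: dim_eq_card_independent)
  have pU: "p j \<in> U" for j using P_orth[OF modk] by (simp add: p_def U_def)
  have step: "p (Suc j) = p j + b j + b (Suc j)" for j
  proof (cases "Suc (j mod k) < k")
    case True
    then have m: "Suc j mod k = Suc (j mod k)" "Suc j div k = j div k" by (simp_all add: mod_Suc div_Suc)
    show ?thesis unfolding p_def b_def m P_step[OF True] by (simp add: scaleR_add_right)
  next
    case False
    then have e: "Suc (j mod k) = k" using modk[of j] by simp
    then have m: "Suc j mod k = 0" "Suc j div k = Suc (j div k)" "j mod k = k - 1" by (simp_all add: mod_Suc div_Suc)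
    have "p (Suc j) = sg (j div k) *\<^sub>R (- P 0)" unfolding p_def m sgS by simp
    also have "\<dots> = p j + b j + b (Suc j)" unfolding P_wrap p_def b_def m sgS
      by (simp add: scaleR_add_right scaleR_diff_right)
    finally show ?thesis .
  qed
  have orth: "p j \<bullet> b j = 0" for j using P_orth[OF modk, of "s (j mod k)" j] by (simp add: p_def b_def)
  have len: "(norm (p j))\<^sup>2 + \<kappa> * (norm (b j))\<^sup>2 = C" for j
    using P_len[OF modk, of j] by (simp add: p_def b_def sg1)
  have p0: "p j \<noteq> 0" for j using P0[OF modk] sg0 by (simp add: p_def)
  have b0: "b j + b (Suc j) \<noteq> 0" for j
  proof
    assume 0: "b j + b (Suc j) = 0"
    let ?l = "s (j mod k)" and ?m = "s (Suc j mod k)"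
    have ne: "?l \<noteq> ?m"
      using s_inj[OF modk modk, of j "Suc j"] k3 by (auto simp: mod_Suc split: if_splits)
    have "z ?m = (- (sg (j div k) / sg (Suc j div k))) *\<^sub>R z ?l"
    proof -
      have "sg (Suc j div k) *\<^sub>R z ?m = - (sg (j div k) *\<^sub>R z ?l)" using 0 by (simp add: b_def eq_neg_iff_add_eq_0 add.commute)
      then have "inverse (sg (Suc j div k)) *\<^sub>R (sg (Suc j div k) *\<^sub>R z ?m) = inverse (sg (Suc j div k)) *\<^sub>R (- (sg (j div k) *\<^sub>R z ?l))" by simp
      then show ?thesis using sg0 by (simp add: divide_inverse mult.commute)
    qed
    then have "x ?m = (- (sg (j div k) / sg (Suc j div k))) * x ?l" "y ?m = (- (sg (j div k) / sg (Suc j div k))) * y ?l"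
      by (simp_all add: x_def y_def)
    then show False using cross[OF sO[OF modk] sO[OF modk] ne] by simp
  qed
  \<comment> \<open>The base index is \<open>k\<close> rather than 0: reversal about it reaches down
    to index 0, so each of the \<open>k\<close> generators occurs as some \<open>b (k - i)\<close>.
    Up to sign, \<open>w0\<close> is \<open>z (s 0) + z (s 1)\<close>.\<close>
  define w0 where "w0 = b k + b (Suc k)"
  define R where "R = (\<lambda>x. x - (2 * (x \<bullet> w0) / (w0 \<bullet> w0)) *\<^sub>R w0)"
  have Rb: "i \<le> k \<Longrightarrow> R (b (Suc k + i)) = - b (k - i)" for i
    unfolding R_def w0_def
    by (rule belt_sequence_reflection[where p = p and b = b and U = U and \<kappa> = \<kappa> and C = C and N = k, OF subU dimU pU step orth len \<kappa> p0 b0])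
  have w00: "w0 \<noteq> 0" using b0 by (simp add: w0_def)
  have "Suc k mod k = 1" "Suc k div k = 1" "k div k = 1" "k mod k = 0" using k3 by (simp_all add: mod_Suc div_Suc)
  then have bk: "b k = - z (s 0)" "b (Suc k) = - z (s 1)" by (simp_all add: b_def sg_def)
  define w where "w = w0 /\<^sub>R norm w0"
  have nw: "norm w = 1" using w00 by (simp add: w_def)
  have Rw: "R v = v - (2 * (v \<bullet> w)) *\<^sub>R w" for v
    using w00 by (simp add: R_def w_def power2_norm_eq_inner[symmetric] power2_eq_square divide_inverse mult_ac)
  have RR: "R (R v) = v" for v
    unfolding Rw using nw by (simp add: inner_diff_left norm_eq_1)
  have linR: "R (- v) = - R v" for v by (simp add: R_def)
  have w0U: "w0 \<in> U"
  proof -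
    have "w0 = p (Suc k) - p k" using step[of k] by (simp add: w0_def)
    then show ?thesis using pU subU by (auto intro: subspace_diff)
  qed
  have wE: "w \<bullet> z e = 0" if "e \<in> E" for e using w0U that by (simp add: w_def U_def)
  have perm: "\<exists>i'\<in>I. \<exists>\<epsilon>. \<bar>\<epsilon>\<bar> = 1 \<and> R (z i) = \<epsilon> *\<^sub>R z i'" if i: "i \<in> I" for i
  proof (cases "i \<in> E")
    case True
    then have "R (z i) = 1 *\<^sub>R z i" using wE[OF True] by (simp add: Rw inner_commute)
    then show ?thesis using i by (intro bexI[of _ i] exI[of _ 1]) auto
  next
    case False
    then have "i \<in> O'" using i by (simp add: O'_def)
    then obtain j where j: "j < k" "s j = i" using s(1) by (auto simp: bij_betw_def)
    have bj: "b j = z i" using j by (simp add: b_def sg_def)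
    have "R (b (Suc k + (k - j))) = - b (k - (k - j))" by (rule Rb) simp
    then have "R (b (Suc k + (k - j))) = - z i" using j(1) bj by simp
    then have "R (- z i) = b (Suc k + (k - j))" using RR by metis
    then have "R (z i) = - b (Suc k + (k - j))" unfolding linR by (metis minus_minus)
    then have "R (z i) = (- sg ((Suc k + (k - j)) div k)) *\<^sub>R z (s ((Suc k + (k - j)) mod k))" by (simp add: b_def)
    moreover have "s ((Suc k + (k - j)) mod k) \<in> I" using sO[OF modk] by (simp add: O'_def)
    ultimately show ?thesis using sg1 by (intro bexI[of _ "s ((Suc k + (k - j)) mod k)"] exI[of _ "- sg ((Suc k + (k - j)) div k)"]) auto
  qed
  have "R (b (Suc k + 0)) = - b (k - 0)" by (rule Rb) simp
  then have R1: "R (z (s 1)) = - z (s 0)" using bk linR[of "z (s 1)"] by simp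
  have "R (R (z (s 1))) = z (s 1)" by (rule RR)
  then have "- R (z (s 0)) = z (s 1)" unfolding R1 linR .
  then have R0: "R (z (s 0)) = - z (s 1)" by (metis minus_minus)
  have wspan: "w \<in> span {z (s 0) + z (s 1)}"
  proof -
    have "w = (- inverse (norm w0)) *\<^sub>R (z (s 0) + z (s 1))"
      by (simp add: w_def w0_def bk scaleR_add_right scaleR_diff_right)
    then show ?thesis by (metis span_base span_mul singletonI)
  qed
  \<comment> \<open>Orthogonality to \<open>E\<close> and \<open>z (s 2)\<close> makes
    \<open>v\<close> a multiple of \<open>nrm (s 2)\<close>. That normal is negative on both
    \<open>z (s 0)\<close> and \<open>z (s 1)\<close>, hence not orthogonal to
    \<open>w\<close>.\<close>
  have last: "v = 0" if v: "\<forall>e\<in>E. v \<bullet> z e = 0" "v \<bullet> w = 0" "v \<bullet> z (s 2) = 0" for v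
  proof -
    obtain \<alpha> \<beta> where ab: "v = \<alpha> *\<^sub>R q1 + \<beta> *\<^sub>R q2" using q(3)[of v] v(1) by blast
    have k2: "2 < k" using k3 by simp
    have e: "\<alpha> * x (s 2) + \<beta> * y (s 2) = 0" using v(3) by (simp add: ab inner_add_left x_def y_def)
    have "x (s 2) *\<^sub>R v = \<beta> *\<^sub>R nrm (s 2)"
    proof -
      have "x (s 2) * \<alpha> = - (\<beta> * y (s 2))" using e by (simp add: algebra_simps)
      then have "(x (s 2) * \<alpha>) *\<^sub>R q1 = - ((\<beta> * y (s 2)) *\<^sub>R q1)" by simp
      then show ?thesis by (simp add: ab nrm_def scaleR_add_right scaleR_diff_right mult.commute)
    qed
    moreover have "v \<bullet> (z (s 0) + z (s 1)) = 0"
    proof -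
      have "w0 = - (z (s 0) + z (s 1))" by (simp add: w0_def bk)
      moreover have "v \<bullet> w0 = 0" using v(2) w00 by (simp add: w_def)
      ultimately show ?thesis by (metis inner_minus_right neg_equal_0_iff_equal)
    qed
    ultimately have "(\<beta> *\<^sub>R nrm (s 2)) \<bullet> (z (s 0) + z (s 1)) = 0" by (metis inner_scaleR_left mult_zero_right)
    then have "\<beta> * (nrm (s 2) \<bullet> (z (s 0) + z (s 1))) = 0" unfolding inner_scaleR_left .
    moreover have "nrm (s 2) \<bullet> (z (s 0) + z (s 1)) < 0"
    proof -
      have "nrm (s 2) \<bullet> z (s j) < 0" if "j < 2" for j
        using sign1[OF that k2] nrm_z[of "s 2" "s j"] by (simp add: mult.commute)
      from this[of 0] this[of 1] show ?thesis unfolding inner_add_right by linarith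
    qed
    ultimately have "\<beta> = 0" by simp
    with e xpos[OF sO[OF k2]] have "\<alpha> = 0" by simp
    with \<open>\<beta> = 0\<close> ab show "v = 0" by simp
  qed
  have k012: "0 < k" "1 < k" "2 < k" using k3 by auto
  have sub: "{s 0, s 1, s 2} \<subseteq> I - E" using sO[OF k012(1)] sO[OF k012(2)] sO[OF k012(3)] unfolding O'_def by blast
  have ne: "s 0 \<noteq> s 1" "s 0 \<noteq> s 2" "s 1 \<noteq> s 2" using s_inj k012 by auto
  have wE': "\<forall>e\<in>E. w \<bullet> z e = 0" using wE by blast
  have perm': "\<forall>i\<in>I. \<exists>i'\<in>I. \<exists>\<epsilon>. \<bar>\<epsilon>\<bar> = 1 \<and> z i - (2 * (z i \<bullet> w)) *\<^sub>R w = \<epsilon> *\<^sub>R z i'"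
    using perm unfolding Rw by blast
  have last': "\<forall>v. (\<forall>e\<in>E. v \<bullet> z e = 0) \<longrightarrow> v \<bullet> w = 0 \<longrightarrow> v \<bullet> z (s 2) = 0 \<longrightarrow> v = 0"
    using last by blast
  show ?thesis
    by (intro exI conjI, rule nw, rule wE', rule sub, rule ne(1), rule ne(2), rule ne(3), rule wspan, rule perm',
      rule R0[unfolded Rw], rule R1[unfolded Rw], rule last')
qed

section \<open>Excluding more generators than dimensions\<close>

lemma lin_indep_scale:
  assumes "lin_indep J z" "\<And>i. i \<in> J \<Longrightarrow> \<sigma> i \<noteq> 0"
  shows "lin_indep J (\<lambda>i. \<sigma> i *\<^sub>R z i)"
  unfolding lin_indep_def
proof (intro allI impI ballI)
  fix u i assume u: "(\<Sum>i\<in>J. u i *\<^sub>R \<sigma> i *\<^sub>R z i) = 0" and i: "i \<in> J"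
  have "(\<Sum>i\<in>J. (u i * \<sigma> i) *\<^sub>R z i) = 0" using u by simp
  then have "\<forall>i\<in>J. u i * \<sigma> i = 0"
    using assms(1)[unfolded lin_indep_def, THEN spec, of "\<lambda>i. u i * \<sigma> i"] by blast
  then have "u i * \<sigma> i = 0" using i by blast
  then show "u i = 0" using assms(2)[OF i] by (metis mult_eq_0_iff)
qed

lemma lin_indep_pair:
  assumes "z i \<notin> span {z j}" "z j \<noteq> 0"
  shows "lin_indep {i, j} z"
proof (rule lin_indepI)
  have ne: "z i \<noteq> z j" using assms(1) by (auto simp: span_base)
  show "inj_on z {i, j}" using ne by auto
  show "independent (z ` {i, j})" using assms ne by (simp add: independent_insert)
qed simp

text \<open>Any prescribed values on an independent family are attained. As \<open>b\<close>
  vanishes on the family but not at \<open>w\<close>, subtracting a multiple of \<open>b\<close>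
  corrects the value at \<open>w\<close>. This is how independent facet generators admit a
  movement.\<close>

lemma functional_vanishing:
  fixes z :: "nat \<Rightarrow> 'a::euclidean_space"
  assumes "finite J" "lin_indep J z" "\<And>j. j \<in> J \<Longrightarrow> b \<bullet> z j = 0" "b \<bullet> w \<noteq> 0"
  shows "\<exists>a. a \<bullet> w = 0 \<and> (\<forall>j\<in>J. a \<bullet> z j = t j)"
proof -
  have "\<exists>a0. \<forall>j\<in>J. a0 \<bullet> z j = t j"
    by (rule lin_indep_functional[OF assms(1,2), of t]) blast
  then obtain a0 where a0: "\<forall>j\<in>J. a0 \<bullet> z j = t j" by blast
  show ?thesis
    by (rule exI[of _ "a0 - ((a0 \<bullet> w) / (b \<bullet> w)) *\<^sub>R b"])
      (use a0 assms(3,4) in \<open>simp add: inner_diff_left\<close>)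
qed

text \<open>If the generators other than \<open>z k\<close> span, moving \<open>z k\<close> alone is compatible with the
  reflection. Otherwise every facet transversal to \<open>w\<close> has independent generators, and one moves
  \<open>z s0\<close> and \<open>z s1\<close> oppositely. Neither movement is linear.\<close>

lemma belt_contradiction:
  fixes z :: "nat \<Rightarrow> real^'n::finite"
  assumes I: "finite I" and int: "interior (zon I z) \<noteq> {}"
    and iso: "isotropic (zon I z)"
    and lm: "local_maximizer_isotropic_constant {K. convex_body K \<and> centrally_symmetric K} (zon I z)"
    and np: "\<And>i j. i \<in> I \<Longrightarrow> j \<in> I \<Longrightarrow> i \<noteq> j \<Longrightarrow> z i \<notin> span {z j}" and nz: "\<And>i. i \<in> I \<Longrightarrow> z i \<noteq> 0"
    and E: "E \<subseteq> I" and w: "norm w = 1" "\<And>e. e \<in> E \<Longrightarrow> w \<bullet> z e = 0"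
    and s: "s0 \<in> I - E" "s1 \<in> I - E" "s2 \<in> I - E" "s0 \<noteq> s1" "s0 \<noteq> s2" "s1 \<noteq> s2"
    and wspan: "w \<in> span {z s0 + z s1}"
    and perm: "\<And>i. i \<in> I \<Longrightarrow> \<exists>i'\<in>I. \<exists>\<epsilon>. \<bar>\<epsilon>\<bar> = 1 \<and> z i - (2 * (z i \<bullet> w)) *\<^sub>R w = \<epsilon> *\<^sub>R z i'"
    and R01: "z s0 - (2 * (z s0 \<bullet> w)) *\<^sub>R w = - z s1" "z s1 - (2 * (z s1 \<bullet> w)) *\<^sub>R w = - z s0"
    and last: "\<And>v. (\<And>e. e \<in> E \<Longrightarrow> v \<bullet> z e = 0) \<Longrightarrow> v \<bullet> w = 0 \<Longrightarrow> v \<bullet> z s2 = 0 \<Longrightarrow> v = 0"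
    and cub: "(\<exists>k\<in>E. \<forall>a. a \<noteq> 0 \<longrightarrow> a \<bullet> z k = 0 \<longrightarrow> lin_indep {i \<in> I. a \<bullet> z i = 0} z) \<or>
      (\<forall>a. a \<noteq> 0 \<longrightarrow> lin_indep {i \<in> I. a \<bullet> z i = 0} z)"
  shows False
proof -
  have ww: "w \<bullet> w = 1" using w by (simp add: norm_eq_1)
  define R where "R = (\<lambda>x::real^'n. x - (2 * (x \<bullet> w)) *\<^sub>R w)"
  have RR: "R (R x) = x" for x by (simp add: R_def inner_diff_left ww)
  have Rs: "R (c *\<^sub>R x) = c *\<^sub>R R x" for c x by (simp add: R_def scaleR_diff_right mult.left_commute)
  have "\<forall>i\<in>I. \<exists>pe. fst pe \<in> I \<and> \<bar>snd pe\<bar> = 1 \<and> R (z i) = snd pe *\<^sub>R z (fst pe)"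
  proof
    fix i assume "i \<in> I"
    from perm[OF this] obtain i' e where "i' \<in> I" "\<bar>e\<bar> = 1" "R (z i) = e *\<^sub>R z i'" unfolding R_def by blast
    then show "\<exists>pe. fst pe \<in> I \<and> \<bar>snd pe\<bar> = 1 \<and> R (z i) = snd pe *\<^sub>R z (fst pe)"
      by (intro exI[of _ "(i', e)"]) simp
  qed
  from bchoice[OF this] obtain pe where pe: "\<forall>i\<in>I. fst (pe i) \<in> I \<and> \<bar>snd (pe i)\<bar> = 1 \<and> R (z i) = snd (pe i) *\<^sub>R z (fst (pe i))" ..
  define \<pi> where "\<pi> = (\<lambda>i. fst (pe i))"
  define \<epsilon> where "\<epsilon> = (\<lambda>i. snd (pe i))"
  have \<pi>I: "\<pi> i \<in> I" and \<epsilon>1: "\<bar>\<epsilon> i\<bar> = 1" and R\<pi>: "R (z i) = \<epsilon> i *\<^sub>R z (\<pi> i)" if "i \<in> I" for i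
    using pe that by (auto simp: \<pi>_def \<epsilon>_def)
  \<comment> \<open>No two generators are parallel, so the reflection determines the permutation and
    the signs uniquely.\<close>
  have same: "i = j" if "i \<in> I" "j \<in> I" "z i = c *\<^sub>R z j" for i j c
    using np[OF that(1,2)] that(3) by (metis span_base span_mul singletonI)
  have \<pi>_eq: "\<pi> i = j \<and> \<epsilon> i = c" if "i \<in> I" "j \<in> I" "R (z i) = c *\<^sub>R z j" for i j c
  proof -
    have eq: "\<epsilon> i *\<^sub>R z (\<pi> i) = c *\<^sub>R z j" using R\<pi>[OF that(1)] that(3) by simp
    have e0: "\<epsilon> i \<noteq> 0" using \<epsilon>1[OF that(1)] by auto
    then have "z (\<pi> i) = (inverse (\<epsilon> i) * c) *\<^sub>R z j"
      using eq by (metis scaleR_scaleR left_inverse scaleR_one)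
    then have "\<pi> i = j" using same \<pi>I that(1,2) by blast
    with eq nz[OF that(2)] show ?thesis by simp
  qed
  have inj\<pi>: "inj_on \<pi> I"
  proof (rule inj_onI)
    fix i j assume ij: "i \<in> I" "j \<in> I" "\<pi> i = \<pi> j"
    have ej: "\<epsilon> j \<noteq> 0" using \<epsilon>1[OF ij(2)] by auto
    have "R (z i) = (\<epsilon> i * inverse (\<epsilon> j)) *\<^sub>R R (z j)"
      unfolding R\<pi>[OF ij(1)] R\<pi>[OF ij(2)] ij(3) using ej by simp
    then have "R (R (z i)) = R ((\<epsilon> i * inverse (\<epsilon> j)) *\<^sub>R R (z j))" by (rule arg_cong)
    then have "z i = (\<epsilon> i * inverse (\<epsilon> j)) *\<^sub>R z j" unfolding Rs RR .
    then show "i = j" by (rule same[OF ij(1,2)])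
  qed
  have bij: "bij_betw \<pi> I I"
    unfolding bij_betw_def using inj\<pi> endo_inj_surj[OF I _ inj\<pi>] \<pi>I by blast
  have "\<exists>A. finite A \<and> zon I z = {x. \<forall>b\<in>A. b \<bullet> x \<le> 1} \<and> (\<forall>b\<in>A. zon_support I z b = 1) \<and>
     (\<forall>b\<in>A. \<forall>v. b \<bullet> v = 0 \<longrightarrow> v \<in> span (z ` {i \<in> I. b \<bullet> z i = 0}))"
    by (rule zon_facets[OF I int], intro exI conjI ballI allI impI) assumption+
  then obtain A where A0: "finite A" "zon I z = {x. \<forall>b\<in>A. b \<bullet> x \<le> 1}" "\<forall>b\<in>A. zon_support I z b = 1"
    "\<forall>b\<in>A. \<forall>v. b \<bullet> v = 0 \<longrightarrow> v \<in> span (z ` {i \<in> I. b \<bullet> z i = 0})" by (elim exE conjE)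
  have A3: "zon_support I z b = 1" if "b \<in> A" for b using A0(3) that by blast
  have Asp: "v \<in> span (z ` {i \<in> I. b \<bullet> z i = 0})" if "b \<in> A" "b \<bullet> v = 0" for b v
    by (rule A0(4)[THEN bspec, THEN spec, THEN mp, OF that])
  have b0: "b \<noteq> 0" if "b \<in> A" for b using A3[OF that] by (auto simp: zon_support_def)
  have mirror: "z i - (2 * (z i \<bullet> w)) *\<^sub>R w = \<epsilon> i *\<^sub>R z (\<pi> i)" if "i \<in> I" for i using R\<pi>[OF that] by (simp add: R_def)
  have movement: "\<exists>c. c \<bullet> w = 0 \<and> (\<forall>i\<in>I. c \<bullet> z i = d i)"
    if d: "\<And>i. i \<in> I \<Longrightarrow> d (\<pi> i) = \<epsilon> i * d i" "\<And>i. i \<in> I \<Longrightarrow> z i \<in> span {w} \<Longrightarrow> d i = 0"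
      "\<And>b. b \<in> A \<Longrightarrow> b \<bullet> w \<noteq> 0 \<Longrightarrow> \<exists>a. a \<bullet> w = 0 \<and> (\<forall>i\<in>I. b \<bullet> z i = 0 \<longrightarrow> a \<bullet> z i = - (d i * (b \<bullet> w)))" for d :: "nat \<Rightarrow> real"
  proof -
    from mirror_movement_linear[OF I int iso lm A0(1,2) A3 w(1) bij \<epsilon>1 mirror d]
    obtain c where c: "c \<bullet> w = 0" "\<And>i. i \<in> I \<Longrightarrow> c \<bullet> z i = d i" by metis
    have c2: "\<forall>i\<in>I. c \<bullet> z i = d i" by (rule ballI, rule c(2))
    show ?thesis by (rule exI[of _ c], rule conjI, rule c(1), rule c2)
  qed
  have lin: "\<exists>a. a \<bullet> w = 0 \<and> (\<forall>i\<in>I. b \<bullet> z i = 0 \<longrightarrow> a \<bullet> z i = t i)"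
    if "b \<bullet> w \<noteq> 0" "lin_indep {i \<in> I. b \<bullet> z i = 0} z" for b t
  proof -
    have "\<exists>a. a \<bullet> w = 0 \<and> (\<forall>i\<in>{i \<in> I. b \<bullet> z i = 0}. a \<bullet> z i = t i)"
      by (rule functional_vanishing[OF _ that(2) _ that(1)]) (use I in auto)
    then show ?thesis by (elim exE conjE) (rule exI, rule conjI, assumption, blast)
  qed
  \<comment> \<open>When all facets transversal to \<open>w\<close> have independent generators, the
    facet condition holds for every \<open>d\<close>. The values 1 and -1 at \<open>s0\<close> and
    \<open>s1\<close> are compatible, as the reflection exchanges these generators with a minus
    sign. A functional inducing them would vanish on \<open>E\<close>, \<open>w\<close> and
    \<open>z s2\<close>, hence be 0.\<close>
  have pair: False if all_lin: "\<And>b. b \<in> A \<Longrightarrow> b \<bullet> w \<noteq> 0 \<Longrightarrow> lin_indep {i \<in> I. b \<bullet> z i = 0} z"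
  proof -
    define d where "d = (\<lambda>i. if i = s0 then 1 else if i = s1 then -1 else (0::real))"
    have sI: "s0 \<in> I" "s1 \<in> I" "s2 \<in> I" using s by auto
    have p0: "\<pi> s0 = s1 \<and> \<epsilon> s0 = -1" by (rule \<pi>_eq) (use sI R01 in \<open>simp_all add: R_def\<close>)
    have p1: "\<pi> s1 = s0 \<and> \<epsilon> s1 = -1" by (rule \<pi>_eq) (use sI R01 in \<open>simp_all add: R_def\<close>)
    have d1: "d (\<pi> i) = \<epsilon> i * d i" if i: "i \<in> I" for i
    proof (cases "i = s0 \<or> i = s1")
      case True then show ?thesis using p0 p1 s(4) by (auto simp: d_def)
    next
      case False
      then have "\<pi> i \<noteq> s0" "\<pi> i \<noteq> s1" using inj_onD[OF inj\<pi>] p0 p1 i sI by metis+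
      then show ?thesis using False by (simp add: d_def)
    qed
    obtain r where r: "w = r *\<^sub>R (z s0 + z s1)" using wspan by (auto simp: span_singleton)
    \<comment> \<open>If one of \<open>z s0\<close>, \<open>z s1\<close> were parallel to
      \<open>w\<close>, that is to their sum, the two would be parallel to each other.\<close>
    have nospan: "z i \<notin> span {w}" if ij: "(i = s0 \<and> j = s1) \<or> (i = s1 \<and> j = s0)" for i j
    proof
      assume "z i \<in> span {w}"
      then obtain k where k: "z i = k *\<^sub>R w" by (auto simp: span_singleton)
      have "w = r *\<^sub>R (z i + z j)" using r ij by (auto simp: add.commute)
      then have zi: "z i = (k * r) *\<^sub>R (z i + z j)" using k by (metis scaleR_scaleR)
      then have e: "(1 - k * r) *\<^sub>R z i = (k * r) *\<^sub>R z j" by (simp add: scaleR_diff_left scaleR_add_right)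
        (metis add_diff_cancel_left' scaleR_add_right)
      have kr: "k * r \<noteq> 0" using zi nz[of i] ij sI by auto
      then have "z j = (inverse (k * r) * (1 - k * r)) *\<^sub>R z i"
        using e by (metis scaleR_scaleR left_inverse scaleR_one)
      then show False using same[of j i] ij sI s(4) by blast
    qed
    have d2: "d i = 0" if "i \<in> I" "z i \<in> span {w}" for i
      using nospan[of s0 s1] nospan[of s1 s0] that by (auto simp: d_def)
    have "\<exists>c. c \<bullet> w = 0 \<and> (\<forall>i\<in>I. c \<bullet> z i = d i)"
      by (rule movement[OF d1 d2 lin[OF _ all_lin]])
    then obtain c where c: "c \<bullet> w = 0" "\<forall>i\<in>I. c \<bullet> z i = d i" by blast
    have "c = 0"
    proof (rule last)
      show "c \<bullet> z e = 0" if "e \<in> E" for e using c(2) that E s by (auto simp: d_def)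
      show "c \<bullet> z s2 = 0" using c(2) s by (auto simp: d_def)
    qed (rule c(1))
    then show False using c(2) sI by (auto simp: d_def)
  qed
  from cub show False
  proof
    assume "\<forall>a. a \<noteq> 0 \<longrightarrow> lin_indep {i \<in> I. a \<bullet> z i = 0} z"
    then show False using pair b0 by blast
  next
    assume "\<exists>k\<in>E. \<forall>a. a \<noteq> 0 \<longrightarrow> a \<bullet> z k = 0 \<longrightarrow> lin_indep {i \<in> I. a \<bullet> z i = 0} z"
    then obtain k where k: "k \<in> E" "\<And>a. a \<noteq> 0 \<Longrightarrow> a \<bullet> z k = 0 \<Longrightarrow> lin_indep {i \<in> I. a \<bullet> z i = 0} z" by blast
    have kI: "k \<in> I" using k(1) E by blast
    have wk: "w \<bullet> z k = 0" by (rule w(2)[OF k(1)])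
    show False
    proof (cases "\<exists>g. g \<noteq> 0 \<and> (\<forall>i\<in>I - {k}. g \<bullet> z i = 0)")
      \<comment> \<open>Here \<open>g\<close> also vanishes at \<open>w\<close>. The generators of a
        transversal facet that omits \<open>z k\<close> would lie with \<open>w\<close> in the
        hyperplane of \<open>g\<close>, although together they span the space. So every facet
        transversal to \<open>w\<close> has \<open>z k\<close> as a generator and is a
        parallelepiped.\<close>
      case True
      then obtain g where g: "g \<noteq> 0" "\<And>i. i \<in> I - {k} \<Longrightarrow> g \<bullet> z i = 0" by blast
      have gw: "g \<bullet> w = 0"
      proof -
        obtain r where r: "w = r *\<^sub>R (z s0 + z s1)" using wspan by (auto simp: span_singleton)
        have "g \<bullet> z s0 = 0" "g \<bullet> z s1 = 0" using g(2) s k(1) by auto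
        then show ?thesis by (simp add: r inner_add_right)
      qed
      show False
      proof (rule pair)
        fix b assume b: "b \<in> A" "b \<bullet> w \<noteq> 0"
        show "lin_indep {i \<in> I. b \<bullet> z i = 0} z"
        proof (cases "b \<bullet> z k = 0")
          case True then show ?thesis using k(2) b0[OF b(1)] by blast
        next
          case False
          have sub: "span (z ` {i \<in> I. b \<bullet> z i = 0}) \<subseteq> {v. g \<bullet> v = 0}"
            by (rule span_minimal) (use g(2) False in \<open>auto simp: subspace_hyperplane\<close>)
          have "g \<bullet> v = 0" for v
          proof -
            let ?u = "v - ((b \<bullet> v) / (b \<bullet> w)) *\<^sub>R w"
            have "b \<bullet> ?u = 0" using b(2) by (simp add: inner_diff_right)
            then have "g \<bullet> ?u = 0" using Asp[OF b(1)] sub by blast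
            then show ?thesis using gw by (simp add: inner_diff_right)
          qed
          then have "g \<bullet> g = 0" by blast
          then show ?thesis using g(1) by simp
        qed
      qed
    next
      \<comment> \<open>Facets with generator \<open>z k\<close> are parallelepipeds, and on the
        generators of all others \<open>d\<close> vanishes, so \<open>a = 0\<close> works there. A
        functional inducing \<open>d\<close> would be nonzero and vanish on all generators except
        \<open>z k\<close>, which this case excludes.\<close>
      case False
      define d where "d = (\<lambda>i. if i = k then 1 else (0::real))"
      have pk: "\<pi> k = k \<and> \<epsilon> k = 1"
        by (rule \<pi>_eq) (use kI wk in \<open>simp_all add: R_def inner_commute[of "z k" w]\<close>)
      have d1: "d (\<pi> i) = \<epsilon> i * d i" if i: "i \<in> I" for i
      proof (cases "i = k")
        case True then show ?thesis using pk by (simp add: d_def)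
      next
        case False
        then have "\<pi> i \<noteq> k" using inj_onD[OF inj\<pi>] pk i kI by metis
        then show ?thesis using False by (simp add: d_def)
      qed
      have d2: "d i = 0" if zi: "i \<in> I" "z i \<in> span {w}" for i
      proof (cases "i = k")
        case True
        then obtain r where r: "z k = r *\<^sub>R w" using zi(2) by (auto simp: span_singleton)
        then have "r = 0" using wk ww by simp
        then show ?thesis using r nz[OF kI] by simp
      qed (simp add: d_def)
      have d3: "\<exists>a. a \<bullet> w = 0 \<and> (\<forall>i\<in>I. b \<bullet> z i = 0 \<longrightarrow> a \<bullet> z i = - (d i * (b \<bullet> w)))" if b: "b \<in> A" "b \<bullet> w \<noteq> 0" for b
      proof (cases "b \<bullet> z k = 0")
        case True
        show ?thesis by (rule lin[OF b(2) k(2)[OF b0[OF b(1)] True]])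
      next
        case False
        then show ?thesis by (intro exI[of _ 0]) (auto simp: d_def)
      qed
      have "\<exists>c. c \<bullet> w = 0 \<and> (\<forall>i\<in>I. c \<bullet> z i = d i)" by (rule movement[OF d1 d2 d3])
      then obtain c where c: "\<forall>i\<in>I. c \<bullet> z i = d i" by blast
      have "c \<noteq> 0" using c kI by (auto simp: d_def)
      moreover have "\<forall>i\<in>I - {k}. c \<bullet> z i = 0" using c by (simp add: d_def)
      ultimately show False using False by blast
    qed
  qed
qed

lemma lin_indep_card_le:
  fixes z :: "nat \<Rightarrow> 'a::euclidean_space"
  assumes "finite J" "lin_indep J z"
  shows "card J \<le> DIM('a)"
  using lin_indep_inj_independent[OF assms] independent_bound[of "z ` J"] by (simp add: card_image)

lemma lin_indep_subset_basis:
  fixes z :: "nat \<Rightarrow> 'a::euclidean_space"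
  assumes I: "finite I" and sp: "span (z ` I) = UNIV" and inj: "inj_on z I" and k: "k \<in> I" "z k \<noteq> 0"
  shows "\<exists>J\<subseteq>I. k \<in> J \<and> lin_indep J z \<and> card J = DIM('a)"
proof -
  obtain B where B: "{z k} \<subseteq> B" "B \<subseteq> z ` I" "independent B" "z ` I \<subseteq> span B"
    by (rule maximal_independent_subset_extend[of "{z k}" "z ` I"]) (use k in auto)
  define J where "J = {i \<in> I. z i \<in> B}"
  have zJ: "z ` J = B" using B(2) by (auto simp: J_def)
  have JI: "J \<subseteq> I" by (auto simp: J_def)
  have injJ: "inj_on z J" by (rule inj_on_subset[OF inj JI])
  have fJ: "finite J" using I JI by (rule rev_finite_subset)
  have "span B = UNIV" using span_mono[OF B(4)] sp by (simp add: span_span top.extremum_unique)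
  then have "card B = DIM('a)" using B(3) dim_eq_card[of B UNIV] by (simp add: dim_UNIV)
  then have "card J = DIM('a)" using card_image[OF injJ] zJ by simp
  moreover have "lin_indep J z" by (rule lin_indepI[OF fJ injJ]) (simp add: zJ B(3))
  moreover have "k \<in> J" using k(1) B(1) by (simp add: J_def)
  ultimately show ?thesis using JI by blast
qed

text \<open>Two members of the dual basis; they span the plane of functionals that vanish on the
  remaining basis vectors, which is the plane of normals of a belt.\<close>

lemma dual_pair:
  fixes z :: "nat \<Rightarrow> 'a::euclidean_space"
  assumes J: "finite J" "lin_indep J z" "card J = DIM('a)" and uv: "u \<in> J" "v \<in> J" "u \<noteq> v"
  shows "\<exists>q1 q2. (\<forall>e\<in>J - {u, v}. q1 \<bullet> z e = 0 \<and> q2 \<bullet> z e = 0) \<and> q1 \<bullet> z u = 1 \<and> q1 \<bullet> z v = 0 \<and>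
    q2 \<bullet> z u = 0 \<and> q2 \<bullet> z v = 1 \<and>
    (\<forall>a. (\<forall>e\<in>J - {u, v}. a \<bullet> z e = 0) \<longrightarrow> a = (a \<bullet> z u) *\<^sub>R q1 + (a \<bullet> z v) *\<^sub>R q2)"
proof -
  have "\<exists>q. \<forall>i\<in>J. q \<bullet> z i = (if i = l then 1 else 0)" for l
    by (rule lin_indep_functional[OF J(1,2), of "\<lambda>i. if i = l then 1 else 0"]) blast
  then obtain q where q: "\<forall>i\<in>J. q l \<bullet> z i = (if i = l then 1 else 0)" for l by metis
  have "a = (a \<bullet> z u) *\<^sub>R q u + (a \<bullet> z v) *\<^sub>R q v" if a: "\<forall>e\<in>J - {u, v}. a \<bullet> z e = 0" for a
  proof (rule ccontr)
    let ?b = "a - (a \<bullet> z u) *\<^sub>R q u - (a \<bullet> z v) *\<^sub>R q v"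
    assume "a \<noteq> (a \<bullet> z u) *\<^sub>R q u + (a \<bullet> z v) *\<^sub>R q v"
    then have "?b \<noteq> 0" by (simp add: diff_diff_eq)
    moreover have "?b \<bullet> z j = 0" if j: "j \<in> J" for j
      using j a q[of u] q[of v] uv by (cases "j = u"; cases "j = v") (auto simp: inner_diff_left)
    ultimately have "card J < DIM('a)" using lin_indep_card_hyperplane[OF J(1,2)] by blast
    then show False using J(3) by simp
  qed
  then show ?thesis using q[of u] q[of v] uv by (intro exI[of _ "q u"] exI[of _ "q v"]) simp
qed

text \<open>Removing \<open>u\<close> and \<open>v\<close> from the basis \<open>J\<close> leaves
  the common generators \<open>E\<close> of a belt. Sorting by slope requires a functional in the
  plane of normals that is positive on all other generators; a generic functional becomes such after
  changing signs of generators.\<close>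

lemma belt_impossible:
  fixes z :: "nat \<Rightarrow> real^'n::finite"
  assumes I: "finite I" and int: "interior (zon I z) \<noteq> {}"
    and iso: "isotropic (zon I z)"
    and lm: "local_maximizer_isotropic_constant {K. convex_body K \<and> centrally_symmetric K} (zon I z)"
    and np: "\<And>i j. i \<in> I \<Longrightarrow> j \<in> I \<Longrightarrow> i \<noteq> j \<Longrightarrow> z i \<notin> span {z j}" and nz: "\<And>i. i \<in> I \<Longrightarrow> z i \<noteq> 0"
    and big: "CARD('n) < card I"
    and J: "J \<subseteq> I" "lin_indep J z" "card J = CARD('n)" and uv: "u \<in> J" "v \<in> J" "u \<noteq> v"
    and cub: "(\<exists>k\<in>J - {u, v}. \<forall>a. a \<noteq> 0 \<longrightarrow> a \<bullet> z k = 0 \<longrightarrow> lin_indep {i \<in> I. a \<bullet> z i = 0} z) \<or>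
      (\<forall>a. a \<noteq> 0 \<longrightarrow> lin_indep {i \<in> I. a \<bullet> z i = 0} z)"
  shows False
proof -
  define E where "E = J - {u, v}"
  have fJ: "finite J" using I J(1) by (rule rev_finite_subset)
  have EI: "E \<subseteq> I" using J(1) by (auto simp: E_def)
  have fE: "finite E" using fJ by (simp add: E_def)
  have uvE: "u \<notin> E" "v \<notin> E" by (auto simp: E_def)
  have "J = insert u (insert v E)" using uv by (auto simp: E_def)
  then have cE: "card E + 2 = CARD('n)" using J(3) uv(3) uvE fE by simp
  have "\<exists>q1 q2. (\<forall>e\<in>J - {u, v}. q1 \<bullet> z e = 0 \<and> q2 \<bullet> z e = 0) \<and> q1 \<bullet> z u = 1 \<and> q1 \<bullet> z v = 0 \<and>
    q2 \<bullet> z u = 0 \<and> q2 \<bullet> z v = 1 \<and>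
    (\<forall>a. (\<forall>e\<in>J - {u, v}. a \<bullet> z e = 0) \<longrightarrow> a = (a \<bullet> z u) *\<^sub>R q1 + (a \<bullet> z v) *\<^sub>R q2)"
    by (rule dual_pair[OF fJ J(2) _ uv]) (simp add: J(3))
  then obtain q1 q2 where q0: "\<forall>e\<in>E. q1 \<bullet> z e = 0 \<and> q2 \<bullet> z e = 0"
    and quv: "q1 \<bullet> z u = 1" "q1 \<bullet> z v = 0" "q2 \<bullet> z u = 0" "q2 \<bullet> z v = 1"
    and qspan: "\<forall>a. (\<forall>e\<in>E. a \<bullet> z e = 0) \<longrightarrow> a = (a \<bullet> z u) *\<^sub>R q1 + (a \<bullet> z v) *\<^sub>R q2"
    unfolding E_def by (elim exE conjE)
  have cubE: "lin_indep {i \<in> I. a \<bullet> z i = 0} z" if "a \<noteq> 0" "\<And>e. e \<in> E \<Longrightarrow> a \<bullet> z e = 0" for a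
    using cub that unfolding E_def by blast
  have q2_0: "q2 \<noteq> 0" using quv(4) by auto
  \<comment> \<open>A generator killed by both functionals would lie with \<open>u\<close> and
    \<open>E\<close> in the hyperplane of \<open>q2\<close>, which holds at most
    \<open>n - 1\<close> generators.\<close>
  have nonzero: "q1 \<bullet> z l \<noteq> 0 \<or> q2 \<bullet> z l \<noteq> 0" if l: "l \<in> I - E" for l
  proof (rule ccontr)
    assume *: "\<not> (q1 \<bullet> z l \<noteq> 0 \<or> q2 \<bullet> z l \<noteq> 0)"
    let ?H = "{i \<in> I. q2 \<bullet> z i = 0}"
    have fH: "finite ?H" using I by simp
    have "lin_indep ?H z" using cubE[OF q2_0] q0 by blast
    then have "card ?H < CARD('n)" using lin_indep_card_hyperplane[OF fH _ _ q2_0] by simp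
    moreover have "insert l (insert u E) \<subseteq> ?H" using * l uv J(1) EI q0 quv by auto
    then have "card (insert l (insert u E)) \<le> card ?H" by (rule card_mono[OF fH])
    moreover have "l \<noteq> u" using * quv(1) by auto
    then have "card (insert l (insert u E)) = card E + 2" using l uvE fE by simp
    ultimately show False using cE by simp
  qed
  \<comment> \<open>Each generator \<open>l\<close> outside \<open>E\<close> with
    \<open>q2 \<bullet> z l\<close> nonzero forbids one value of \<open>t\<close>, at which
    \<open>p \<bullet> z l\<close> would vanish.\<close>
  obtain t where t: "t \<notin> (\<lambda>l. - (q1 \<bullet> z l) / (q2 \<bullet> z l)) ` (I - E)"
    using ex_new_if_finite[of "(\<lambda>l. - (q1 \<bullet> z l) / (q2 \<bullet> z l)) ` (I - E)"] I infinite_UNIV_char_0 by blast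
  define p where "p = q1 + t *\<^sub>R q2"
  have p0: "p \<bullet> z l \<noteq> 0" if l: "l \<in> I - E" for l
  proof
    assume "p \<bullet> z l = 0"
    then have e: "q1 \<bullet> z l + t * (q2 \<bullet> z l) = 0" by (simp add: p_def inner_add_left)
    with nonzero[OF l] have "q2 \<bullet> z l \<noteq> 0" by auto
    with e have "t = - (q1 \<bullet> z l) / (q2 \<bullet> z l)" by (simp add: field_simps)
    with t l show False by blast
  qed
  \<comment> \<open>Changing the sign of a generator changes neither the zonotope nor any condition
    on faces, but makes \<open>p\<close> positive on all generators outside
    \<open>E\<close>.\<close>
  define \<sigma> where "\<sigma> = (\<lambda>i. if i \<in> I - E then sgn (p \<bullet> z i) else 1)"
  have \<sigma>1: "\<bar>\<sigma> i\<bar> = 1" "\<sigma> i \<noteq> 0" for i using p0[of i] by (auto simp: \<sigma>_def abs_sgn_eq sgn_zero_iff)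
  define y where "y = (\<lambda>i. \<sigma> i *\<^sub>R z i)"
  have y0: "a \<bullet> y i = 0 \<longleftrightarrow> a \<bullet> z i = 0" for a i using \<sigma>1 by (simp add: y_def)
  have Jy: "{i \<in> I. a \<bullet> y i = 0} = {i \<in> I. a \<bullet> z i = 0}" for a by (simp add: y0)
  have "zon_support I y a = zon_support I z a" for a
    by (simp add: zon_support_def y_def abs_mult \<sigma>1)
  then have zy: "zon I y = zon I z" by (intro zon_eq_iff_support I)
  have liny: "lin_indep {i \<in> I. a \<bullet> y i = 0} y" if "lin_indep {i \<in> I. a \<bullet> z i = 0} z" for a
    unfolding Jy unfolding y_def by (rule lin_indep_scale[OF that \<sigma>1(2)])
  have npy: "y i \<notin> span {y j}" if ij: "i \<in> I" "j \<in> I" "i \<noteq> j" for i j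
  proof
    assume "y i \<in> span {y j}"
    then have "\<sigma> i *\<^sub>R z i \<in> span {\<sigma> j *\<^sub>R z j}" by (simp add: y_def)
    moreover have "span {\<sigma> j *\<^sub>R z j} \<subseteq> span {z j}"
      by (intro span_minimal subspace_span) (simp add: span_mul span_base)
    ultimately have "\<sigma> i *\<^sub>R z i \<in> span {z j}" by (rule rev_subsetD)
    then have "inverse (\<sigma> i) *\<^sub>R \<sigma> i *\<^sub>R z i \<in> span {z j}" by (rule span_mul)
    then show False using np[OF ij] \<sigma>1(2)[of i] by simp
  qed
  have nzy: "y i \<noteq> 0" if "i \<in> I" for i using nz[OF that] \<sigma>1(2)[of i] by (simp add: y_def)
  have inty: "interior (zon I y) \<noteq> {}" and isoy: "isotropic (zon I y)"
    and lmy: "local_maximizer_isotropic_constant {K. convex_body K \<and> centrally_symmetric K} (zon I y)"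
    using int iso lm by (simp_all add: zy)
  have c1: "lin_indep {i \<in> I. a \<bullet> y i = 0} y" if "a \<noteq> 0" "\<And>e. e \<in> E \<Longrightarrow> a \<bullet> y e = 0" for a
    by (rule liny, rule cubE[OF that(1)]) (use that(2) y0 in blast)
  have c2: "p \<bullet> y e = 0" "q2 \<bullet> y e = 0" if "e \<in> E" for e
    unfolding y0 using q0 that by (simp_all add: p_def inner_add_left)
  have c3: "\<exists>\<alpha> \<beta>. a = \<alpha> *\<^sub>R p + \<beta> *\<^sub>R q2" if a: "\<And>e. e \<in> E \<Longrightarrow> a \<bullet> y e = 0" for a
  proof -
    have "a = (a \<bullet> z u) *\<^sub>R q1 + (a \<bullet> z v) *\<^sub>R q2" using qspan a y0 by blast
    also have "\<dots> = (a \<bullet> z u) *\<^sub>R p + (a \<bullet> z v - (a \<bullet> z u) * t) *\<^sub>R q2"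
      by (simp add: p_def scaleR_add_right scaleR_diff_left)
    finally show ?thesis by blast
  qed
  have c4: "\<alpha> = 0 \<and> \<beta> = 0" if e: "\<alpha> *\<^sub>R p + \<beta> *\<^sub>R q2 = 0" for \<alpha> \<beta>
  proof -
    have "(\<alpha> *\<^sub>R p + \<beta> *\<^sub>R q2) \<bullet> z u = 0" "(\<alpha> *\<^sub>R p + \<beta> *\<^sub>R q2) \<bullet> z v = 0" unfolding e by simp_all
    then show ?thesis by (simp add: p_def inner_add_left quv)
  qed
  have c5: "p \<bullet> y l > 0" if l: "l \<in> I - E" for l
  proof -
    have "p \<bullet> y l = sgn (p \<bullet> z l) * (p \<bullet> z l)" using l by (simp add: y_def \<sigma>_def)
    then have "p \<bullet> y l = \<bar>p \<bullet> z l\<bar>" by (metis abs_sgn mult.commute)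
    then show ?thesis using p0[OF l] by simp
  qed
  have refl_ex: "\<exists>w s0 s1 s2. norm w = 1 \<and> (\<forall>e\<in>E. w \<bullet> y e = 0) \<and> {s0, s1, s2} \<subseteq> I - E \<and> s0 \<noteq> s1 \<and> s0 \<noteq> s2 \<and> s1 \<noteq> s2 \<and>
    w \<in> span {y s0 + y s1} \<and>
    (\<forall>i\<in>I. \<exists>i'\<in>I. \<exists>\<epsilon>. \<bar>\<epsilon>\<bar> = 1 \<and> y i - (2 * (y i \<bullet> w)) *\<^sub>R w = \<epsilon> *\<^sub>R y i') \<and>
    y s0 - (2 * (y s0 \<bullet> w)) *\<^sub>R w = - y s1 \<and> y s1 - (2 * (y s1 \<bullet> w)) *\<^sub>R w = - y s0 \<and>
    (\<forall>v. (\<forall>e\<in>E. v \<bullet> y e = 0) \<longrightarrow> v \<bullet> w = 0 \<longrightarrow> v \<bullet> y s2 = 0 \<longrightarrow> v = 0)"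
    by (rule belt_reflection[OF I inty isoy lmy EI cE c1 big c2 c3 c4 c5])
  then obtain w s0 s1 s2 where w: "norm w = 1" "\<forall>e\<in>E. w \<bullet> y e = 0" and s: "{s0, s1, s2} \<subseteq> I - E" "s0 \<noteq> s1" "s0 \<noteq> s2" "s1 \<noteq> s2"
    and wsp: "w \<in> span {y s0 + y s1}"
    and perm: "\<forall>i\<in>I. \<exists>i'\<in>I. \<exists>\<epsilon>. \<bar>\<epsilon>\<bar> = 1 \<and> y i - (2 * (y i \<bullet> w)) *\<^sub>R w = \<epsilon> *\<^sub>R y i'"
    and R01: "y s0 - (2 * (y s0 \<bullet> w)) *\<^sub>R w = - y s1" "y s1 - (2 * (y s1 \<bullet> w)) *\<^sub>R w = - y s0"
    and last: "\<forall>v. (\<forall>e\<in>E. v \<bullet> y e = 0) \<longrightarrow> v \<bullet> w = 0 \<longrightarrow> v \<bullet> y s2 = 0 \<longrightarrow> v = 0"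
    by (elim exE conjE)
  have sI: "s0 \<in> I - E" "s1 \<in> I - E" "s2 \<in> I - E" using s(1) by auto
  have cuby: "(\<exists>k\<in>E. \<forall>a. a \<noteq> 0 \<longrightarrow> a \<bullet> y k = 0 \<longrightarrow> lin_indep {i \<in> I. a \<bullet> y i = 0} y) \<or>
      (\<forall>a. a \<noteq> 0 \<longrightarrow> lin_indep {i \<in> I. a \<bullet> y i = 0} y)"
    using cub liny unfolding E_def[symmetric] y0 by blast
  show False
    by (rule belt_contradiction[OF I inty isoy lmy npy nzy EI w(1) bspec[OF w(2)] sI s(2-4) wsp bspec[OF perm] R01 _ cuby])
      (use last in blast)+
qed

section \<open>Conclusion\<close>

text \<open>The generators span, so there are at least \<open>n\<close> of them; a surplus is
  excluded by a belt of parallelepipeds. Two non-parallel generators already require dimension at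
  least 2.\<close>

lemma card_generators:
  fixes z :: "nat \<Rightarrow> real^'n::finite"
  assumes I: "finite I" and int: "interior (zon I z) \<noteq> {}"
    and iso: "isotropic (zon I z)"
    and lm: "local_maximizer_isotropic_constant {K. convex_body K \<and> centrally_symmetric K} (zon I z)"
    and np: "\<And>i j. i \<in> I \<Longrightarrow> j \<in> I \<Longrightarrow> i \<noteq> j \<Longrightarrow> z i \<notin> span {z j}" and nz: "\<And>i. i \<in> I \<Longrightarrow> z i \<noteq> 0"
    and k: "k \<in> I" and cub: "\<And>a. a \<noteq> 0 \<Longrightarrow> a \<bullet> z k = 0 \<Longrightarrow> lin_indep {i \<in> I. a \<bullet> z i = 0} z"
  shows "card I = CARD('n)"
proof (rule ccontr)
  assume ne: "card I \<noteq> CARD('n)"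
  have sp: "span (z ` I) = UNIV" by (rule zon_interior_span[OF int])
  have inj: "inj_on z I"
  proof (rule inj_onI, rule ccontr)
    fix i j assume ij: "i \<in> I" "j \<in> I" "z i = z j" "i \<noteq> j"
    show False using np[OF ij(1,2,4)] ij(3) by (simp add: span_base)
  qed
  have "\<exists>J\<subseteq>I. k \<in> J \<and> lin_indep J z \<and> card J = DIM(real^'n)"
    by (rule lin_indep_subset_basis[OF I sp inj k nz[OF k]])
  then obtain J where J: "J \<subseteq> I" "k \<in> J" "lin_indep J z" "card J = CARD('n)" by auto
  have fJ: "finite J" using I J(1) by (rule rev_finite_subset)
  have big: "CARD('n) < card I" using card_mono[OF I J(1)] J(4) ne by simp
  have pair: "lin_indep {i, j} z" if "i \<in> I" "j \<in> I" "i \<noteq> j" for i j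
    by (rule lin_indep_pair[OF np[OF that] nz[OF that(2)]])
  have "2 \<le> card I" using big zero_less_card_finite[where 'a='n] by linarith
  then obtain T where "T \<subseteq> I" "card T = 2" using obtain_subset_with_card_n by metis
  then obtain i j where "i \<in> I" "j \<in> I" "i \<noteq> j" by (auto simp: card_2_iff)
  from lin_indep_card_le[OF _ pair[OF this]] \<open>i \<noteq> j\<close> have n2: "2 \<le> CARD('n)" by simp
  show False
  proof (cases "CARD('n) = 2")
    \<comment> \<open>In the plane a nonzero functional vanishes on at most one generator, so every
      edge qualifies and \<open>E\<close> is empty.\<close>
    case True
    have "card J = 2" using J(4) True by (rule trans)
    then obtain u v where uv: "J = {u, v}" "u \<noteq> v" by (auto simp: card_2_iff)
    have "lin_indep {i \<in> I. a \<bullet> z i = 0} z" if a: "a \<noteq> 0" for a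
    proof (cases "{i \<in> I. a \<bullet> z i = 0} = {}")
      case empty: True
      show ?thesis unfolding empty by (simp add: lin_indep_def)
    next
      case False
      then obtain i where i: "i \<in> I" "a \<bullet> z i = 0" by blast
      have "j = i" if j: "j \<in> I" "a \<bullet> z j = 0" for j
      proof (rule ccontr)
        assume ji: "j \<noteq> i"
        have "card {j, i} < DIM(real^'n)"
          by (rule lin_indep_card_hyperplane[OF _ pair[OF j(1) i(1) ji] _ a]) (use i j in auto)
        then show False using True ji by simp
      qed
      then have "{i \<in> I. a \<bullet> z i = 0} = {i}" using i by blast
      then show ?thesis using nz[OF i(1)] by (simp add: lin_indep_def)
    qed
    then show False
      by (intro belt_impossible[OF I int iso lm np nz big J(1,3,4), of u v]) (use uv in auto)
  next
    \<comment> \<open>From dimension 3 on, \<open>u\<close> and \<open>v\<close> can be chosen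
      different from \<open>k\<close>; then \<open>k\<close> lies in \<open>E\<close> and the whole
      belt lies in the zone.\<close>
    case False
    then have "2 \<le> card (J - {k})" using n2 J(2,4) by (simp add: card_Diff_singleton)
    then obtain T where T: "T \<subseteq> J - {k}" "card T = 2" using obtain_subset_with_card_n by metis
    then obtain u v where uv: "u \<in> J - {k}" "v \<in> J - {k}" "u \<noteq> v" by (auto simp: card_2_iff)
    have "k \<in> J - {u, v}" using uv J(2) by auto
    then show False
      by (intro belt_impossible[OF I int iso lm np nz big J(1,3,4), of u v]) (use uv cub in blast)+
  qed
qed

section \<open>Parallelotopes and cubes\<close>

lemma cube_of_orthogonal_generators:
  fixes z :: "nat \<Rightarrow> real^'n::finite"
  assumes I: "finite I" "card I = CARD('n)" and r: "r > 0"
    and orth: "\<And>i j. i \<in> I \<Longrightarrow> j \<in> I \<Longrightarrow> z i \<bullet> z j = (if i = j then r\<^sup>2 else 0)"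
  shows "cube (zon I z)"
proof -
  obtain h where h: "bij_betw h (UNIV :: 'n set) I"
    using finite_same_card_bij[of "UNIV :: 'n set" I] I by auto
  have hI: "h k \<in> I" for k using h by (auto simp: bij_betw_def)
  have injh: "inj h" using h by (simp add: bij_betw_def)
  define y where "y = (\<lambda>k. inverse r *\<^sub>R z (h k))"
  define f where "f = (\<lambda>\<xi>::real^'n. \<Sum>k\<in>UNIV. (\<xi> $ k) *\<^sub>R y k)"
  have zy: "z (h k) = r *\<^sub>R y k" for k using r by (simp add: y_def)
  have yy: "y k \<bullet> y l = (if k = l then 1 else 0)" for k l
    unfolding y_def inner_scaleR_left inner_scaleR_right orth[OF hI hI] inj_eq[OF injh]
    using r by (simp add: power2_eq_square field_simps)
  have lin: "linear f"
    by (rule linearI) (simp_all add: f_def scaleR_add_left sum.distrib scaleR_sum_right)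
  have "f v \<bullet> f w = v \<bullet> w" for v w
  proof -
    have "f v \<bullet> f w = (\<Sum>k\<in>UNIV. w $ k * (\<Sum>l\<in>UNIV. v $ l * (y l \<bullet> y k)))"
      by (simp only: f_def inner_sum_left inner_scaleR_left inner_sum_right inner_scaleR_right)
    also have "\<dots> = (\<Sum>k\<in>UNIV. v $ k * w $ k)"
      by (intro sum.cong refl) (simp add: yy if_distrib mult.commute cong: if_cong)
    finally show ?thesis by (simp add: inner_vec_def)
  qed
  then have "orthogonal_transformation f" using lin by (simp add: orthogonal_transformation_def)
  moreover have "zon I z = (\<lambda>x. 0 + f x) ` cbox (vec (- r)) (vec r)"
  proof (intro equalityI subsetI)
    fix x assume "x \<in> zon I z"
    then obtain c where c: "x = (\<Sum>i\<in>I. c i *\<^sub>R z i)" "\<forall>i\<in>I. \<bar>c i\<bar> \<le> 1" by (auto simp: zon_def)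
    let ?\<xi> = "\<chi> k. r * c (h k)"
    have "x = (\<Sum>k\<in>UNIV. c (h k) *\<^sub>R z (h k))" unfolding c(1) by (rule sum.reindex_bij_betw[OF h, symmetric])
    also have "\<dots> = f ?\<xi>" by (simp add: f_def zy mult.commute)
    finally have "x = 0 + f ?\<xi>" by simp
    moreover have "?\<xi> \<in> cbox (vec (- r)) (vec r)"
    proof -
      have "\<bar>r * c (h k)\<bar> \<le> r" for k
        using mult_left_mono[OF bspec[OF c(2) hI[of k]], of r] r by (simp add: abs_mult)
      then show ?thesis by (simp add: mem_box_cart abs_le_iff minus_le_iff)
    qed
    ultimately show "x \<in> (\<lambda>x. 0 + f x) ` cbox (vec (- r)) (vec r)" by (rule image_eqI)
  next
    fix x assume "x \<in> (\<lambda>x. 0 + f x) ` cbox (vec (- r)) (vec r)"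
    then obtain \<xi> where \<xi>: "\<xi> \<in> cbox (vec (- r)) (vec r)" "x = f \<xi>" by auto
    define c where "c = (\<lambda>i. inverse r * \<xi> $ inv h i)"
    have ch: "c (h k) = inverse r * \<xi> $ k" for k by (simp add: c_def inv_f_f[OF injh])
    have "inverse r * \<xi> $ k * r = \<xi> $ k" for k using r by simp
    then have "x = (\<Sum>k\<in>UNIV. c (h k) *\<^sub>R z (h k))" by (simp only: \<xi>(2) f_def zy ch scaleR_scaleR)
    also have "\<dots> = (\<Sum>i\<in>I. c i *\<^sub>R z i)" by (rule sum.reindex_bij_betw[OF h])
    also have "\<dots> \<in> zon I z"
    proof (rule zonI)
      fix i assume "i \<in> I"
      then obtain k where k: "i = h k" using h by (auto simp: bij_betw_def)
      have "\<bar>\<xi> $ k\<bar> \<le> r" using \<xi>(1) by (simp add: mem_box_cart abs_le_iff minus_le_iff)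
      then have "\<bar>inverse r * \<xi> $ k\<bar> \<le> 1" using r by (simp add: abs_mult field_simps)
      then show "\<bar>c i\<bar> \<le> 1" by (simp add: k ch)
    qed
    finally show "x \<in> zon I z" .
  qed
  ultimately show ?thesis using r unfolding cube_def by blast
qed

text \<open>A spanning family of \<open>n\<close> generators is independent, so every facet is a
  parallelepiped. Its center is the one generator not parallel to it, and the center conditions
  become orthogonality and equality of lengths.\<close>

lemma parallelotope_cube:
  fixes z :: "nat \<Rightarrow> real^'n::finite"
  assumes I: "finite I" "card I = CARD('n)" and int: "interior (zon I z) \<noteq> {}"
    and iso: "isotropic (zon I z)"
    and lm: "local_maximizer_isotropic_constant {K. convex_body K \<and> centrally_symmetric K} (zon I z)"
    and nz: "\<And>i. i \<in> I \<Longrightarrow> z i \<noteq> 0"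
  shows "cube (zon I z)"
proof -
  have sp: "span (z ` I) = UNIV" by (rule zon_interior_span[OF int])
  have "card (z ` I) \<le> CARD('n)" using card_image_le[OF I(1), of z] I(2) by simp
  then have ind: "independent (z ` I)"
    by (intro card_le_dim_spanning[of _ UNIV]) (use sp I(1) in \<open>simp_all add: dim_UNIV\<close>)
  have "card (z ` I) = CARD('n)" using ind sp dim_eq_card[of "z ` I" UNIV] by (simp add: dim_UNIV)
  then have "inj_on z I" using I by (intro eq_card_imp_inj_on) simp_all
  then have li: "lin_indep I z" using I(1) ind by (intro lin_indepI)
  have "\<exists>\<kappa><1. (\<forall>a j. lin_indep {i \<in> I. a \<bullet> z i = 0} z \<longrightarrow> Suc (card {i \<in> I. a \<bullet> z i = 0}) = CARD('n) \<longrightarrow>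
       j \<in> I \<longrightarrow> a \<bullet> z j = 0 \<longrightarrow> zon_max I z a \<bullet> z j = 0) \<and>
    (\<forall>a. lin_indep {i \<in> I. a \<bullet> z i = 0} z \<longrightarrow> Suc (card {i \<in> I. a \<bullet> z i = 0}) = CARD('n) \<longrightarrow>
       (norm (zon_max I z a))\<^sup>2 + \<kappa> * (\<Sum>i | i \<in> I \<and> a \<bullet> z i = 0. (norm (z i))\<^sup>2) = real CARD('n) + 2)"
    by (rule zon_facet_center[OF I(1) int iso lm]) blast
  then obtain \<kappa> where \<kappa>: "\<kappa> < 1"
    and c1: "\<forall>a j. lin_indep {i \<in> I. a \<bullet> z i = 0} z \<longrightarrow> Suc (card {i \<in> I. a \<bullet> z i = 0}) = CARD('n) \<longrightarrow>
       j \<in> I \<longrightarrow> a \<bullet> z j = 0 \<longrightarrow> zon_max I z a \<bullet> z j = 0"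
    and c2: "\<forall>a. lin_indep {i \<in> I. a \<bullet> z i = 0} z \<longrightarrow> Suc (card {i \<in> I. a \<bullet> z i = 0}) = CARD('n) \<longrightarrow>
       (norm (zon_max I z a))\<^sup>2 + \<kappa> * (\<Sum>i | i \<in> I \<and> a \<bullet> z i = 0. (norm (z i))\<^sup>2) = real CARD('n) + 2"
    by (elim exE conjE)
  have facet: "(\<forall>l\<in>I. l \<noteq> j \<longrightarrow> z j \<bullet> z l = 0) \<and>
    (norm (z j))\<^sup>2 + \<kappa> * (\<Sum>i\<in>I - {j}. (norm (z i))\<^sup>2) = real CARD('n) + 2" if j: "j \<in> I" for j
  proof -
    have "\<exists>a. \<forall>i\<in>I. a \<bullet> z i = (if i = j then 1 else 0)"
      by (rule lin_indep_functional[OF I(1) li, of "\<lambda>i. if i = j then 1 else 0"]) blast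
    then obtain a where a: "\<forall>i\<in>I. a \<bullet> z i = (if i = j then 1 else 0)" by blast
    have H: "{i \<in> I. a \<bullet> z i = 0} = I - {j}" using a by auto
    have li': "lin_indep {i \<in> I. a \<bullet> z i = 0} z" unfolding H by (rule lin_indep_mono[OF li _ I(1)]) blast
    have cd: "Suc (card {i \<in> I. a \<bullet> z i = 0}) = CARD('n)"
      unfolding H using card_Suc_Diff1[OF I(1) j] I(2) by simp
    \<comment> \<open>All generators but \<open>z j\<close> are orthogonal to the dual vector
      \<open>a\<close>, so they drop out of the facet center.\<close>
    have "zon_max I z a = (\<Sum>i\<in>I. if i = j then z j else 0)"
      unfolding zon_max_def by (rule sum.cong) (use a in auto)
    then have mx: "zon_max I z a = z j" using I(1) j by simp
    have "z j \<bullet> z l = 0" if "l \<in> I" "l \<noteq> j" for l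
      using c1[THEN spec, THEN spec, of a l, THEN mp, THEN mp, OF li' cd] that a unfolding mx by simp
    moreover have "(norm (z j))\<^sup>2 + \<kappa> * (\<Sum>i\<in>I - {j}. (norm (z i))\<^sup>2) = real CARD('n) + 2"
      using c2[THEN spec, of a, THEN mp, THEN mp, OF li' cd] unfolding mx H .
    ultimately show ?thesis by blast
  qed
  define S where "S = (\<Sum>i\<in>I. (norm (z i))\<^sup>2)"
  \<comment> \<open>Solves \<open>(norm (z j))\<^sup>2 + \<kappa> * (S - (norm (z j))\<^sup>2) = n +
    2\<close> for the squared length; the solution does not depend on \<open>j\<close>, and
    \<open>\<kappa> < 1\<close> allows the division.\<close>
  define t where "t = (real CARD('n) + 2 - \<kappa> * S) / (1 - \<kappa>)"
  have nt: "(norm (z j))\<^sup>2 = t" if j: "j \<in> I" for j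
  proof -
    have "S = (norm (z j))\<^sup>2 + (\<Sum>i\<in>I - {j}. (norm (z i))\<^sup>2)"
      unfolding S_def by (rule sum.remove[OF I(1) j])
    then have "(\<Sum>i\<in>I - {j}. (norm (z i))\<^sup>2) = S - (norm (z j))\<^sup>2" by simp
    then have "(norm (z j))\<^sup>2 + \<kappa> * (S - (norm (z j))\<^sup>2) = real CARD('n) + 2" using facet[OF j] by simp
    then have "(1 - \<kappa>) * (norm (z j))\<^sup>2 = real CARD('n) + 2 - \<kappa> * S" by (simp add: algebra_simps)
    then show ?thesis unfolding t_def using \<kappa> by (simp add: field_simps)
  qed
  have "I \<noteq> {}" using I(2) zero_less_card_finite[where 'a='n] by auto
  then obtain j where "j \<in> I" by blast
  then have t0: "t > 0" using nt[of j] nz[of j] by (metis zero_less_norm_iff zero_less_power)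
  have "z i \<bullet> z j = (if i = j then (sqrt t)\<^sup>2 else 0)" if "i \<in> I" "j \<in> I" for i j
    using nt[OF that(1)] facet[OF that(1)] that(2) t0 by (auto simp: power2_norm_eq_inner)
  then show ?thesis using t0 by (intro cube_of_orthogonal_generators[OF I, of "sqrt t"]) simp_all
qed

theorem theorem1p4:
  fixes Z :: "(real ^ 'n) set"
  assumes "zonotope Z"
    and "interior Z \<noteq> {}"
    and "isotropic Z"
    and "local_maximizer_isotropic_constant {K. convex_body K \<and> centrally_symmetric K} Z"
    and "has_cubical_zone Z"
  shows "cube Z"
proof -
  obtain c m z k where irr: "irredundant_generators Z c m z" and k: "k < m"
    and cub: "\<forall>F\<in>zone Z (z k). parallelepiped F"
    using assms(5) unfolding has_cubical_zone_def by blast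
  let ?I = "{..<m}"
  have Zc: "Z = {c} + zon ?I z"
    using irr zon_eq_sum[of ?I z] by (simp add: irredundant_generators_def generated_zonotope_def)
  have Z_iff: "x \<in> Z \<longleftrightarrow> x - c \<in> zon ?I z" for x
    unfolding Zc set_plus_def by (auto intro!: bexI[of _ "x - c"])
  have "convex_body Z" using assms(4) by (simp add: local_maximizer_isotropic_constant_def)
  moreover have "2 *\<^sub>R c - x \<in> Z \<longleftrightarrow> x \<in> Z" for x
    using zon_uminus[of "x - c" ?I z] by (simp add: Z_iff scaleR_2)
  \<comment> \<open>The center of symmetry is the barycenter, which isotropy places at the origin;
    so the translation part of the zonotope is 0.\<close>
  ultimately have "barycenter Z = c" by (rule barycenter_symmetric)
  then have "c = 0" using assms(3) by (simp add: isotropic_def)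
  then have Z: "Z = zon ?I z" using Z_iff by auto
  have nz: "z i \<noteq> 0" if "i \<in> ?I" for i using irr that by (simp add: irredundant_generators_def)
  have np: "z i \<notin> span {z j}" if "i \<in> ?I" "j \<in> ?I" "i \<noteq> j" for i j
    using irr that by (auto simp: irredundant_generators_def span_singleton)
  have kI: "k \<in> ?I" using k by simp
  note Zfacts = assms(2-4)[unfolded Z]
  have li: "lin_indep {i \<in> ?I. a \<bullet> z i = 0} z" if "a \<noteq> 0" "a \<bullet> z k = 0" for a
    by (rule zone_lin_indep[OF finite_lessThan np nz Zfacts(1) _ kI that]) (use cub in \<open>simp_all add: Z\<close>)
  have "card ?I = CARD('n)"
    by (rule card_generators[OF finite_lessThan Zfacts np nz kI li])
  with Zfacts nz show ?thesis by (subst Z) (intro parallelotope_cube finite_lessThan)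
qed

end
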